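(* Let $\Bbbk$ be a field, let $H$ be a weak bialgebra over $\Bbbk$, and let $\mathcal{M}^H$ be the monoidal category of right $H$-comodules. Let $\mathcal{C}^H$ be the category of right $H$-comodule coalgebras, $\mathcal{F}^H$ the category of right $H$-comodule Frobenius algebras, $\mathsf{Coalg}(\mathcal{M}^H)$ the category of coalgebras in $\mathcal{M}^H$, and $\mathsf{FrobAlg}(\mathcal{M}^H)$ the category of Frobenius algebras in $\mathcal{M}^H$. Then there are isomorphisms of categories $$\mathcal{C}^H\cong\mathsf{Coalg}(\mathcal{M}^H)\qquad\text{and}\qquad \mathcal{F}^H\cong\mathsf{FrobAlg}(\mathcal{M}^H).$$
   Context: All structures are $\Bbbk$-linear, $\otimes=\otimes_\Bbbk$, (co)algebras are (co)associative and (co)unital; Sweedler notation $\Delta(h)=h_1\otimes h_2$ and, for a right comodule $M$, $\rho_M(m)=m_{[0]}\otimes m_{[1]}$ is used. **Weak bialgebra.** A tuple $(H,m,u,\Delta,\varepsilon)$ with $(H,m,u)$ a $\Bbbk$-algebra, $(H,\Delta,\varepsilon)$ a $\Bbbk$-coalgebra, such that for all $a,b,c\in H$: $\Delta(ab)=\Delta(a)\Delta(b)$; $\varepsilon(abc)=\varepsilon(ab_1)\varepsilon(b_2c)=\varepsilon(ab_2)\varepsilon(b_1c)$; and $(\Delta\otimes\mathrm{Id})\Delta(1)=(\Delta(1)\otimes 1)(1\otimes\Delta(1))=(1\otimes\Delta(1))(\Delta(1)\otimes 1)$. Define $\varepsilon_s(x)=1_1\,\varepsilon(x1_2)$ and $\varepsilon_t(x)=\varepsilon(1_1x)\,1_2$,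 and put $H_s=\varepsilon_s(H)$, $H_t=\varepsilon_t(H)$ (these are subalgebras of $H$). **Right $H$-comodule.** A right comodule over the coalgebra $(H,\Delta,\varepsilon)$. **The monoidal category $\mathcal{M}^H$.** Objects: right $H$-comodules; morphisms: $H$-comodule maps. The monoidal product of $M,N$ is the subspace $M\,\bar\otimes\, N\subseteq M\otimes N$ of elements fixed by the linear (idempotent) map $m\otimes n\mapsto \varepsilon(m_{[1]}n_{[1]})\,m_{[0]}\otimes n_{[0]}$, with coaction induced by $m\otimes n\mapsto m_{[0]}\otimes n_{[0]}\otimes m_{[1]}n_{[1]}$; $f\,\bar\otimes\, g$ is the restriction of $f\otimes g$. The unit object is $H_s$ with coaction $\Delta|_{H_s}: H_s\to H_s\otimes H$. The associativity constraint is the one of vector spaces. The unit isomorphisms are $l_M:H_s\,\bar\otimes\, M\to M$, $x\,\bar\otimes\, m\mapsto\varepsilon(xm_{[1]})m_{[0]}$, and $r_M:M\,\bar\otimes\, H_s\to M$, $m\,\bar\otimes\, x\mapsto\varepsilon(m_{[1]}x)m_{[0]}$, with inverses $l_M^{-1}(m)=\varepsilon(1_2m_{[1]})1_1\,\bar\otimes\, m_{[0]}$ and $r_M^{-1}(m)=m_{[0]}\,\bar\otimes\,\varepsilon(m_{[1]}1_2)1_1$. **Algebras, coalgebras, Frobenius algebras in $\mathcal{M}^H$.** An algebra in $\mathcal{M}^H$ is $(A,\bar m:A\,\bar\otimes\, A\to A,\ \bar u:H_s\to A)$ with $A\in\mathcal M^H$ and $\bar m,\bar u$ morphisms of $\mathcal{M}^H$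 such that $\bar m(\bar m\,\bar\otimes\,\mathrm{id})=\bar m(\mathrm{id}\,\bar\otimes\,\bar m)$, $\bar m(\bar u\,\bar\otimes\,\mathrm{id})=l_A$, $\bar m(\mathrm{id}\,\bar\otimes\,\bar u)=r_A$. A coalgebra in $\mathcal{M}^H$ is $(C,\bar\Delta:C\to C\,\bar\otimes\, C,\ \bar\varepsilon:C\to H_s)$ with $C\in\mathcal M^H$ and $\bar\Delta,\bar\varepsilon$ morphisms of $\mathcal{M}^H$ such that $(\bar\Delta\,\bar\otimes\,\mathrm{id})\bar\Delta=(\mathrm{id}\,\bar\otimes\,\bar\Delta)\bar\Delta$, $(\bar\varepsilon\,\bar\otimes\,\mathrm{id})\bar\Delta=l_C^{-1}$, $(\mathrm{id}\,\bar\otimes\,\bar\varepsilon)\bar\Delta=r_C^{-1}$. A Frobenius algebra in $\mathcal{M}^H$ is $(A,\bar m,\bar u,\bar\Delta,\bar\varepsilon)$ that is both an algebra and a coalgebra in $\mathcal{M}^H$ with $(\bar m\,\bar\otimes\,\mathrm{id})(\mathrm{id}\,\bar\otimes\,\bar\Delta)=\bar\Delta\bar m=(\mathrm{id}\,\bar\otimes\,\bar m)(\bar\Delta\,\bar\otimes\,\mathrm{id})$. Morphisms are morphisms of $\mathcal{M}^H$ compatible with the (co)multiplication and (co)unit (for Frobenius algebras: with all four structure maps). **$\mathcal{C}^H$ (right $H$-comodule coalgebras).** Objects: $\Bbbk$-coalgebras $(C,\Delta_C,\varepsilon_C)$ (with $\Delta_C(c)=c_1\otimes c_2$) that are right $H$-comodules,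 such that for all $c\in C$: $c_{1,[0]}\otimes c_{2,[0]}\otimes c_{1,[1]}c_{2,[1]}=c_{[0],1}\otimes c_{[0],2}\otimes c_{[1]}$ and $\varepsilon_C(c_{[0]})c_{[1]}=\varepsilon_C(c_{[0]})\varepsilon_s(c_{[1]})$. Morphisms: $\Bbbk$-coalgebra maps that are also $H$-comodule maps. **$\mathcal{A}^H$ (right $H$-comodule algebras).** Objects: $\Bbbk$-algebras $A$ that are right $H$-comodules via $\rho_A$, such that $(ab)_{[0]}\otimes(ab)_{[1]}=a_{[0]}b_{[0]}\otimes a_{[1]}b_{[1]}$ for all $a,b\in A$, and $\rho_A(1_A)\in A\otimes H_t$. Morphisms: $\Bbbk$-algebra maps that are also $H$-comodule maps. **$\mathcal{F}^H$ (right $H$-comodule Frobenius algebras).** A Frobenius $\Bbbk$-algebra is a tuple $(A,m_A,u_A,\Delta_A,\varepsilon_A)$ that is a $\Bbbk$-algebra and a $\Bbbk$-coalgebra with $(m_A\otimes\mathrm{id})(\mathrm{id}\otimes\Delta_A)=\Delta_Am_A=(\mathrm{id}\otimes m_A)(\Delta_A\otimes\mathrm{id})$. Objects of $\mathcal{F}^H$: Frobenius $\Bbbk$-algebras that are right $H$-comodules such that, for this coaction, $(A,m_A,u_A)\in\mathcal{A}^H$ and $(A,\Delta_A,\varepsilon_A)\in\mathcal{C}^H$. Morphisms: linear maps that are morphisms in both $\mathcal{A}^H$ and $\mathcal{C}^H$. *)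

theory Defs
  imports Complex_Main "HOL-Library.FuncSet" "HOL-Library.Poly_Mapping"
begin

section \<open>Vector spaces with an explicit carrier\<close>

text \<open>
  The base field is a type of class \<^class>\<open>field\<close>.  A vector space has a carrier inside some type,
  since a category of comodules ranges over vector spaces with different underlying sets.
  All structure maps, here and below, are extensional (they take the value \<^const>\<open>undefined\<close>
  outside the carriers), so that equality of the HOL objects is equality of the mathematical
  objects, which a strict isomorphism of categories relies on.
\<close>

record ('k, 'a) vspace =
  carrier :: "'a set"
  add :: "'a \<Rightarrow> 'a \<Rightarrow> 'a"
  zero :: 'a
  scale :: "'k \<Rightarrow> 'a \<Rightarrow> 'a"

definition is_vspace :: "('k::field, 'a, 'z) vspace_scheme \<Rightarrow> bool" where
  "is_vspace V \<longleftrightarrow>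
    add V \<in> carrier V \<rightarrow>\<^sub>E carrier V \<rightarrow>\<^sub>E carrier V \<and>
    zero V \<in> carrier V \<and>
    (\<forall>c. scale V c \<in> carrier V \<rightarrow>\<^sub>E carrier V) \<and>
    (\<forall>x\<in>carrier V. \<forall>y\<in>carrier V. \<forall>z\<in>carrier V. add V (add V x y) z = add V x (add V y z)) \<and>
    (\<forall>x\<in>carrier V. \<forall>y\<in>carrier V. add V x y = add V y x) \<and>
    (\<forall>x\<in>carrier V. add V (zero V) x = x) \<and>
    (\<forall>x\<in>carrier V. \<exists>y\<in>carrier V. add V x y = zero V) \<and>
    (\<forall>c. \<forall>x\<in>carrier V. \<forall>y\<in>carrier V. scale V c (add V x y) = add V (scale V c x) (scale V c y)) \<and>
    (\<forall>c d. \<forall>x\<in>carrier V. scale V (c + d) x = add V (scale V c x) (scale V d x)) \<and>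
    (\<forall>c d. \<forall>x\<in>carrier V. scale V (c * d) x = scale V c (scale V d x)) \<and>
    (\<forall>x\<in>carrier V. scale V 1 x = x)"

definition linear_maps ::
    "('k::field, 'a, 'y) vspace_scheme \<Rightarrow> ('k, 'b, 'z) vspace_scheme \<Rightarrow> ('a \<Rightarrow> 'b) set" where
  "linear_maps V W = {f \<in> carrier V \<rightarrow>\<^sub>E carrier W.
    (\<forall>x\<in>carrier V. \<forall>y\<in>carrier V. f (add V x y) = add W (f x) (f y)) \<and>
    (\<forall>c. \<forall>x\<in>carrier V. f (scale V c x) = scale W c (f x))}"

definition ground :: "('k::field, 'k) vspace" where
  "ground = \<lparr>carrier = UNIV, add = (+), zero = 0, scale = (*)\<rparr>"

definition restrict_vspace :: "('k, 'a, 'z) vspace_scheme \<Rightarrow> 'a set \<Rightarrow> ('k, 'a) vspace" where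
  "restrict_vspace V S =
    \<lparr>carrier = S, add = (\<lambda>x\<in>S. \<lambda>y\<in>S. add V x y), zero = zero V, scale = (\<lambda>c. \<lambda>x\<in>S. scale V c x)\<rparr>"


section \<open>Tensor products of vector spaces\<close>

text \<open>
  The tensor product of \<open>M\<close> and \<open>N\<close> is the vector space of formal linear combinations of pairs in
  \<open>carrier M \<times> carrier N\<close>, modulo the subspace spanned by the bilinearity relations.
\<close>

definition fscale :: "'k::field \<Rightarrow> ('x \<Rightarrow>\<^sub>0 'k) \<Rightarrow> ('x \<Rightarrow>\<^sub>0 'k)" where
  "fscale c = Poly_Mapping.map ((*) c)"

lemma lookup_fscale: "Poly_Mapping.lookup (fscale c f) x = c * Poly_Mapping.lookup f x"
  by (simp add: fscale_def Poly_Mapping.map.rep_eq when_def)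

global_interpretation formal: vector_space "fscale :: 'k::field \<Rightarrow> ('x \<Rightarrow>\<^sub>0 'k) \<Rightarrow> _"
  by unfold_locales
    (simp_all add: poly_mapping_eq_iff fun_eq_iff lookup_fscale lookup_add algebra_simps)

type_synonym ('k, 'a, 'b) tensor = "('a \<times> 'b \<Rightarrow>\<^sub>0 'k) set"

definition tensor_relations ::
    "('k::field, 'a, 'y) vspace_scheme \<Rightarrow> ('k, 'b, 'z) vspace_scheme \<Rightarrow> ('a \<times> 'b \<Rightarrow>\<^sub>0 'k) set" where
  "tensor_relations M N = formal.span
    ({Poly_Mapping.single (add M m m', n) 1 - Poly_Mapping.single (m, n) 1 - Poly_Mapping.single (m', n) 1
        | m m' n. m \<in> carrier M \<and> m' \<in> carrier M \<and> n \<in> carrier N} \<union>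
     {Poly_Mapping.single (m, add N n n') 1 - Poly_Mapping.single (m, n) 1 - Poly_Mapping.single (m, n') 1
        | m n n'. m \<in> carrier M \<and> n \<in> carrier N \<and> n' \<in> carrier N} \<union>
     {Poly_Mapping.single (scale M c m, n) 1 - Poly_Mapping.single (m, n) c
        | c m n. m \<in> carrier M \<and> n \<in> carrier N} \<union>
     {Poly_Mapping.single (m, scale N c n) 1 - Poly_Mapping.single (m, n) c
        | c m n. m \<in> carrier M \<and> n \<in> carrier N})"

definition tensor_class ::
    "('k::field, 'a, 'y) vspace_scheme \<Rightarrow> ('k, 'b, 'z) vspace_scheme \<Rightarrow>
      ('a \<times> 'b \<Rightarrow>\<^sub>0 'k) \<Rightarrow> ('k, 'a, 'b) tensor" where
  "tensor_class M N f = {g. g - f \<in> tensor_relations M N}"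

definition tensor_space ::
    "('k::field, 'a, 'y) vspace_scheme \<Rightarrow> ('k, 'b, 'z) vspace_scheme \<Rightarrow>
      ('k, ('k, 'a, 'b) tensor) vspace"  (infixl "\<otimes>" 70) where
  "M \<otimes> N =
    (let T = tensor_class M N ` {f. Poly_Mapping.keys f \<subseteq> carrier M \<times> carrier N} in
      \<lparr>carrier = T,
       add = (\<lambda>s\<in>T. \<lambda>t\<in>T. {f + g | f g. f \<in> s \<and> g \<in> t}),
       zero = tensor_class M N 0,
       scale = (\<lambda>c. \<lambda>t\<in>T. \<Union>f\<in>t. tensor_class M N (fscale c f))\<rparr>)"

definition tensor_elt ::
    "'a \<Rightarrow> ('k::field, 'a, 'y) vspace_scheme \<Rightarrow> ('k, 'b, 'z) vspace_scheme \<Rightarrow> 'b \<Rightarrow> ('k, 'a, 'b) tensor"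
    ("_ \<otimes>\<^bsub>_,_\<^esub> _" [71, 0, 0, 71] 70) where
  "m \<otimes>\<^bsub>M,N\<^esub> n = tensor_class M N (Poly_Mapping.single (m, n) 1)"

text \<open>
  \<open>tensor_lift M N W B\<close> is the linear map \<open>M \<otimes> N \<rightarrow> W\<close> given by the universal property from a bilinear
  map \<open>B\<close>.  An expression in Sweedler notation is an iterated lift: if \<open>t \<in> M \<otimes> N\<close> is written
  \<open>t\<^sub>1 \<otimes> t\<^sub>2\<close>, then \<open>B(t\<^sub>1, t\<^sub>2)\<close> is \<open>tensor_lift M N W B t\<close>.
\<close>

definition tensor_lift ::
    "('k::field, 'a, 'x) vspace_scheme \<Rightarrow> ('k, 'b, 'y) vspace_scheme \<Rightarrow> ('k, 'c, 'z) vspace_scheme \<Rightarrow>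
      ('a \<Rightarrow> 'b \<Rightarrow> 'c) \<Rightarrow> ('k, 'a, 'b) tensor \<Rightarrow> 'c" where
  "tensor_lift M N W B = (THE g. g \<in> linear_maps (M \<otimes> N) W \<and>
    (\<forall>m\<in>carrier M. \<forall>n\<in>carrier N. g (m \<otimes>\<^bsub>M,N\<^esub> n) = B m n))"

definition tensor_map ::
    "('k::field, 'a, 'w) vspace_scheme \<Rightarrow> ('k, 'b, 'x) vspace_scheme \<Rightarrow>
     ('k, 'c, 'y) vspace_scheme \<Rightarrow> ('k, 'd, 'z) vspace_scheme \<Rightarrow>
      ('a \<Rightarrow> 'c) \<Rightarrow> ('b \<Rightarrow> 'd) \<Rightarrow> ('k, 'a, 'b) tensor \<Rightarrow> ('k, 'c, 'd) tensor" where
  "tensor_map M N M' N' f g = tensor_lift M N (M' \<otimes> N') (\<lambda>m n. f m \<otimes>\<^bsub>M',N'\<^esub> g n)"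

text \<open>
  If \<open>S\<close> is a subspace of \<open>M\<close>, the canonical injection \<open>S \<otimes> N \<rightarrow> M \<otimes> N\<close> is
  \<open>tensor_map S N M N id id\<close>; it is not a literal inclusion of carriers, because the equivalence
  classes differ.
\<close>

definition assoc ::
    "('k::field, 'a, 'x) vspace_scheme \<Rightarrow> ('k, 'b, 'y) vspace_scheme \<Rightarrow> ('k, 'c, 'z) vspace_scheme \<Rightarrow>
      ('k, ('k, 'a, 'b) tensor, 'c) tensor \<Rightarrow> ('k, 'a, ('k, 'b, 'c) tensor) tensor" where
  "assoc M N P = tensor_lift (M \<otimes> N) P (M \<otimes> (N \<otimes> P)) (\<lambda>t p.
     tensor_lift M N (M \<otimes> (N \<otimes> P)) (\<lambda>m n. m \<otimes>\<^bsub>M, N \<otimes> P\<^esub> (n \<otimes>\<^bsub>N,P\<^esub> p)) t)"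

definition assoc_inv ::
    "('k::field, 'a, 'x) vspace_scheme \<Rightarrow> ('k, 'b, 'y) vspace_scheme \<Rightarrow> ('k, 'c, 'z) vspace_scheme \<Rightarrow>
      ('k, 'a, ('k, 'b, 'c) tensor) tensor \<Rightarrow> ('k, ('k, 'a, 'b) tensor, 'c) tensor" where
  "assoc_inv M N P = tensor_lift M (N \<otimes> P) (M \<otimes> N \<otimes> P) (\<lambda>m t.
     tensor_lift N P (M \<otimes> N \<otimes> P) (\<lambda>n p. (m \<otimes>\<^bsub>M,N\<^esub> n) \<otimes>\<^bsub>M \<otimes> N, P\<^esub> p) t)"


section \<open>Algebras, coalgebras and Frobenius algebras over the field\<close>

definition algebra ::
    "('k::field, 'a, 'z) vspace_scheme \<Rightarrow> ('a \<Rightarrow> 'a \<Rightarrow> 'a) \<Rightarrow> 'a \<Rightarrow> bool" where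
  "algebra A mul u \<longleftrightarrow>
    is_vspace A \<and>
    mul \<in> carrier A \<rightarrow>\<^sub>E carrier A \<rightarrow>\<^sub>E carrier A \<and>
    (\<forall>a\<in>carrier A. mul a \<in> linear_maps A A \<and> (\<lambda>b\<in>carrier A. mul b a) \<in> linear_maps A A) \<and>
    u \<in> carrier A \<and>
    (\<forall>a\<in>carrier A. \<forall>b\<in>carrier A. \<forall>c\<in>carrier A. mul (mul a b) c = mul a (mul b c)) \<and>
    (\<forall>a\<in>carrier A. mul u a = a \<and> mul a u = a)"

definition coalgebra ::
    "('k::field, 'a, 'z) vspace_scheme \<Rightarrow> ('a \<Rightarrow> ('k, 'a, 'a) tensor) \<Rightarrow> ('a \<Rightarrow> 'k) \<Rightarrow> bool" where
  "coalgebra C \<Delta> \<epsilon> \<longleftrightarrow>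
    is_vspace C \<and>
    \<Delta> \<in> linear_maps C (C \<otimes> C) \<and>
    \<epsilon> \<in> linear_maps C ground \<and>
    (\<forall>c\<in>carrier C.
      assoc C C C (tensor_map C C (C \<otimes> C) C \<Delta> id (\<Delta> c)) = tensor_map C C C (C \<otimes> C) id \<Delta> (\<Delta> c) \<and>
      tensor_lift C C C (\<lambda>c1 c2. scale C (\<epsilon> c1) c2) (\<Delta> c) = c \<and>
      tensor_lift C C C (\<lambda>c1 c2. scale C (\<epsilon> c2) c1) (\<Delta> c) = c)"

definition frobenius_algebra ::
    "('k::field, 'a, 'z) vspace_scheme \<Rightarrow> ('a \<Rightarrow> 'a \<Rightarrow> 'a) \<Rightarrow> 'a \<Rightarrow>
      ('a \<Rightarrow> ('k, 'a, 'a) tensor) \<Rightarrow> ('a \<Rightarrow> 'k) \<Rightarrow> bool" where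
  "frobenius_algebra A mul u \<Delta> \<epsilon> \<longleftrightarrow>
    algebra A mul u \<and> coalgebra A \<Delta> \<epsilon> \<and>
    (let m = tensor_lift A A A mul in
      \<forall>t\<in>carrier (A \<otimes> A).
        tensor_map (A \<otimes> A) A A A m id (assoc_inv A A A (tensor_map A A A (A \<otimes> A) id \<Delta> t)) = \<Delta> (m t) \<and>
        \<Delta> (m t) = tensor_map A (A \<otimes> A) A A id m (assoc A A A (tensor_map A A (A \<otimes> A) A \<Delta> id t)))"

definition tensor_mult ::
    "('k::field, 'a, 'y) vspace_scheme \<Rightarrow> ('a \<Rightarrow> 'a \<Rightarrow> 'a) \<Rightarrow>
     ('k, 'b, 'z) vspace_scheme \<Rightarrow> ('b \<Rightarrow> 'b \<Rightarrow> 'b) \<Rightarrow>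
      ('k, 'a, 'b) tensor \<Rightarrow> ('k, 'a, 'b) tensor \<Rightarrow> ('k, 'a, 'b) tensor" where
  "tensor_mult A mulA B mulB s t =
    tensor_lift A B (A \<otimes> B) (\<lambda>a b.
      tensor_lift A B (A \<otimes> B) (\<lambda>a' b'. mulA a a' \<otimes>\<^bsub>A,B\<^esub> mulB b b') t) s"


section \<open>Weak bialgebras\<close>

record (overloaded) ('k::zero, 'h) bialg = "('k, 'h) vspace" +
  mult :: "'h \<Rightarrow> 'h \<Rightarrow> 'h"
  one :: 'h
  comult :: "'h \<Rightarrow> ('k, 'h, 'h) tensor"
  counit :: "'h \<Rightarrow> 'k"

definition weak_bialgebra :: "('k::field, 'h) bialg \<Rightarrow> bool" where
  "weak_bialgebra H \<longleftrightarrow>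
    algebra H (mult H) (one H) \<and>
    coalgebra H (comult H) (counit H) \<and>
    (\<forall>a\<in>carrier H. \<forall>b\<in>carrier H.
      comult H (mult H a b) = tensor_mult H (mult H) H (mult H) (comult H a) (comult H b)) \<and>
    (\<forall>a\<in>carrier H. \<forall>b\<in>carrier H. \<forall>c\<in>carrier H.
      counit H (mult H (mult H a b) c) =
        tensor_lift H H ground (\<lambda>b1 b2. counit H (mult H a b1) * counit H (mult H b2 c)) (comult H b) \<and>
      counit H (mult H (mult H a b) c) =
        tensor_lift H H ground (\<lambda>b1 b2. counit H (mult H a b2) * counit H (mult H b1 c)) (comult H b)) \<and>
    (let mult3 = tensor_mult (H \<otimes> H) (tensor_mult H (mult H) H (mult H)) H (mult H);
         D = comult H (one H);
         D1 = D \<otimes>\<^bsub>H \<otimes> H, H\<^esub> one H;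
         oneD = assoc_inv H H H (one H \<otimes>\<^bsub>H, H \<otimes> H\<^esub> D)
     in tensor_map H H (H \<otimes> H) H (comult H) id D = mult3 D1 oneD \<and>
        mult3 D1 oneD = mult3 oneD D1)"

definition eps_s :: "('k::field, 'h) bialg \<Rightarrow> 'h \<Rightarrow> 'h" where
  "eps_s H x = tensor_lift H H H (\<lambda>p q. scale H (counit H (mult H x q)) p) (comult H (one H))"

definition eps_t :: "('k::field, 'h) bialg \<Rightarrow> 'h \<Rightarrow> 'h" where
  "eps_t H x = tensor_lift H H H (\<lambda>p q. scale H (counit H (mult H p x)) q) (comult H (one H))"

definition H_s :: "('k::field, 'h) bialg \<Rightarrow> ('k, 'h) vspace" where
  "H_s H = restrict_vspace H (eps_s H ` carrier H)"

definition H_t :: "('k::field, 'h) bialg \<Rightarrow> ('k, 'h) vspace" where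
  "H_t H = restrict_vspace H (eps_t H ` carrier H)"


section \<open>The monoidal category of right comodules\<close>

text \<open>
  Comodules may have underlying sets in arbitrary types: the product \<open>M \<otimes> N\<close> of comodules lives on
  the type of tensors, the unit object \<open>H_s\<close> on the type of \<open>H\<close>.  The monoidal structure is therefore
  given by polymorphic constants rather than packaged into one record.
\<close>

record (overloaded) ('k::zero, 'h, 'm) comod = "('k, 'm) vspace" +
  coact :: "'m \<Rightarrow> ('k, 'm, 'h) tensor"

definition comodule :: "('k::field, 'h) bialg \<Rightarrow> ('k, 'h, 'm) comod \<Rightarrow> bool" where
  "comodule H M \<longleftrightarrow>
    is_vspace M \<and>
    coact M \<in> linear_maps M (M \<otimes> H) \<and>
    (\<forall>m\<in>carrier M.
      assoc M H H (tensor_map M H (M \<otimes> H) H (coact M) id (coact M m)) =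
        tensor_map M H M (H \<otimes> H) id (comult H) (coact M m) \<and>
      tensor_lift M H M (\<lambda>m0 m1. scale M (counit H m1) m0) (coact M m) = m)"

definition comodule_homs ::
    "('k::field, 'h) bialg \<Rightarrow> ('k, 'h, 'm) comod \<Rightarrow> ('k, 'h, 'n) comod \<Rightarrow> ('m \<Rightarrow> 'n) set" where
  "comodule_homs H M N = {f \<in> linear_maps M N.
    \<forall>m\<in>carrier M. coact N (f m) = tensor_map M H N H f id (coact M m)}"

definition mtensor_proj ::
    "('k::field, 'h) bialg \<Rightarrow> ('k, 'h, 'm) comod \<Rightarrow> ('k, 'h, 'n) comod \<Rightarrow>
      ('k, 'm, 'n) tensor \<Rightarrow> ('k, 'm, 'n) tensor" where
  "mtensor_proj H M N = tensor_lift M N (M \<otimes> N) (\<lambda>m n.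
     tensor_lift M H (M \<otimes> N) (\<lambda>m0 m1.
       tensor_lift N H (M \<otimes> N) (\<lambda>n0 n1.
         scale (M \<otimes> N) (counit H (mult H m1 n1)) (m0 \<otimes>\<^bsub>M,N\<^esub> n0)) (coact N n)) (coact M m))"

definition diag_coact ::
    "('k::field, 'h) bialg \<Rightarrow> ('k, 'h, 'm) comod \<Rightarrow> ('k, 'h, 'n) comod \<Rightarrow>
      ('k, 'm, 'n) tensor \<Rightarrow> ('k, ('k, 'm, 'n) tensor, 'h) tensor" where
  "diag_coact H M N = tensor_lift M N (M \<otimes> N \<otimes> H) (\<lambda>m n.
     tensor_lift M H (M \<otimes> N \<otimes> H) (\<lambda>m0 m1.
       tensor_lift N H (M \<otimes> N \<otimes> H) (\<lambda>n0 n1.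
         (m0 \<otimes>\<^bsub>M,N\<^esub> n0) \<otimes>\<^bsub>M \<otimes> N, H\<^esub> mult H m1 n1) (coact N n)) (coact M m))"

text \<open>
  \<open>corestrict_coact H S M \<rho>\<close> is the coaction induced by a map \<open>\<rho>\<close> with values in \<open>M \<otimes> H\<close> on a subspace
  \<open>S\<close> of \<open>M\<close> such that \<open>\<rho>(S)\<close> lies in the image of the injection \<open>S \<otimes> H \<rightarrow> M \<otimes> H\<close>.
\<close>

definition corestrict_coact ::
    "('k::field, 'h) bialg \<Rightarrow> ('k, 'm) vspace \<Rightarrow> ('k, 'm, 'z) vspace_scheme \<Rightarrow>
      ('m \<Rightarrow> ('k, 'm, 'h) tensor) \<Rightarrow> 'm \<Rightarrow> ('k, 'm, 'h) tensor" where
  "corestrict_coact H S M \<rho> =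
    (\<lambda>x\<in>carrier S. inv_into (carrier (S \<otimes> H)) (tensor_map S H M H id id) (\<rho> x))"

definition mtensor ::
    "('k::field, 'h) bialg \<Rightarrow> ('k, 'h, 'm) comod \<Rightarrow> ('k, 'h, 'n) comod \<Rightarrow>
      ('k, 'h, ('k, 'm, 'n) tensor) comod" where
  "mtensor H M N =
    (let S = restrict_vspace (M \<otimes> N) {t \<in> carrier (M \<otimes> N). mtensor_proj H M N t = t} in
      vspace.extend S (comod.fields (corestrict_coact H S (M \<otimes> N) (diag_coact H M N))))"

definition mtensor_map ::
    "('k::field, 'h) bialg \<Rightarrow>
     ('k, 'h, 'a) comod \<Rightarrow> ('k, 'h, 'b) comod \<Rightarrow> ('k, 'h, 'c) comod \<Rightarrow> ('k, 'h, 'd) comod \<Rightarrow>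
      ('a \<Rightarrow> 'c) \<Rightarrow> ('b \<Rightarrow> 'd) \<Rightarrow> ('k, 'a, 'b) tensor \<Rightarrow> ('k, 'c, 'd) tensor" where
  "mtensor_map H M N M' N' f g = restrict (tensor_map M N M' N' f g) (carrier (mtensor H M N))"

definition munit :: "('k::field, 'h) bialg \<Rightarrow> ('k, 'h, 'h) comod" where
  "munit H = vspace.extend (H_s H) (comod.fields (corestrict_coact H (H_s H) H (comult H)))"

text \<open>
  The associator of vector spaces, restricted to \<open>(X \<otimes> Y) \<otimes> Z \<rightarrow> X \<otimes> (Y \<otimes> Z)\<close> for the products of
  comodules.  The nested lift is the associator of vector spaces precomposed with the injection of
  \<open>mtensor H X Y \<otimes> Z\<close> into \<open>X \<otimes> Y \<otimes> Z\<close>; the \<^const>\<open>inv_into\<close> undoes the injection of the target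
  into \<open>X \<otimes> (Y \<otimes> Z)\<close>.
\<close>

definition massoc ::
    "('k::field, 'h) bialg \<Rightarrow> ('k, 'h, 'a) comod \<Rightarrow> ('k, 'h, 'b) comod \<Rightarrow> ('k, 'h, 'c) comod \<Rightarrow>
      ('k, ('k, 'a, 'b) tensor, 'c) tensor \<Rightarrow> ('k, 'a, ('k, 'b, 'c) tensor) tensor" where
  "massoc H X Y Z = (\<lambda>t\<in>carrier (mtensor H (mtensor H X Y) Z).
    inv_into (carrier (mtensor H X (mtensor H Y Z)))
      (tensor_map X (mtensor H Y Z) X (Y \<otimes> Z) id id)
      (assoc X Y Z (tensor_map (mtensor H X Y) Z (X \<otimes> Y) Z id id t)))"

definition massoc_inv ::
    "('k::field, 'h) bialg \<Rightarrow> ('k, 'h, 'a) comod \<Rightarrow> ('k, 'h, 'b) comod \<Rightarrow> ('k, 'h, 'c) comod \<Rightarrow>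
      ('k, 'a, ('k, 'b, 'c) tensor) tensor \<Rightarrow> ('k, ('k, 'a, 'b) tensor, 'c) tensor" where
  "massoc_inv H X Y Z = (\<lambda>t\<in>carrier (mtensor H X (mtensor H Y Z)).
    inv_into (carrier (mtensor H (mtensor H X Y) Z)) (massoc H X Y Z) t)"

definition lunit ::
    "('k::field, 'h) bialg \<Rightarrow> ('k, 'h, 'm) comod \<Rightarrow> ('k, 'h, 'm) tensor \<Rightarrow> 'm" where
  "lunit H M = restrict
    (tensor_lift (munit H) M M (\<lambda>x m.
       tensor_lift M H M (\<lambda>m0 m1. scale M (counit H (mult H x m1)) m0) (coact M m)))
    (carrier (mtensor H (munit H) M))"

definition runit ::
    "('k::field, 'h) bialg \<Rightarrow> ('k, 'h, 'm) comod \<Rightarrow> ('k, 'm, 'h) tensor \<Rightarrow> 'm" where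
  "runit H M = restrict
    (tensor_lift M (munit H) M (\<lambda>m x.
       tensor_lift M H M (\<lambda>m0 m1. scale M (counit H (mult H m1 x)) m0) (coact M m)))
    (carrier (mtensor H M (munit H)))"

text \<open>
  In the inverses of the unit isomorphisms, \<open>1\<^sub>1 \<otimes> 1\<^sub>2\<close> is \<open>\<Delta>(1)\<close> seen as an element of \<open>H_s \<otimes> H\<close>, that
  is, the coaction of the unit object evaluated at \<open>1\<close>.
\<close>

definition lunit_inv ::
    "('k::field, 'h) bialg \<Rightarrow> ('k, 'h, 'm) comod \<Rightarrow> 'm \<Rightarrow> ('k, 'h, 'm) tensor" where
  "lunit_inv H M = (\<lambda>m\<in>carrier M.
    tensor_lift (munit H) H (munit H \<otimes> M) (\<lambda>p q.
      tensor_lift M H (munit H \<otimes> M) (\<lambda>m0 m1.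
        scale (munit H \<otimes> M) (counit H (mult H q m1)) (p \<otimes>\<^bsub>munit H, M\<^esub> m0)) (coact M m))
      (coact (munit H) (one H)))"

definition runit_inv ::
    "('k::field, 'h) bialg \<Rightarrow> ('k, 'h, 'm) comod \<Rightarrow> 'm \<Rightarrow> ('k, 'm, 'h) tensor" where
  "runit_inv H M = (\<lambda>m\<in>carrier M.
    tensor_lift (munit H) H (M \<otimes> munit H) (\<lambda>p q.
      tensor_lift M H (M \<otimes> munit H) (\<lambda>m0 m1.
        scale (M \<otimes> munit H) (counit H (mult H m1 q)) (m0 \<otimes>\<^bsub>M, munit H\<^esub> p)) (coact M m))
      (coact (munit H) (one H)))"


section \<open>Algebras, coalgebras and Frobenius algebras in the category of comodules\<close>

definition algebra_in_comod ::
    "('k::field, 'h) bialg \<Rightarrow> ('k, 'h, 'v) comod \<Rightarrow> (('k, 'v, 'v) tensor \<Rightarrow> 'v) \<Rightarrow> ('h \<Rightarrow> 'v) \<Rightarrow> bool" where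
  "algebra_in_comod H A m u \<longleftrightarrow>
    comodule H A \<and>
    m \<in> comodule_homs H (mtensor H A A) A \<and>
    u \<in> comodule_homs H (munit H) A \<and>
    (\<forall>t\<in>carrier (mtensor H (mtensor H A A) A).
      m (mtensor_map H (mtensor H A A) A A A m id t) =
      m (mtensor_map H A (mtensor H A A) A A id m (massoc H A A A t))) \<and>
    (\<forall>t\<in>carrier (mtensor H (munit H) A). m (mtensor_map H (munit H) A A A u id t) = lunit H A t) \<and>
    (\<forall>t\<in>carrier (mtensor H A (munit H)). m (mtensor_map H A (munit H) A A id u t) = runit H A t)"

definition coalgebra_in_comod ::
    "('k::field, 'h) bialg \<Rightarrow> ('k, 'h, 'v) comod \<Rightarrow> ('v \<Rightarrow> ('k, 'v, 'v) tensor) \<Rightarrow> ('v \<Rightarrow> 'h) \<Rightarrow> bool" where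
  "coalgebra_in_comod H C \<Delta> \<epsilon> \<longleftrightarrow>
    comodule H C \<and>
    \<Delta> \<in> comodule_homs H C (mtensor H C C) \<and>
    \<epsilon> \<in> comodule_homs H C (munit H) \<and>
    (\<forall>c\<in>carrier C.
      massoc H C C C (mtensor_map H C C (mtensor H C C) C \<Delta> id (\<Delta> c)) =
        mtensor_map H C C C (mtensor H C C) id \<Delta> (\<Delta> c) \<and>
      mtensor_map H C C (munit H) C \<epsilon> id (\<Delta> c) = lunit_inv H C c \<and>
      mtensor_map H C C C (munit H) id \<epsilon> (\<Delta> c) = runit_inv H C c)"

definition frobenius_in_comod ::
    "('k::field, 'h) bialg \<Rightarrow> ('k, 'h, 'v) comod \<Rightarrow> (('k, 'v, 'v) tensor \<Rightarrow> 'v) \<Rightarrow> ('h \<Rightarrow> 'v) \<Rightarrow>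
      ('v \<Rightarrow> ('k, 'v, 'v) tensor) \<Rightarrow> ('v \<Rightarrow> 'h) \<Rightarrow> bool" where
  "frobenius_in_comod H A m u \<Delta> \<epsilon> \<longleftrightarrow>
    algebra_in_comod H A m u \<and> coalgebra_in_comod H A \<Delta> \<epsilon> \<and>
    (\<forall>t\<in>carrier (mtensor H A A).
      mtensor_map H (mtensor H A A) A A A m id
        (massoc_inv H A A A (mtensor_map H A A A (mtensor H A A) id \<Delta> t)) = \<Delta> (m t) \<and>
      \<Delta> (m t) =
        mtensor_map H A (mtensor H A A) A A id m
          (massoc H A A A (mtensor_map H A A (mtensor H A A) A \<Delta> id t)))"


section \<open>Comodule algebras, comodule coalgebras and comodule Frobenius algebras\<close>

definition comodule_algebra ::
    "('k::field, 'h) bialg \<Rightarrow> ('k, 'h, 'v) comod \<Rightarrow> ('v \<Rightarrow> 'v \<Rightarrow> 'v) \<Rightarrow> 'v \<Rightarrow> bool" where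
  "comodule_algebra H A mul u \<longleftrightarrow>
    algebra A mul u \<and> comodule H A \<and>
    (\<forall>a\<in>carrier A. \<forall>b\<in>carrier A.
      coact A (mul a b) = tensor_mult A mul H (mult H) (coact A a) (coact A b)) \<and>
    coact A u \<in> tensor_map A (H_t H) A H id id ` carrier (A \<otimes> H_t H)"

definition comodule_coalgebra ::
    "('k::field, 'h) bialg \<Rightarrow> ('k, 'h, 'v) comod \<Rightarrow> ('v \<Rightarrow> ('k, 'v, 'v) tensor) \<Rightarrow> ('v \<Rightarrow> 'k) \<Rightarrow> bool" where
  "comodule_coalgebra H C \<Delta> \<epsilon> \<longleftrightarrow>
    coalgebra C \<Delta> \<epsilon> \<and> comodule H C \<and>
    (\<forall>c\<in>carrier C.
      diag_coact H C C (\<Delta> c) = tensor_map C H (C \<otimes> C) H \<Delta> id (coact C c) \<and>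
      tensor_lift C H H (\<lambda>c0 c1. scale H (\<epsilon> c0) c1) (coact C c) =
        tensor_lift C H H (\<lambda>c0 c1. scale H (\<epsilon> c0) (eps_s H c1)) (coact C c))"

definition comodule_frobenius ::
    "('k::field, 'h) bialg \<Rightarrow> ('k, 'h, 'v) comod \<Rightarrow> ('v \<Rightarrow> 'v \<Rightarrow> 'v) \<Rightarrow> 'v \<Rightarrow>
      ('v \<Rightarrow> ('k, 'v, 'v) tensor) \<Rightarrow> ('v \<Rightarrow> 'k) \<Rightarrow> bool" where
  "comodule_frobenius H A mul u \<Delta> \<epsilon> \<longleftrightarrow>
    frobenius_algebra A mul u \<Delta> \<epsilon> \<and> comodule_algebra H A mul u \<and> comodule_coalgebra H A \<Delta> \<epsilon>"

definition algebra_hom ::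
    "('k::field, 'a, 'y) vspace_scheme \<Rightarrow> ('a \<Rightarrow> 'a \<Rightarrow> 'a) \<Rightarrow> 'a \<Rightarrow>
     ('k, 'b, 'z) vspace_scheme \<Rightarrow> ('b \<Rightarrow> 'b \<Rightarrow> 'b) \<Rightarrow> 'b \<Rightarrow> ('a \<Rightarrow> 'b) \<Rightarrow> bool" where
  "algebra_hom A mul u A' mul' u' f \<longleftrightarrow>
    f \<in> linear_maps A A' \<and> f u = u' \<and>
    (\<forall>a\<in>carrier A. \<forall>b\<in>carrier A. f (mul a b) = mul' (f a) (f b))"

definition coalgebra_hom ::
    "('k::field, 'a, 'y) vspace_scheme \<Rightarrow> ('a \<Rightarrow> ('k, 'a, 'a) tensor) \<Rightarrow> ('a \<Rightarrow> 'k) \<Rightarrow>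
     ('k, 'b, 'z) vspace_scheme \<Rightarrow> ('b \<Rightarrow> ('k, 'b, 'b) tensor) \<Rightarrow> ('b \<Rightarrow> 'k) \<Rightarrow> ('a \<Rightarrow> 'b) \<Rightarrow> bool" where
  "coalgebra_hom C \<Delta> \<epsilon> C' \<Delta>' \<epsilon>' f \<longleftrightarrow>
    f \<in> linear_maps C C' \<and>
    (\<forall>c\<in>carrier C. \<Delta>' (f c) = tensor_map C C C' C' f f (\<Delta> c) \<and> \<epsilon>' (f c) = \<epsilon> c)"


section \<open>Categories and the four categories of the theorem\<close>

text \<open>
  The composite of \<open>f \<in> homs \<C> X Y\<close> and \<open>g \<in> homs \<C> Y Z\<close> is \<open>comp \<C> X Y Z g f\<close>; the hom sets of
  different pairs of objects need not be disjoint.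
\<close>

record ('o, 'm) cat =
  objs :: "'o set"
  homs :: "'o \<Rightarrow> 'o \<Rightarrow> 'm set"
  ident :: "'o \<Rightarrow> 'm"
  comp :: "'o \<Rightarrow> 'o \<Rightarrow> 'o \<Rightarrow> 'm \<Rightarrow> 'm \<Rightarrow> 'm"

definition category :: "('o, 'm) cat \<Rightarrow> bool" where
  "category \<C> \<longleftrightarrow>
    (\<forall>X\<in>objs \<C>. ident \<C> X \<in> homs \<C> X X) \<and>
    (\<forall>X\<in>objs \<C>. \<forall>Y\<in>objs \<C>. \<forall>Z\<in>objs \<C>. \<forall>f\<in>homs \<C> X Y. \<forall>g\<in>homs \<C> Y Z.
      comp \<C> X Y Z g f \<in> homs \<C> X Z) \<and>
    (\<forall>X\<in>objs \<C>. \<forall>Y\<in>objs \<C>. \<forall>f\<in>homs \<C> X Y.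
      comp \<C> X X Y f (ident \<C> X) = f \<and> comp \<C> X Y Y (ident \<C> Y) f = f) \<and>
    (\<forall>W\<in>objs \<C>. \<forall>X\<in>objs \<C>. \<forall>Y\<in>objs \<C>. \<forall>Z\<in>objs \<C>.
      \<forall>f\<in>homs \<C> W X. \<forall>g\<in>homs \<C> X Y. \<forall>h\<in>homs \<C> Y Z.
      comp \<C> W Y Z h (comp \<C> W X Y g f) = comp \<C> W X Z (comp \<C> X Y Z h g) f)"

definition is_functor ::
    "('o, 'm) cat \<Rightarrow> ('p, 'n) cat \<Rightarrow> ('o \<Rightarrow> 'p) \<Rightarrow> ('o \<Rightarrow> 'o \<Rightarrow> 'm \<Rightarrow> 'n) \<Rightarrow> bool" where
  "is_functor \<C> \<D> F\<^sub>o F\<^sub>m \<longleftrightarrow>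
    (\<forall>X\<in>objs \<C>. F\<^sub>o X \<in> objs \<D>) \<and>
    (\<forall>X\<in>objs \<C>. \<forall>Y\<in>objs \<C>. \<forall>f\<in>homs \<C> X Y. F\<^sub>m X Y f \<in> homs \<D> (F\<^sub>o X) (F\<^sub>o Y)) \<and>
    (\<forall>X\<in>objs \<C>. F\<^sub>m X X (ident \<C> X) = ident \<D> (F\<^sub>o X)) \<and>
    (\<forall>X\<in>objs \<C>. \<forall>Y\<in>objs \<C>. \<forall>Z\<in>objs \<C>. \<forall>f\<in>homs \<C> X Y. \<forall>g\<in>homs \<C> Y Z.
      F\<^sub>m X Z (comp \<C> X Y Z g f) = comp \<D> (F\<^sub>o X) (F\<^sub>o Y) (F\<^sub>o Z) (F\<^sub>m Y Z g) (F\<^sub>m X Y f))"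

definition isomorphic_categories :: "('o, 'm) cat \<Rightarrow> ('p, 'n) cat \<Rightarrow> bool"  (infix "\<cong>" 50) where
  "\<C> \<cong> \<D> \<longleftrightarrow>
    category \<C> \<and> category \<D> \<and>
    (\<exists>F\<^sub>o F\<^sub>m G\<^sub>o G\<^sub>m.
      is_functor \<C> \<D> F\<^sub>o F\<^sub>m \<and> is_functor \<D> \<C> G\<^sub>o G\<^sub>m \<and>
      (\<forall>X\<in>objs \<C>. G\<^sub>o (F\<^sub>o X) = X) \<and>
      (\<forall>X\<in>objs \<C>. \<forall>Y\<in>objs \<C>. \<forall>f\<in>homs \<C> X Y. G\<^sub>m (F\<^sub>o X) (F\<^sub>o Y) (F\<^sub>m X Y f) = f) \<and>
      (\<forall>X\<in>objs \<D>. F\<^sub>o (G\<^sub>o X) = X) \<and>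
      (\<forall>X\<in>objs \<D>. \<forall>Y\<in>objs \<D>. \<forall>f\<in>homs \<D> X Y. F\<^sub>m (G\<^sub>o X) (G\<^sub>o Y) (G\<^sub>m X Y f) = f))"

text \<open>
  The four categories are the categories of all the structures of the respective kind whose
  underlying set consists of elements of the type \<open>'v\<close>.
\<close>

type_synonym ('k, 'h, 'v) coalg_obj =
  "('k, 'h, 'v) comod \<times> ('v \<Rightarrow> ('k, 'v, 'v) tensor) \<times> ('v \<Rightarrow> 'k)"

definition ComodCoalg :: "('k::field, 'h) bialg \<Rightarrow> (('k, 'h, 'v) coalg_obj, 'v \<Rightarrow> 'v) cat" where
  "ComodCoalg H =
    \<lparr>objs = {(C, \<Delta>, \<epsilon>). comodule_coalgebra H C \<Delta> \<epsilon>},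
     homs = (\<lambda>(C, \<Delta>, \<epsilon>) (C', \<Delta>', \<epsilon>').
       {f \<in> comodule_homs H C C'. coalgebra_hom C \<Delta> \<epsilon> C' \<Delta>' \<epsilon>' f}),
     ident = (\<lambda>(C, \<Delta>, \<epsilon>). \<lambda>x\<in>carrier C. x),
     comp = (\<lambda>(C, \<Delta>, \<epsilon>) Y Z g f. compose (carrier C) g f)\<rparr>"

type_synonym ('k, 'h, 'v) frob_obj =
  "('k, 'h, 'v) comod \<times> ('v \<Rightarrow> 'v \<Rightarrow> 'v) \<times> 'v \<times> ('v \<Rightarrow> ('k, 'v, 'v) tensor) \<times> ('v \<Rightarrow> 'k)"

definition ComodFrob :: "('k::field, 'h) bialg \<Rightarrow> (('k, 'h, 'v) frob_obj, 'v \<Rightarrow> 'v) cat" where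
  "ComodFrob H =
    \<lparr>objs = {(A, mul, u, \<Delta>, \<epsilon>). comodule_frobenius H A mul u \<Delta> \<epsilon>},
     homs = (\<lambda>(A, mul, u, \<Delta>, \<epsilon>) (A', mul', u', \<Delta>', \<epsilon>').
       {f \<in> comodule_homs H A A'.
         algebra_hom A mul u A' mul' u' f \<and> coalgebra_hom A \<Delta> \<epsilon> A' \<Delta>' \<epsilon>' f}),
     ident = (\<lambda>(A, mul, u, \<Delta>, \<epsilon>). \<lambda>x\<in>carrier A. x),
     comp = (\<lambda>(A, mul, u, \<Delta>, \<epsilon>) Y Z g f. compose (carrier A) g f)\<rparr>"

type_synonym ('k, 'h, 'v) mcoalg_obj =
  "('k, 'h, 'v) comod \<times> ('v \<Rightarrow> ('k, 'v, 'v) tensor) \<times> ('v \<Rightarrow> 'h)"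

definition Coalg :: "('k::field, 'h) bialg \<Rightarrow> (('k, 'h, 'v) mcoalg_obj, 'v \<Rightarrow> 'v) cat" where
  "Coalg H =
    \<lparr>objs = {(C, \<Delta>, \<epsilon>). coalgebra_in_comod H C \<Delta> \<epsilon>},
     homs = (\<lambda>(C, \<Delta>, \<epsilon>) (C', \<Delta>', \<epsilon>').
       {f \<in> comodule_homs H C C'. \<forall>c\<in>carrier C.
         \<Delta>' (f c) = mtensor_map H C C C' C' f f (\<Delta> c) \<and> \<epsilon>' (f c) = \<epsilon> c}),
     ident = (\<lambda>(C, \<Delta>, \<epsilon>). \<lambda>x\<in>carrier C. x),
     comp = (\<lambda>(C, \<Delta>, \<epsilon>) Y Z g f. compose (carrier C) g f)\<rparr>"

type_synonym ('k, 'h, 'v) mfrob_obj =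
  "('k, 'h, 'v) comod \<times> (('k, 'v, 'v) tensor \<Rightarrow> 'v) \<times> ('h \<Rightarrow> 'v) \<times>
    ('v \<Rightarrow> ('k, 'v, 'v) tensor) \<times> ('v \<Rightarrow> 'h)"

definition FrobAlg :: "('k::field, 'h) bialg \<Rightarrow> (('k, 'h, 'v) mfrob_obj, 'v \<Rightarrow> 'v) cat" where
  "FrobAlg H =
    \<lparr>objs = {(A, m, u, \<Delta>, \<epsilon>). frobenius_in_comod H A m u \<Delta> \<epsilon>},
     homs = (\<lambda>(A, m, u, \<Delta>, \<epsilon>) (A', m', u', \<Delta>', \<epsilon>').
       {f \<in> comodule_homs H A A'.
         (\<forall>t\<in>carrier (mtensor H A A). f (m t) = m' (mtensor_map H A A A' A' f f t)) \<and>
         (\<forall>x\<in>carrier (munit H). f (u x) = u' x) \<and>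
         (\<forall>a\<in>carrier A.
           \<Delta>' (f a) = mtensor_map H A A A' A' f f (\<Delta> a) \<and> \<epsilon>' (f a) = \<epsilon> a)}),
     ident = (\<lambda>(A, m, u, \<Delta>, \<epsilon>). \<lambda>x\<in>carrier A. x),
     comp = (\<lambda>(A, m, u, \<Delta>, \<epsilon>) Y Z g f. compose (carrier A) g f)\<rparr>"

end

(*
  Both isomorphisms keep the comodule, the comultiplication and all morphisms.  A counit eps of a
  comodule coalgebra becomes c |-> eps(c_0) c_1, whose values lie in H_s by the compatibility axiom;
  conversely a counit with values in H_s is composed with the counit of H.  A multiplication is
  restricted to the subspace of fixed points, or precomposed with the projection onto it, and a unit u
  becomes x |-> eps(x u_1) u_0, while a unit defined on H_s is evaluated at 1.

  The diagonal coaction makes M (x) N coassociative but not counital, and (id (x) eps) applied to it is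
  the projection p onto the monoidal product.  Linear maps intertwining the coactions commute with p,
  so they restrict to the products.  The two sides of the associativity and of the Frobenius conditions
  can then be compared on the full tensor powers, because projecting two adjacent pairs of factors is
  the same as projecting the triple product; this is what the two axioms on eps(abc) say.  The unit
  conditions come from Delta(z) = 1_1 (x) z 1_2 = 1_1 (x) 1_2 z for z in H_s, and its analogue for H_t.
*)

theory Submission
  imports Defs
begin

section \<open>Linear and bilinear maps on carriers\<close>

text \<open>For a subspace S of T, the space S \<otimes> H is not a subset of T \<otimes> H, so the
  coactions on products and on the unit object, and the associator between products, are preimages
  chosen by \<open>inv_into\<close>. They stay computable because each subspace is the set of fixed
  points of a linear projection r: the injection of S \<otimes> H is split by r \<otimes> id, hence
  injective without bases, and the chosen preimage is the retraction applied to the target. Product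
  and unit object are two instances of one construction, \<open>fixed_comodule\<close>.

  Associativity is easy to transfer, since an outer multiplication absorbs the projection. The
  Frobenius terms end in A \<otimes> A, where nothing absorbs it; there the projection of the triple
  product is split into projections of adjacent pairs, one absorbed by the multiplication and the
  other by the comultiplication.

  Sweedler notation is kept as nested \<open>tensor_lift\<close> terms: \<open>push\<close> moves
  lifts outwards, \<open>vs\<close> discharges membership and linearity, and
  \<open>lift_swap\<close>, coassociativity and the counit laws rewrite the sums.\<close>

definition lin ::
    "('k::field, 'a, 'y) vspace_scheme \<Rightarrow> ('k, 'b, 'z) vspace_scheme \<Rightarrow> ('a \<Rightarrow> 'b) \<Rightarrow> bool" where
  "lin V W f \<longleftrightarrow>
    (\<forall>x\<in>carrier V. f x \<in> carrier W) \<and>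
    (\<forall>x\<in>carrier V. \<forall>y\<in>carrier V. f (add V x y) = add W (f x) (f y)) \<and>
    (\<forall>c. \<forall>x\<in>carrier V. f (scale V c x) = scale W c (f x))"

definition bilin ::
    "('k::field, 'a, 'x) vspace_scheme \<Rightarrow> ('k, 'b, 'y) vspace_scheme \<Rightarrow> ('k, 'c, 'z) vspace_scheme \<Rightarrow>
      ('a \<Rightarrow> 'b \<Rightarrow> 'c) \<Rightarrow> bool" where
  "bilin M N W B \<longleftrightarrow>
    (\<forall>n\<in>carrier N. lin M W (\<lambda>m. B m n)) \<and> (\<forall>m\<in>carrier M. lin N W (\<lambda>n. B m n))"

text \<open>\<open>linear_maps\<close> demands extensionality, which abstractions such as
  \<open>\<lambda>x. g (f x)\<close> lack. Calculations therefore use \<open>lin\<close>;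
  extensionality is split off here and returns only where maps are compared as HOL
  functions.\<close>

lemma linear_maps_iff: "f \<in> linear_maps V W \<longleftrightarrow> lin V W f \<and> f \<in> extensional (carrier V)"
  by (auto simp: linear_maps_def lin_def PiE_def)

lemma linear_mapsD: "f \<in> linear_maps V W \<Longrightarrow> lin V W f"
  by (simp add: linear_maps_iff)

lemma vspace_closed:
  assumes "is_vspace V"
  shows "x \<in> carrier V \<Longrightarrow> y \<in> carrier V \<Longrightarrow> add V x y \<in> carrier V"
    and "zero V \<in> carrier V"
    and "x \<in> carrier V \<Longrightarrow> scale V c x \<in> carrier V"
proof -
  have *: "add V \<in> carrier V \<rightarrow>\<^sub>E carrier V \<rightarrow>\<^sub>E carrier V" "\<And>c. scale V c \<in> carrier V \<rightarrow>\<^sub>E carrier V"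
    using assms by (simp_all add: is_vspace_def)
  show "x \<in> carrier V \<Longrightarrow> y \<in> carrier V \<Longrightarrow> add V x y \<in> carrier V"
    using PiE_mem[OF PiE_mem[OF *(1)]] .
  show "zero V \<in> carrier V"
    using assms by (simp add: is_vspace_def)
  show "x \<in> carrier V \<Longrightarrow> scale V c x \<in> carrier V"
    using PiE_mem[OF *(2)] .
qed

lemma vspace_laws:
  assumes "is_vspace V"
  shows "x \<in> carrier V \<Longrightarrow> y \<in> carrier V \<Longrightarrow> z \<in> carrier V \<Longrightarrow>
      add V (add V x y) z = add V x (add V y z)"
    and "x \<in> carrier V \<Longrightarrow> y \<in> carrier V \<Longrightarrow> add V x y = add V y x"
    and "x \<in> carrier V \<Longrightarrow> add V (zero V) x = x"
    and "x \<in> carrier V \<Longrightarrow> y \<in> carrier V \<Longrightarrow> scale V c (add V x y) = add V (scale V c x) (scale V c y)"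
    and "x \<in> carrier V \<Longrightarrow> scale V (c + d) x = add V (scale V c x) (scale V d x)"
    and "x \<in> carrier V \<Longrightarrow> scale V (c * d) x = scale V c (scale V d x)"
    and "x \<in> carrier V \<Longrightarrow> scale V 1 x = x"
  using assms unfolding is_vspace_def by blast+

lemma vspace_neg:
  assumes "is_vspace V" "x \<in> carrier V"
  obtains y where "y \<in> carrier V" "add V x y = zero V"
proof -
  have "\<forall>x\<in>carrier V. \<exists>y\<in>carrier V. add V x y = zero V"
    using assms by (simp add: is_vspace_def)
  then show thesis
    using that assms by blast
qed

lemma vspace_idem_zero:
  assumes V: "is_vspace V" and x: "x \<in> carrier V" "add V x x = x"
  shows "x = zero V"
proof -
  obtain y where y: "y \<in> carrier V" "add V x y = zero V"
    using vspace_neg[OF V x(1)] .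
  have "add V (add V x x) y = add V x (zero V)"
    using vspace_laws[OF V] x y by metis
  then show ?thesis
    using vspace_laws[OF V] x y vspace_closed(2)[OF V] by metis
qed

lemma vspace_scale_zero:
  assumes V: "is_vspace V"
  shows "x \<in> carrier V \<Longrightarrow> scale V 0 x = zero V"
    and "scale V c (zero V) = zero V"
proof -
  show "scale V 0 x = zero V" if "x \<in> carrier V"
    using vspace_idem_zero[OF V, of "scale V 0 x"] vspace_laws(5)[OF V that, of 0 0]
      vspace_closed(3)[OF V that] by simp
  show "scale V c (zero V) = zero V"
    using vspace_idem_zero[OF V, of "scale V c (zero V)"] vspace_laws(3,4)[OF V] vspace_closed[OF V] by metis
qed

lemma lin_mem: "lin V W f \<Longrightarrow> x \<in> carrier V \<Longrightarrow> f x \<in> carrier W"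
  by (simp add: lin_def)

lemma lin_zero:
  assumes "is_vspace V" "is_vspace W" "lin V W f"
  shows "f (zero V) = zero W"
proof -
  have "f (scale V 0 (zero V)) = scale W 0 (f (zero V))"
    using assms vspace_closed(2) unfolding lin_def by blast
  then show ?thesis
    using assms by (simp add: vspace_scale_zero vspace_closed lin_mem)
qed

lemma lin_comp: "lin U V g \<Longrightarrow> lin V W f \<Longrightarrow> lin U W (\<lambda>x. f (g x))"
  by (simp add: lin_def)

lemma lin_cong: "(\<And>x. x \<in> carrier V \<Longrightarrow> f x = g x) \<Longrightarrow> is_vspace V \<Longrightarrow> lin V W f = lin V W g"
  by (simp add: lin_def vspace_closed)

lemma bilinI:
  assumes "\<And>n. n \<in> carrier N \<Longrightarrow> lin M W (\<lambda>m. B m n)"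
    and "\<And>m. m \<in> carrier M \<Longrightarrow> lin N W (\<lambda>n. B m n)"
  shows "bilin M N W B"
  using assms by (simp add: bilin_def)

lemma bilin_mem: "bilin M N W B \<Longrightarrow> m \<in> carrier M \<Longrightarrow> n \<in> carrier N \<Longrightarrow> B m n \<in> carrier W"
  by (simp add: bilin_def lin_def)

lemma is_vspace_ground: "is_vspace (ground :: ('k::field, 'k) vspace)"
  by (auto simp: is_vspace_def ground_def algebra_simps intro: exI[of _ "- _"])

lemma carrier_ground [simp]: "carrier ground = UNIV"
  and scale_ground [simp]: "scale ground = (*)"
  and add_ground [simp]: "add ground = (+)"
  by (simp_all add: ground_def)


section \<open>The universal property of the tensor product\<close>

text \<open>Finite sums in a carrier come from \<^locale>\<open>comm_monoid_set\<close>, which needs a commutative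
  monoid on a whole type: elements outside the carrier absorb those inside, and two elements
  outside add up to one fixed element outside.\<close>

definition total_add :: "('k::field, 'a, 'z) vspace_scheme \<Rightarrow> 'a \<Rightarrow> 'a \<Rightarrow> 'a" where
  "total_add V x y =
    (if x \<in> carrier V then if y \<in> carrier V then add V x y else y
     else if y \<in> carrier V then x else (SOME z. z \<notin> carrier V))"

lemma comm_monoid_total_add:
  assumes V: "is_vspace V"
  shows "comm_monoid (total_add V) (zero V)"
proof -
  have out: "(SOME z. z \<notin> carrier V) \<notin> carrier V" if "x \<notin> carrier V" for x
    using that by (metis someI_ex)
  have zero_right: "add V x (zero V) = x" if "x \<in> carrier V" for x
    using vspace_laws(2,3)[OF V] vspace_closed(2)[OF V] that by metis
  show ?thesis
    by unfold_locales
      (auto simp: total_add_def vspace_closed[OF V] vspace_laws(1,3)[OF V] out zero_right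
        intro: vspace_laws(2)[OF V] dest: out)
qed

definition vsum :: "('k::field, 'a, 'z) vspace_scheme \<Rightarrow> ('i \<Rightarrow> 'a) \<Rightarrow> 'i set \<Rightarrow> 'a" where
  "vsum V = comm_monoid_set.F (total_add V) (zero V)"

text \<open>The map on formal combinations that induces the lift of \<open>B\<close>. Pairs outside
  the carriers are dropped from the sum, so that it is additive and homogeneous on all formal
  combinations.\<close>

definition eval_formal ::
    "('k::field, 'a, 'x) vspace_scheme \<Rightarrow> ('k, 'b, 'y) vspace_scheme \<Rightarrow> ('k, 'c, 'z) vspace_scheme \<Rightarrow>
      ('a \<Rightarrow> 'b \<Rightarrow> 'c) \<Rightarrow> ('a \<times> 'b \<Rightarrow>\<^sub>0 'k) \<Rightarrow> 'c" where
  "eval_formal M N W B f =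
    vsum W (\<lambda>p. scale W (Poly_Mapping.lookup f p) (B (fst p) (snd p)))
      (Poly_Mapping.keys f \<inter> (carrier M \<times> carrier N))"

context
  fixes M :: "('k::field, 'a, 'x) vspace_scheme" and N :: "('k, 'b, 'y) vspace_scheme"
    and W :: "('k, 'c, 'z) vspace_scheme" and B :: "'a \<Rightarrow> 'b \<Rightarrow> 'c"
  assumes M: "is_vspace M" and N: "is_vspace N" and W: "is_vspace W" and B: "bilin M N W B"
begin

interpretation S: comm_monoid_set "total_add W" "zero W"
  rewrites "comm_monoid_set.F (total_add W) (zero W) = vsum W"
  using comm_monoid_total_add[OF W] by (simp_all add: comm_monoid_set_def vsum_def)

lemma vsum_mem: "(\<And>i. i \<in> I \<Longrightarrow> g i \<in> carrier W) \<Longrightarrow> vsum W g I \<in> carrier W"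
  by (induction I rule: infinite_finite_induct)
    (simp_all add: vspace_closed[OF W] total_add_def)

lemma vsum_scale:
  "(\<And>i. i \<in> I \<Longrightarrow> g i \<in> carrier W) \<Longrightarrow> vsum W (\<lambda>i. scale W c (g i)) I = scale W c (vsum W g I)"
  by (induction I rule: infinite_finite_induct)
    (simp_all add: vspace_closed[OF W] total_add_def vspace_scale_zero[OF W] vspace_laws(4)[OF W] vsum_mem)

text \<open>Coefficients vanish off the support, so two combinations can be summed over a common
  finite index set.\<close>

lemma eval_formal_superset:
  assumes "finite T" "Poly_Mapping.keys f \<subseteq> T"
  shows "eval_formal M N W B f =
    vsum W (\<lambda>p. scale W (Poly_Mapping.lookup f p) (B (fst p) (snd p))) (T \<inter> (carrier M \<times> carrier N))"
  unfolding eval_formal_def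
  by (rule S.mono_neutral_left)
    (use assms in \<open>auto simp: in_keys_iff vspace_scale_zero[OF W] bilin_mem[OF B]\<close>)

lemma eval_formal_mem: "eval_formal M N W B f \<in> carrier W"
  unfolding eval_formal_def by (rule vsum_mem) (auto simp: vspace_closed[OF W] bilin_mem[OF B])

lemma eval_formal_add:
  "eval_formal M N W B (f + g) = add W (eval_formal M N W B f) (eval_formal M N W B g)"
proof -
  let ?T = "Poly_Mapping.keys f \<union> Poly_Mapping.keys g"
  let ?s = "\<lambda>f. \<lambda>p. scale W (Poly_Mapping.lookup f p) (B (fst p) (snd p))"
  have "eval_formal M N W B (f + g) = vsum W (?s (f + g)) (?T \<inter> (carrier M \<times> carrier N))"
    by (intro eval_formal_superset) (simp_all add: Poly_Mapping.keys_add)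
  also have "\<dots> = vsum W (\<lambda>p. total_add W (?s f p) (?s g p)) (?T \<inter> (carrier M \<times> carrier N))"
    by (rule S.cong)
      (auto simp: lookup_add vspace_laws(5)[OF W] bilin_mem[OF B] total_add_def vspace_closed[OF W])
  also have "\<dots> = total_add W (eval_formal M N W B f) (eval_formal M N W B g)"
    by (simp add: S.distrib eval_formal_superset[of ?T])
  finally show ?thesis
    by (simp add: total_add_def eval_formal_mem)
qed

lemma eval_formal_scale:
  "eval_formal M N W B (fscale c f) = scale W c (eval_formal M N W B f)"
proof -
  have "eval_formal M N W B (fscale c f) =
    vsum W (\<lambda>p. scale W (Poly_Mapping.lookup (fscale c f) p) (B (fst p) (snd p)))
      (Poly_Mapping.keys f \<inter> (carrier M \<times> carrier N))"
    by (rule eval_formal_superset) (auto simp: in_keys_iff lookup_fscale)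
  also have "\<dots> = vsum W (\<lambda>p. scale W c (scale W (Poly_Mapping.lookup f p) (B (fst p) (snd p))))
      (Poly_Mapping.keys f \<inter> (carrier M \<times> carrier N))"
    by (rule S.cong) (auto simp: lookup_fscale vspace_laws(6)[OF W] bilin_mem[OF B])
  also have "\<dots> = scale W c (eval_formal M N W B f)"
    unfolding eval_formal_def by (rule vsum_scale) (auto simp: vspace_closed[OF W] bilin_mem[OF B])
  finally show ?thesis .
qed

lemma eval_formal_single:
  "m \<in> carrier M \<Longrightarrow> n \<in> carrier N \<Longrightarrow>
    eval_formal M N W B (Poly_Mapping.single (m, n) c) = scale W c (B m n)"
  by (subst eval_formal_superset[of "{(m, n)}"])
    (simp_all add: total_add_def vspace_closed[OF W] bilin_mem[OF B] vspace_laws(2)[OF W, of _ "zero W"] vspace_laws(3)[OF W])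

text \<open>\<open>is_vspace\<close> offers no subtraction, so the common value is cancelled with an
  additive inverse. Each generator of the bilinearity relations is a difference of two combinations
  with the same value.\<close>

lemma eval_formal_diff_zero:
  assumes "eval_formal M N W B f = eval_formal M N W B g"
  shows "eval_formal M N W B (f - g) = zero W"
proof -
  have "eval_formal M N W B f = add W (eval_formal M N W B (f - g)) (eval_formal M N W B g)"
    using eval_formal_add[of "f - g" g] by simp
  then have eq: "eval_formal M N W B g = add W (eval_formal M N W B (f - g)) (eval_formal M N W B g)"
    using assms by simp
  obtain y where y: "y \<in> carrier W" "add W (eval_formal M N W B g) y = zero W"
    using vspace_neg[OF W eval_formal_mem] .
  have "zero W = add W (eval_formal M N W B (f - g)) (zero W)"
    using eq y vspace_laws(1)[OF W eval_formal_mem eval_formal_mem y(1)] by metis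
  then show ?thesis
    using vspace_laws(2,3)[OF W] eval_formal_mem vspace_closed(2)[OF W] by metis
qed

lemma eval_formal_relations:
  assumes "f \<in> tensor_relations M N"
  shows "eval_formal M N W B f = zero W"
  using assms unfolding tensor_relations_def
proof (induction rule: formal.span_induct)
  case base
  have "eval_formal M N W B 0 = zero W"
    using eval_formal_diff_zero[of 0 0] by simp
  then show ?case
    by (auto simp: formal.subspace_def eval_formal_add eval_formal_scale vspace_laws(3)[OF W]
        vspace_closed(2)[OF W] vspace_scale_zero[OF W])
next
  case (step x)
  \<comment> \<open>Groups the three-term relations into one difference, the form that
    \<open>eval_formal_diff_zero\<close> accepts.\<close>
  have diff: "a - b - c = a - (b + c)" for a b c :: "'a \<times> 'b \<Rightarrow>\<^sub>0 'k"
    by simp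
  have B': "B (add M m m') n = add W (B m n) (B m' n)" "B (scale M c m) n = scale W c (B m n)"
    if "m \<in> carrier M" "m' \<in> carrier M" "n \<in> carrier N" for c m m' n
    using B that by (simp_all add: bilin_def lin_def)
  have B'': "B m (add N n n') = add W (B m n) (B m n')" "B m (scale N c n) = scale W c (B m n)"
    if "m \<in> carrier M" "n \<in> carrier N" "n' \<in> carrier N" for c m n n'
    using B that by (simp_all add: bilin_def lin_def)
  note mem = bilin_mem[OF B] vspace_closed[OF W]
  show ?case
    using step
    by (elim UnE CollectE exE conjE; hypsubst; unfold diff; intro eval_formal_diff_zero)
      (simp_all add: eval_formal_add eval_formal_single vspace_laws(7)[OF W] B' B'' mem vspace_closed[OF M] vspace_closed[OF N])
qed

end

section \<open>The tensor product as a quotient vector space\<close>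

abbreviation supp_in :: "'x set \<Rightarrow> ('x \<Rightarrow>\<^sub>0 'k::zero) set" where
  "supp_in X \<equiv> {f. Poly_Mapping.keys f \<subseteq> X}"

lemma supp_in_closed:
  shows "f \<in> supp_in X \<Longrightarrow> g \<in> supp_in X \<Longrightarrow> f + g \<in> supp_in X"
    and "0 \<in> supp_in X"
    and "f \<in> supp_in X \<Longrightarrow> fscale c f \<in> supp_in X"
    and "x \<in> X \<Longrightarrow> Poly_Mapping.single x c \<in> supp_in X"
  using Poly_Mapping.keys_add[of f g] by (auto simp: in_keys_iff lookup_fscale split: if_splits)

lemma tensor_relations_closed:
  shows "0 \<in> tensor_relations M N"
    and "f \<in> tensor_relations M N \<Longrightarrow> g \<in> tensor_relations M N \<Longrightarrow> f + g \<in> tensor_relations M N"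
    and "f \<in> tensor_relations M N \<Longrightarrow> g \<in> tensor_relations M N \<Longrightarrow> f - g \<in> tensor_relations M N"
    and "f \<in> tensor_relations M N \<Longrightarrow> fscale c f \<in> tensor_relations M N"
  unfolding tensor_relations_def
  by (auto intro: formal.span_zero formal.span_add formal.span_diff formal.span_scale)

lemma tensor_class_eq_iff:
  "tensor_class M N f = tensor_class M N g \<longleftrightarrow> f - g \<in> tensor_relations M N"
proof
  assume "tensor_class M N f = tensor_class M N g"
  moreover have "f \<in> tensor_class M N f"
    by (simp add: tensor_class_def tensor_relations_closed)
  ultimately show "f - g \<in> tensor_relations M N"
    by (simp add: tensor_class_def)
next
  assume *: "f - g \<in> tensor_relations M N"
  have "h - f \<in> tensor_relations M N \<longleftrightarrow> h - g \<in> tensor_relations M N" for h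
    using tensor_relations_closed(2)[of "h - f" M N "f - g"] tensor_relations_closed(3)[of "h - g" M N "f - g"] *
    by auto
  then show "tensor_class M N f = tensor_class M N g"
    by (simp add: tensor_class_def)
qed

lemma tensor_class_self: "f \<in> tensor_class M N f"
  by (simp add: tensor_class_def tensor_relations_closed)


lemma carrier_tensor: "carrier (M \<otimes> N) = tensor_class M N ` supp_in (carrier M \<times> carrier N)"
  by (simp add: tensor_space_def Let_def)

lemma zero_tensor: "zero (M \<otimes> N) = tensor_class M N 0"
  by (simp add: tensor_space_def Let_def)

lemma add_tensor:
  assumes "f \<in> supp_in (carrier M \<times> carrier N)" "g \<in> supp_in (carrier M \<times> carrier N)"
  shows "add (M \<otimes> N) (tensor_class M N f) (tensor_class M N g) = tensor_class M N (f + g)"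
proof -
  have "{a + b |a b. a \<in> tensor_class M N f \<and> b \<in> tensor_class M N g} = tensor_class M N (f + g)"
  proof (intro equalityI subsetI)
    fix x assume "x \<in> {a + b |a b. a \<in> tensor_class M N f \<and> b \<in> tensor_class M N g}"
    then obtain a b where "x = a + b" "a - f \<in> tensor_relations M N" "b - g \<in> tensor_relations M N"
      by (auto simp: tensor_class_def)
    then have "x - (f + g) \<in> tensor_relations M N"
      using tensor_relations_closed(2)[of "a - f" M N "b - g"] by (simp add: algebra_simps)
    then show "x \<in> tensor_class M N (f + g)"
      by (simp add: tensor_class_def)
  next
    fix x assume "x \<in> tensor_class M N (f + g)"
    then have "x = (x - g) + g" "x - g \<in> tensor_class M N f" "g \<in> tensor_class M N g"
      by (simp_all add: tensor_class_def algebra_simps tensor_relations_closed)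
    then show "x \<in> {a + b |a b. a \<in> tensor_class M N f \<and> b \<in> tensor_class M N g}"
      by blast
  qed
  then show ?thesis
    using assms by (simp add: tensor_space_def Let_def)
qed

lemma scale_tensor:
  assumes "f \<in> supp_in (carrier M \<times> carrier N)"
  shows "scale (M \<otimes> N) c (tensor_class M N f) = tensor_class M N (fscale c f)"
proof -
  have "tensor_class M N (fscale c g) = tensor_class M N (fscale c f)" if "g \<in> tensor_class M N f" for g
  proof -
    have "g - f \<in> tensor_relations M N"
      using that by (simp add: tensor_class_def)
    then show ?thesis
      using tensor_relations_closed(4)[of "g - f" M N c]
      by (simp add: tensor_class_eq_iff formal.scale_right_diff_distrib)
  qed
  then have "(\<Union>g\<in>tensor_class M N f. tensor_class M N (fscale c g)) = tensor_class M N (fscale c f)"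
    using tensor_class_self by blast
  then show ?thesis
    using assms by (simp add: tensor_space_def Let_def)
qed

lemma is_vspace_tensor:
  fixes M :: "('k::field, 'a, 'x) vspace_scheme" and N :: "('k, 'b, 'y) vspace_scheme"
  shows "is_vspace (M \<otimes> N)"
proof -
  let ?P = "supp_in (carrier M \<times> carrier N) :: ('a \<times> 'b \<Rightarrow>\<^sub>0 'k) set"
  have ext: "add (M \<otimes> N) \<in> extensional (carrier (M \<otimes> N))"
    "\<And>s. s \<in> carrier (M \<otimes> N) \<Longrightarrow> add (M \<otimes> N) s \<in> extensional (carrier (M \<otimes> N))"
    "\<And>c. scale (M \<otimes> N) c \<in> extensional (carrier (M \<otimes> N))"
    by (simp_all add: tensor_space_def Let_def)
  have neg: "\<exists>g\<in>?P. tensor_class M N (f + g) = tensor_class M N 0" if "f \<in> ?P" for f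
    using that by (intro bexI[of _ "- f"]) simp_all
  show ?thesis
    unfolding is_vspace_def PiE_def
    by (intro conjI allI ballI IntI Pi_I ext; (assumption)?; (clarsimp simp only: carrier_tensor zero_tensor)?)
      (auto simp: add_tensor[unfolded mem_Collect_eq] scale_tensor[unfolded mem_Collect_eq]
         supp_in_closed[unfolded mem_Collect_eq] formal.scale_right_distrib formal.scale_left_distrib ac_simps
         intro: neg[unfolded mem_Collect_eq Bex_def])
qed

lemma tensor_elt_mem: "m \<in> carrier M \<Longrightarrow> n \<in> carrier N \<Longrightarrow> m \<otimes>\<^bsub>M,N\<^esub> n \<in> carrier (M \<otimes> N)"
  by (auto simp: tensor_elt_def carrier_tensor)

lemma tensor_relations_gens:
  shows "m \<in> carrier M \<Longrightarrow> m' \<in> carrier M \<Longrightarrow> n \<in> carrier N \<Longrightarrow>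
      Poly_Mapping.single (add M m m', n) 1 - Poly_Mapping.single (m, n) 1 - Poly_Mapping.single (m', n) 1
        \<in> tensor_relations M N"
    and "m \<in> carrier M \<Longrightarrow> n \<in> carrier N \<Longrightarrow> n' \<in> carrier N \<Longrightarrow>
      Poly_Mapping.single (m, add N n n') 1 - Poly_Mapping.single (m, n) 1 - Poly_Mapping.single (m, n') 1
        \<in> tensor_relations M N"
    and "m \<in> carrier M \<Longrightarrow> n \<in> carrier N \<Longrightarrow>
      Poly_Mapping.single (scale M c m, n) 1 - Poly_Mapping.single (m, n) c \<in> tensor_relations M N"
    and "m \<in> carrier M \<Longrightarrow> n \<in> carrier N \<Longrightarrow>
      Poly_Mapping.single (m, scale N c n) 1 - Poly_Mapping.single (m, n) c \<in> tensor_relations M N"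
  unfolding tensor_relations_def by (rule formal.span_base; blast)+

lemma fscale_single: "fscale c (Poly_Mapping.single x d) = Poly_Mapping.single x (c * d)"
  by (rule poly_mapping_eqI) (simp add: lookup_fscale lookup_single when_def)

lemma bilin_tensor_elt:
  assumes M: "is_vspace M" and N: "is_vspace N"
  shows "bilin M N (M \<otimes> N) (\<lambda>m n. m \<otimes>\<^bsub>M,N\<^esub> n)"
  unfolding bilin_def lin_def tensor_elt_def
  by (intro conjI ballI allI tensor_elt_mem[unfolded tensor_elt_def]; (assumption)?;
      subst add_tensor scale_tensor;
      simp add: tensor_class_eq_iff fscale_single tensor_relations_gens flip: diff_diff_eq)

lemma tensor_class_single:
  assumes "m \<in> carrier M" "n \<in> carrier N" "is_vspace M"
  shows "tensor_class M N (Poly_Mapping.single (m, n) c) = scale M c m \<otimes>\<^bsub>M,N\<^esub> n"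
  unfolding tensor_elt_def by (rule sym) (use assms in \<open>simp add: tensor_class_eq_iff tensor_relations_gens\<close>)

text \<open>A formal combination is built up one coefficient at a time. The coefficient is absorbed
  into the first factor by \<open>tensor_class_single\<close>, so the induction step deals with pure
  tensors without scalars.\<close>

lemma tensor_induct [consumes 3, case_names zero add]:
  assumes "t \<in> carrier (M \<otimes> N)" "is_vspace M" "is_vspace N"
    and zero: "P (zero (M \<otimes> N))"
    and add: "\<And>m n t. m \<in> carrier M \<Longrightarrow> n \<in> carrier N \<Longrightarrow> t \<in> carrier (M \<otimes> N) \<Longrightarrow> P t \<Longrightarrow>
      P (add (M \<otimes> N) (m \<otimes>\<^bsub>M,N\<^esub> n) t)"
  shows "P t"
proof -
  have "Poly_Mapping.keys f \<subseteq> carrier M \<times> carrier N \<Longrightarrow> P (tensor_class M N f)" for f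
  proof (induction f rule: update_induct)
    case const
    then show ?case using zero by (simp add: zero_tensor)
  next
    case (update f a b)
    then have 1: "Poly_Mapping.update a b f = Poly_Mapping.single a b + f"
      by (intro poly_mapping_eqI)
        (auto simp: lookup_add lookup_single when_def lookup_update in_keys_iff)
    have keys: "Poly_Mapping.keys (Poly_Mapping.update a b f) = insert a (Poly_Mapping.keys f)"
      using update by (simp add: keys_update)
    obtain m n where a: "a = (m, n)" "m \<in> carrier M" "n \<in> carrier N"
      using update.prems keys by auto
    have f: "Poly_Mapping.keys f \<subseteq> carrier M \<times> carrier N"
      using update.prems keys by simp
    have "tensor_class M N (Poly_Mapping.single a b + f) =
        add (M \<otimes> N) (tensor_class M N (Poly_Mapping.single a b)) (tensor_class M N f)"
      by (rule add_tensor[symmetric]) (use a f in auto)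
    also have "\<dots> = add (M \<otimes> N) (scale M b m \<otimes>\<^bsub>M,N\<^esub> n) (tensor_class M N f)"
      using a assms by (simp add: tensor_class_single)
    also have "P \<dots>"
      using a f assms(2) update.IH by (intro add) (auto simp: vspace_closed carrier_tensor)
    finally show ?case by (simp add: 1)
  qed
  then show ?thesis
    using assms(1) by (auto simp: carrier_tensor)
qed

text \<open>Pure tensors span. Most identities of linear maps on tensor products are reduced by this
  rule to a computation with Sweedler sums.\<close>

lemma lin_tensor_eqI:
  assumes "lin (M \<otimes> N) W f" "lin (M \<otimes> N) W g" "is_vspace M" "is_vspace N" "is_vspace W"
    and "\<And>m n. m \<in> carrier M \<Longrightarrow> n \<in> carrier N \<Longrightarrow> f (m \<otimes>\<^bsub>M,N\<^esub> n) = g (m \<otimes>\<^bsub>M,N\<^esub> n)"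
    and "t \<in> carrier (M \<otimes> N)"
  shows "f t = g t"
  using assms(7,3,4)
proof (induction t rule: tensor_induct)
  case zero
  then show ?case using assms by (simp add: lin_zero[of "M \<otimes> N" W] is_vspace_tensor)
next
  case (add m n t)
  then show ?case using assms(1,2,6) by (simp add: lin_def tensor_elt_mem)
qed

lemma tensor_lift_char:
  assumes M: "is_vspace M" and N: "is_vspace N" and W: "is_vspace W" and B: "bilin M N W B"
  shows "tensor_lift M N W B \<in> linear_maps (M \<otimes> N) W \<and>
    (\<forall>m\<in>carrier M. \<forall>n\<in>carrier N. tensor_lift M N W B (m \<otimes>\<^bsub>M,N\<^esub> n) = B m n)"
proof -
  \<comment> \<open>Any representative will do: two of them differ by a relation, and relations
    evaluate to zero.\<close>
  define g where "g = (\<lambda>t\<in>carrier (M \<otimes> N). eval_formal M N W B (SOME f. f \<in> t))"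
  have g: "g (tensor_class M N f) = eval_formal M N W B f"
    if "f \<in> supp_in (carrier M \<times> carrier N)" for f
  proof -
    define h where "h = (SOME h. h \<in> tensor_class M N f)"
    have "h \<in> tensor_class M N f"
      unfolding h_def by (rule someI, rule tensor_class_self)
    then have "eval_formal M N W B (h - f) = zero W"
      using eval_formal_relations[OF M N W B] by (simp add: tensor_class_def)
    then have "eval_formal M N W B h = eval_formal M N W B f"
      using eval_formal_add[OF M N W B, of "h - f" f] eval_formal_mem[OF M N W B]
      by (simp add: vspace_laws(3)[OF W])
    moreover have "tensor_class M N f \<in> carrier (M \<otimes> N)"
      using that by (simp add: carrier_tensor)
    ultimately show ?thesis
      by (simp add: g_def h_def)
  qed
  have "g \<in> linear_maps (M \<otimes> N) W"
    unfolding linear_maps_iff lin_def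
    by (auto simp: carrier_tensor add_tensor[unfolded mem_Collect_eq] scale_tensor[unfolded mem_Collect_eq]
        g[unfolded mem_Collect_eq] supp_in_closed[unfolded mem_Collect_eq]
        eval_formal_mem[OF M N W B] eval_formal_add[OF M N W B] eval_formal_scale[OF M N W B])
      (simp add: g_def carrier_tensor)
  moreover have "g (m \<otimes>\<^bsub>M,N\<^esub> n) = B m n" if "m \<in> carrier M" "n \<in> carrier N" for m n
    using that by (simp add: tensor_elt_def g eval_formal_single[OF M N W B] vspace_laws(7)[OF W] bilin_mem[OF B])
  ultimately have g: "g \<in> linear_maps (M \<otimes> N) W \<and>
    (\<forall>m\<in>carrier M. \<forall>n\<in>carrier N. g (m \<otimes>\<^bsub>M,N\<^esub> n) = B m n)"
    by blast
  have "tensor_lift M N W B = g"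
    unfolding tensor_lift_def
  proof (rule the_equality, rule g)
    fix h assume h: "h \<in> linear_maps (M \<otimes> N) W \<and>
      (\<forall>m\<in>carrier M. \<forall>n\<in>carrier N. h (m \<otimes>\<^bsub>M,N\<^esub> n) = B m n)"
    show "h = g"
      by (rule extensionalityI[of _ "carrier (M \<otimes> N)"])
        (use g h lin_tensor_eqI[OF _ _ M N W, of h g] in \<open>auto simp: linear_maps_iff\<close>)
  qed
  then show ?thesis using g by simp
qed

section \<open>Linearity conditions and the calculus of iterated lifts\<close>

named_theorems vs "membership, linearity and vector space conditions"

declare is_vspace_ground [vs] is_vspace_tensor [vs] tensor_elt_mem [vs] bilin_def [vs] vspace_closed(3) [vs]

lemma lin_ident [vs]: "lin V V (\<lambda>x. x)" "lin V V id"
  by (simp_all add: lin_def)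

lemma lin_scale [vs]:
  "is_vspace W \<Longrightarrow> lin V W g \<Longrightarrow> lin V W (\<lambda>x. scale W c (g x))"
  by (simp add: lin_def vspace_closed vspace_laws mult.commute flip: vspace_laws(6))

lemma lin_scale_left [vs]:
  "is_vspace W \<Longrightarrow> lin V ground \<phi> \<Longrightarrow> w \<in> carrier W \<Longrightarrow> lin V W (\<lambda>x. scale W (\<phi> x) w)"
  by (simp add: lin_def vspace_closed vspace_laws)

lemma lin_times [vs]:
  "lin V ground \<phi> \<Longrightarrow> lin V ground (\<lambda>x. \<phi> x * c)" "lin V ground \<phi> \<Longrightarrow> lin V ground (\<lambda>x. c * \<phi> x)"
  by (simp_all add: lin_def algebra_simps)

lemma lin_tensor_elt [vs]:
  assumes "is_vspace M" "is_vspace N"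
  shows "lin V M g \<Longrightarrow> n \<in> carrier N \<Longrightarrow> lin V (M \<otimes> N) (\<lambda>x. g x \<otimes>\<^bsub>M,N\<^esub> n)"
    and "m \<in> carrier M \<Longrightarrow> lin V N h \<Longrightarrow> lin V (M \<otimes> N) (\<lambda>x. m \<otimes>\<^bsub>M,N\<^esub> h x)"
  using bilin_tensor_elt[OF assms] by (simp_all add: bilin_def lin_def)

lemma lift_pure:
  assumes "is_vspace M" "is_vspace N" "is_vspace W" "bilin M N W B" "m \<in> carrier M" "n \<in> carrier N"
  shows "tensor_lift M N W B (m \<otimes>\<^bsub>M,N\<^esub> n) = B m n"
  using tensor_lift_char[OF assms(1-4)] assms(5,6) by blast

lemma lin_tensor_lift:
  assumes "is_vspace M" "is_vspace N" "is_vspace W" "bilin M N W B"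
  shows "lin (M \<otimes> N) W (tensor_lift M N W B)"
  using tensor_lift_char[OF assms] linear_mapsD by blast

lemma tensor_lift_linear_maps:
  assumes "is_vspace M" "is_vspace N" "is_vspace W" "bilin M N W B"
  shows "tensor_lift M N W B \<in> linear_maps (M \<otimes> N) W"
  using tensor_lift_char[OF assms] by blast

lemma tensor_lift_mem [vs]:
  assumes "is_vspace M" "is_vspace N" "is_vspace W" "bilin M N W B" "t \<in> carrier (M \<otimes> N)"
  shows "tensor_lift M N W B t \<in> carrier W"
  using lin_tensor_lift[OF assms(1-4)] assms(5) by (rule lin_mem)

lemma lin_tensor_lift_arg [vs]:
  assumes "is_vspace M" "is_vspace N" "is_vspace W" "bilin M N W B" "lin V (M \<otimes> N) g"
  shows "lin V W (\<lambda>x. tensor_lift M N W B (g x))"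
  using assms(5) lin_tensor_lift[OF assms(1-4)] by (rule lin_comp)

text \<open>The defining description looks at \<open>B\<close> only on the carriers. As a congruence
  rule this tells the simplifier, when it works inside a lift, that the bound Sweedler components
  lie in the carriers.\<close>

lemma tensor_lift_cong [cong]:
  assumes "M = M'" "N = N'" "W = W'" "t = t'"
    and "\<And>m n. m \<in> carrier M' \<Longrightarrow> n \<in> carrier N' \<Longrightarrow> B m n = B' m n"
  shows "tensor_lift M N W B t = tensor_lift M' N' W' B' t'"
  using assms unfolding tensor_lift_def by simp

lemma lift_eqI:
  assumes "is_vspace M" "is_vspace N" "is_vspace W" "bilin M N W B" "lin (M \<otimes> N) W f"
    and "\<And>m n. m \<in> carrier M \<Longrightarrow> n \<in> carrier N \<Longrightarrow> f (m \<otimes>\<^bsub>M,N\<^esub> n) = B m n"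
    and "t \<in> carrier (M \<otimes> N)"
  shows "f t = tensor_lift M N W B t"
  by (rule lin_tensor_eqI[OF assms(5) lin_tensor_lift[OF assms(1-4)] assms(1-3) _ assms(7)])
    (simp add: assms lift_pure)

lemma lift_push:
  assumes "is_vspace M" "is_vspace N" "is_vspace W" "is_vspace W'" "bilin M N W B" "lin W W' f"
    "t \<in> carrier (M \<otimes> N)"
  shows "f (tensor_lift M N W B t) = tensor_lift M N W' (\<lambda>m n. f (B m n)) t"
proof (rule lift_eqI[where f = "\<lambda>t. f (tensor_lift M N W B t)"])
  show "bilin M N W' (\<lambda>m n. f (B m n))"
    using assms by (auto simp: bilin_def intro: lin_comp)
  show "lin (M \<otimes> N) W' (\<lambda>t. f (tensor_lift M N W B t))"
    using lin_tensor_lift[OF assms(1-3,5)] assms(6) by (rule lin_comp)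
qed (simp_all add: assms lift_pure)

text \<open>Linearity in a parameter of the integrand rather than in the tensor. For fixed x and y
  the sum of the two lifts is linear in the tensor and has the right values on pure tensors, so
  uniqueness identifies it with the lift at the sum of x and y.\<close>

lemma lin_tensor_lift_body [vs]:
  assumes "is_vspace M" "is_vspace N" "is_vspace W" "is_vspace V"
    and bilin: "\<And>x. x \<in> carrier V \<Longrightarrow> bilin M N W (\<lambda>m n. B x m n)" 
    and lin: "\<And>m n. m \<in> carrier M \<Longrightarrow> n \<in> carrier N \<Longrightarrow> lin V W (\<lambda>x. B x m n)"
    and t: "t \<in> carrier (M \<otimes> N)"
  shows "lin V W (\<lambda>x. tensor_lift M N W (\<lambda>m n. B x m n) t)"
proof -
  have mem: "x \<in> carrier V \<Longrightarrow> tensor_lift M N W (B x) t \<in> carrier W" for x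
    using assms by (intro tensor_lift_mem) auto
  have "tensor_lift M N W (B (add V x y)) t = add W (tensor_lift M N W (B x) t) (tensor_lift M N W (B y) t)"
    if xy: "x \<in> carrier V" "y \<in> carrier V" for x y
  proof (rule lift_eqI[symmetric, where f = "\<lambda>t. add W (tensor_lift M N W (B x) t) (tensor_lift M N W (B y) t)"])
    have *: "add W (add W a b) (add W c d) = add W (add W a c) (add W b d)"
      if "a \<in> carrier W" "b \<in> carrier W" "c \<in> carrier W" "d \<in> carrier W" for a b c d
      using that vspace_laws(1,2)[OF assms(3)] vspace_closed(1)[OF assms(3)] by metis
    show "lin (M \<otimes> N) W (\<lambda>t. add W (tensor_lift M N W (B x) t) (tensor_lift M N W (B y) t))"
      using lin_tensor_lift[OF assms(1-3) bilin[OF xy(1)]] lin_tensor_lift[OF assms(1-3) bilin[OF xy(2)]]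
      by (simp add: lin_def vspace_laws(4)[OF assms(3)] vspace_closed[OF assms(3)] *)
  qed (use xy lin bilin[OF xy(1)] bilin[OF xy(2)] bilin[of "add V x y"] t in
      \<open>simp_all add: assms(1-4) lift_pure vspace_closed lin_def\<close>)
  moreover have "tensor_lift M N W (B (scale V c x)) t = scale W c (tensor_lift M N W (B x) t)"
    if x: "x \<in> carrier V" for x c
  proof (rule lift_eqI[symmetric, where f = "\<lambda>t. scale W c (tensor_lift M N W (B x) t)"])
    show "lin (M \<otimes> N) W (\<lambda>t. scale W c (tensor_lift M N W (B x) t))"
      by (intro lin_scale lin_tensor_lift bilin x assms)
  qed (use x lin bilin[OF x] bilin[of "scale V c x"] t in
      \<open>simp_all add: assms(1-4) lift_pure vspace_closed lin_def\<close>)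
  ultimately show ?thesis
    using mem by (simp add: lin_def)
qed

text \<open>Fubini for Sweedler sums: both sides are linear in t and agree when t is pure.\<close>

lemma lift_swap:
  assumes "is_vspace M" "is_vspace N" "is_vspace P" "is_vspace Q" "is_vspace W"
    and "\<And>m n. m \<in> carrier M \<Longrightarrow> n \<in> carrier N \<Longrightarrow> bilin P Q W (\<lambda>p q. B m n p q)"
    and "\<And>p q. p \<in> carrier P \<Longrightarrow> q \<in> carrier Q \<Longrightarrow> bilin M N W (\<lambda>m n. B m n p q)"
    and "s \<in> carrier (M \<otimes> N)" "t \<in> carrier (P \<otimes> Q)"
  shows "tensor_lift M N W (\<lambda>m n. tensor_lift P Q W (\<lambda>p q. B m n p q) t) s =
    tensor_lift P Q W (\<lambda>p q. tensor_lift M N W (\<lambda>m n. B m n p q) s) t"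
proof (rule lift_eqI[where f = "\<lambda>t. tensor_lift M N W (\<lambda>m n. tensor_lift P Q W (\<lambda>p q. B m n p q) t) s"])
  have l: "m \<in> carrier M \<Longrightarrow> q \<in> carrier Q \<Longrightarrow> n \<in> carrier N \<Longrightarrow> lin P W (\<lambda>p. B m n p q)"
    "m \<in> carrier M \<Longrightarrow> p \<in> carrier P \<Longrightarrow> n \<in> carrier N \<Longrightarrow> lin Q W (\<lambda>q. B m n p q)"
    "p \<in> carrier P \<Longrightarrow> q \<in> carrier Q \<Longrightarrow> n \<in> carrier N \<Longrightarrow> lin M W (\<lambda>m. B m n p q)"
    "p \<in> carrier P \<Longrightarrow> q \<in> carrier Q \<Longrightarrow> m \<in> carrier M \<Longrightarrow> lin N W (\<lambda>n. B m n p q)"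
    for m n p q using assms(6,7) by (auto simp: bilin_def)
  show "bilin P Q W (\<lambda>p q. tensor_lift M N W (\<lambda>m n. B m n p q) s)"
    by (simp add: vs assms l)
  show "lin (P \<otimes> Q) W (\<lambda>t. tensor_lift M N W (\<lambda>m n. tensor_lift P Q W (\<lambda>p q. B m n p q) t) s)"
    by (simp add: vs assms l)
  fix p q assume "p \<in> carrier P" "q \<in> carrier Q"
  then show "tensor_lift M N W (\<lambda>m n. tensor_lift P Q W (\<lambda>p q. B m n p q) (p \<otimes>\<^bsub>P,Q\<^esub> q)) s =
      tensor_lift M N W (\<lambda>m n. B m n p q) s"
    by (simp add: lift_pure assms)
qed (use assms in simp_all)

lemma lift_tensor_elt:
  assumes "is_vspace M" "is_vspace N" "t \<in> carrier (M \<otimes> N)"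
  shows "tensor_lift M N (M \<otimes> N) (\<lambda>m n. m \<otimes>\<^bsub>M,N\<^esub> n) t = t"
  by (rule lift_eqI[where f = "\<lambda>t. t", symmetric]) (simp_all add: vs assms)

named_theorems push "rewrite rules that move lifts outwards"

lemma push_scale [push]:
  assumes "is_vspace M" "is_vspace N" "is_vspace W" "bilin M N W B" "t \<in> carrier (M \<otimes> N)"
  shows "scale W c (tensor_lift M N W B t) = tensor_lift M N W (\<lambda>m n. scale W c (B m n)) t"
  using assms by (intro lift_push) (simp_all add: vs)

lemma push_tensor_elt [push]:
  assumes "is_vspace M" "is_vspace N" "is_vspace W" "is_vspace Q" "bilin M N W B" "t \<in> carrier (M \<otimes> N)"
    "q \<in> carrier Q"
  shows "tensor_lift M N W B t \<otimes>\<^bsub>W,Q\<^esub> q = tensor_lift M N (W \<otimes> Q) (\<lambda>m n. B m n \<otimes>\<^bsub>W,Q\<^esub> q) t"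
    and "q \<otimes>\<^bsub>Q,W\<^esub> tensor_lift M N W B t = tensor_lift M N (Q \<otimes> W) (\<lambda>m n. q \<otimes>\<^bsub>Q,W\<^esub> B m n) t"
  using assms
  by (intro lift_push[of M N W "W \<otimes> Q" B "\<lambda>w. w \<otimes>\<^bsub>W,Q\<^esub> q"]
      lift_push[of M N W "Q \<otimes> W" B "\<lambda>w. q \<otimes>\<^bsub>Q,W\<^esub> w"]; simp add: vs)+

lemma push_scalar [push]:
  assumes "is_vspace M" "is_vspace N" "bilin M N ground b" "t \<in> carrier (M \<otimes> N)"
  shows "is_vspace Q \<Longrightarrow> w \<in> carrier Q \<Longrightarrow>
      scale Q (tensor_lift M N ground b t) w = tensor_lift M N Q (\<lambda>m n. scale Q (b m n) w) t"
    and "tensor_lift M N ground b t * c = tensor_lift M N ground (\<lambda>m n. b m n * c) t"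
    and "c * tensor_lift M N ground b t = tensor_lift M N ground (\<lambda>m n. c * b m n) t"
  using assms
  by (intro lift_push[of M N ground Q b "\<lambda>c. scale Q c w"]
      lift_push[of M N ground ground b "\<lambda>d. d * c"] lift_push[of M N ground ground b "\<lambda>d. c * d"];
      simp add: vs)+

lemma push_lift [push]:
  assumes "is_vspace M" "is_vspace N" "is_vspace P" "is_vspace Q" "is_vspace W" "bilin M N (P \<otimes> Q) B"
     "bilin P Q W C" "t \<in> carrier (M \<otimes> N)"
   shows "tensor_lift P Q W C (tensor_lift M N (P \<otimes> Q) B t) = tensor_lift M N W (\<lambda>m n. tensor_lift P Q W C (B m n)) t"
  using assms by (intro lift_push) (simp_all add: is_vspace_tensor lin_tensor_lift)

lemma scale_tensor_elt:
  assumes "is_vspace M" "is_vspace N" "m \<in> carrier M" "n \<in> carrier N"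
  shows "scale M c m \<otimes>\<^bsub>M,N\<^esub> n = scale (M \<otimes> N) c (m \<otimes>\<^bsub>M,N\<^esub> n)"
    and "m \<otimes>\<^bsub>M,N\<^esub> scale N c n = scale (M \<otimes> N) c (m \<otimes>\<^bsub>M,N\<^esub> n)"
  using bilin_tensor_elt[OF assms(1,2)] assms(3,4) by (simp_all add: bilin_def lin_def)


section \<open>Tensor products of linear maps\<close>

context
  fixes M :: "('k::field, 'a, 'w) vspace_scheme" and N :: "('k, 'b, 'x) vspace_scheme"
    and M' :: "('k, 'c, 'y) vspace_scheme" and N' :: "('k, 'd, 'z) vspace_scheme"
    and f g
  assumes V: "is_vspace M" "is_vspace N" "is_vspace M'" "is_vspace N'"
    and fg: "lin M M' f" "lin N N' g"
begin

lemma tensor_map_bilin: "bilin M N (M' \<otimes> N') (\<lambda>m n. f m \<otimes>\<^bsub>M',N'\<^esub> g n)"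
  using fg by (simp add: vs V lin_mem[OF fg(1)] lin_mem[OF fg(2)])

lemma tensor_map_linear_maps: "tensor_map M N M' N' f g \<in> linear_maps (M \<otimes> N) (M' \<otimes> N')"
  unfolding tensor_map_def by (rule tensor_lift_linear_maps[OF V(1,2) is_vspace_tensor tensor_map_bilin])

lemma lin_tensor_map: "lin (M \<otimes> N) (M' \<otimes> N') (tensor_map M N M' N' f g)"
  by (rule linear_mapsD[OF tensor_map_linear_maps])

lemma tensor_map_mem [vs]: "t \<in> carrier (M \<otimes> N) \<Longrightarrow> tensor_map M N M' N' f g t \<in> carrier (M' \<otimes> N')"
  by (rule lin_mem[OF lin_tensor_map])

lemma tensor_map_pure:
  "m \<in> carrier M \<Longrightarrow> n \<in> carrier N \<Longrightarrow> tensor_map M N M' N' f g (m \<otimes>\<^bsub>M,N\<^esub> n) = f m \<otimes>\<^bsub>M',N'\<^esub> g n"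
  unfolding tensor_map_def by (rule lift_pure[OF V(1,2) is_vspace_tensor tensor_map_bilin])

lemma lin_tensor_map_arg [vs]:
  "lin U (M \<otimes> N) h \<Longrightarrow> lin U (M' \<otimes> N') (\<lambda>x. tensor_map M N M' N' f g (h x))"
  using lin_tensor_map by (rule lin_comp[rotated])

lemma push_tensor_map [push]:
  assumes "is_vspace P" "is_vspace Q" "bilin P Q (M \<otimes> N) B" "t \<in> carrier (P \<otimes> Q)"
  shows "tensor_map M N M' N' f g (tensor_lift P Q (M \<otimes> N) B t) =
    tensor_lift P Q (M' \<otimes> N') (\<lambda>p q. tensor_map M N M' N' f g (B p q)) t"
  using assms lin_tensor_map by (intro lift_push) (simp_all add: is_vspace_tensor)

lemma lift_tensor_map:
  assumes "is_vspace W" "bilin M' N' W B" "t \<in> carrier (M \<otimes> N)"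
  shows "tensor_lift M' N' W B (tensor_map M N M' N' f g t) = tensor_lift M N W (\<lambda>m n. B (f m) (g n)) t"
proof -
  have "tensor_lift M' N' W B (tensor_map M N M' N' f g t) =
    tensor_lift M N W (\<lambda>m n. tensor_lift M' N' W B (f m \<otimes>\<^bsub>M',N'\<^esub> g n)) t"
    unfolding tensor_map_def
    using assms V tensor_map_bilin by (intro push_lift) (simp_all)
  also have "\<dots> = tensor_lift M N W (\<lambda>m n. B (f m) (g n)) t"
    using assms V fg by (intro tensor_lift_cong refl lift_pure) (simp_all add: lin_mem)
  finally show ?thesis .
qed

end


lemma tensor_map_cong:
  assumes "\<And>m. m \<in> carrier M \<Longrightarrow> f m = f' m" "\<And>n. n \<in> carrier N \<Longrightarrow> g n = g' n"
  shows "tensor_map M N M' N' f g t = tensor_map M N M' N' f' g' t"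
  using assms unfolding tensor_map_def by simp

lemma tensor_map_comp:
  assumes "is_vspace M" "is_vspace N" "is_vspace M'" "is_vspace N'" "is_vspace M''" "is_vspace N''"
    "lin M M' f" "lin N N' g" "lin M' M'' f'" "lin N' N'' g'" "t \<in> carrier (M \<otimes> N)"
  shows "tensor_map M' N' M'' N'' f' g' (tensor_map M N M' N' f g t) =
    tensor_map M N M'' N'' (\<lambda>x. f' (f x)) (\<lambda>x. g' (g x)) t"
  unfolding tensor_map_def[of M' N' M'' N'']
  by (subst lift_tensor_map) (simp_all add: assms tensor_map_bilin is_vspace_tensor, simp add: tensor_map_def)

lemma tensor_map_ident:
  assumes "is_vspace M" "is_vspace N" "t \<in> carrier (M \<otimes> N)"
    "\<And>m. m \<in> carrier M \<Longrightarrow> f m = m" "\<And>n. n \<in> carrier N \<Longrightarrow> g n = n"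
  shows "tensor_map M N M N f g t = t"
proof -
  have "tensor_map M N M N f g t = tensor_lift M N (M \<otimes> N) (\<lambda>m n. m \<otimes>\<^bsub>M,N\<^esub> n) t"
    unfolding tensor_map_def by (simp add: assms(4,5))
  then show ?thesis using assms by (simp add: lift_tensor_elt)
qed

lemma lin_tensor3_eqI:
  assumes V: "is_vspace M" "is_vspace N" "is_vspace P" "is_vspace W"
    and fg: "lin (M \<otimes> N \<otimes> P) W f" "lin (M \<otimes> N \<otimes> P) W g"
    and eq: "\<And>m n p. m \<in> carrier M \<Longrightarrow> n \<in> carrier N \<Longrightarrow> p \<in> carrier P \<Longrightarrow>
      f ((m \<otimes>\<^bsub>M,N\<^esub> n) \<otimes>\<^bsub>M \<otimes> N,P\<^esub> p) = g ((m \<otimes>\<^bsub>M,N\<^esub> n) \<otimes>\<^bsub>M \<otimes> N,P\<^esub> p)"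
    and t: "t \<in> carrier (M \<otimes> N \<otimes> P)"
  shows "f t = g t"
proof (rule lin_tensor_eqI[OF fg is_vspace_tensor V(3,4) _ t])
  fix s p assume s: "s \<in> carrier (M \<otimes> N)" and p: "p \<in> carrier P"
  have l: "lin (M \<otimes> N) (M \<otimes> N \<otimes> P) (\<lambda>s. s \<otimes>\<^bsub>M \<otimes> N,P\<^esub> p)"
    using V p by (simp add: vs)
  show "f (s \<otimes>\<^bsub>M \<otimes> N,P\<^esub> p) = g (s \<otimes>\<^bsub>M \<otimes> N,P\<^esub> p)"
    by (rule lin_tensor_eqI[OF lin_comp[OF l fg(1)] lin_comp[OF l fg(2)] V(1,2,4) eq[OF _ _ p] s])
qed

lemma lin_tensor3_eqI':
  assumes V: "is_vspace M" "is_vspace N" "is_vspace P" "is_vspace W"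
    and fg: "lin (M \<otimes> (N \<otimes> P)) W f" "lin (M \<otimes> (N \<otimes> P)) W g"
    and eq: "\<And>m n p. m \<in> carrier M \<Longrightarrow> n \<in> carrier N \<Longrightarrow> p \<in> carrier P \<Longrightarrow>
      f (m \<otimes>\<^bsub>M,N \<otimes> P\<^esub> (n \<otimes>\<^bsub>N,P\<^esub> p)) = g (m \<otimes>\<^bsub>M,N \<otimes> P\<^esub> (n \<otimes>\<^bsub>N,P\<^esub> p))"
    and t: "t \<in> carrier (M \<otimes> (N \<otimes> P))"
  shows "f t = g t"
proof (rule lin_tensor_eqI[OF fg V(1) is_vspace_tensor V(4) _ t])
  fix m s assume s: "s \<in> carrier (N \<otimes> P)" and m: "m \<in> carrier M"
  have l: "lin (N \<otimes> P) (M \<otimes> (N \<otimes> P)) (\<lambda>s. m \<otimes>\<^bsub>M,N \<otimes> P\<^esub> s)"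
    using V m by (simp add: vs)
  show "f (m \<otimes>\<^bsub>M,N \<otimes> P\<^esub> s) = g (m \<otimes>\<^bsub>M,N \<otimes> P\<^esub> s)"
    by (rule lin_tensor_eqI[OF lin_comp[OF l fg(1)] lin_comp[OF l fg(2)] V(2,3,4) eq[OF m] s])
qed

context
  fixes M :: "('k::field, 'a, 'x) vspace_scheme" and N :: "('k, 'b, 'y) vspace_scheme"
    and P :: "('k, 'c, 'z) vspace_scheme"
  assumes V: "is_vspace M" "is_vspace N" "is_vspace P"
begin

lemma assoc_linear_maps: "assoc M N P \<in> linear_maps (M \<otimes> N \<otimes> P) (M \<otimes> (N \<otimes> P))"
  unfolding assoc_def using V by (intro tensor_lift_linear_maps) (simp_all add: vs)

lemma assoc_inv_linear_maps: "assoc_inv M N P \<in> linear_maps (M \<otimes> (N \<otimes> P)) (M \<otimes> N \<otimes> P)"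
  unfolding assoc_inv_def using V by (intro tensor_lift_linear_maps) (simp_all add: vs)

lemmas lin_assoc = linear_mapsD[OF assoc_linear_maps] linear_mapsD[OF assoc_inv_linear_maps]

lemmas assoc_mem [vs] = lin_assoc[THEN lin_mem]
lemmas lin_assoc_arg [vs] = lin_assoc[THEN lin_comp[rotated]]

lemma assoc_pure:
  assumes "m \<in> carrier M" "n \<in> carrier N" "p \<in> carrier P"
  shows "assoc M N P ((m \<otimes>\<^bsub>M,N\<^esub> n) \<otimes>\<^bsub>M \<otimes> N,P\<^esub> p) = m \<otimes>\<^bsub>M,N \<otimes> P\<^esub> (n \<otimes>\<^bsub>N,P\<^esub> p)"
    and "assoc_inv M N P (m \<otimes>\<^bsub>M,N \<otimes> P\<^esub> (n \<otimes>\<^bsub>N,P\<^esub> p)) = (m \<otimes>\<^bsub>M,N\<^esub> n) \<otimes>\<^bsub>M \<otimes> N,P\<^esub> p"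
  unfolding assoc_def assoc_inv_def using V assms by (simp_all add: lift_pure vs)

lemma assoc_inverse:
  shows "t \<in> carrier (M \<otimes> N \<otimes> P) \<Longrightarrow> assoc_inv M N P (assoc M N P t) = t"
    and "s \<in> carrier (M \<otimes> (N \<otimes> P)) \<Longrightarrow> assoc M N P (assoc_inv M N P s) = s"
proof -
  show "assoc_inv M N P (assoc M N P t) = t" if "t \<in> carrier (M \<otimes> N \<otimes> P)"
    by (rule lin_tensor3_eqI[OF V is_vspace_tensor[of "M \<otimes> N" P] _ _ _ that])
      (simp_all add: V vs assoc_pure)
  show "assoc M N P (assoc_inv M N P s) = s" if "s \<in> carrier (M \<otimes> (N \<otimes> P))"
    by (rule lin_tensor3_eqI'[OF V is_vspace_tensor[of M "N \<otimes> P"] _ _ _ that])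
      (simp_all add: V vs assoc_pure)
qed

lemma lift_assoc:
  assumes W: "is_vspace W"
    and T: "\<And>m n. m \<in> carrier M \<Longrightarrow> n \<in> carrier N \<Longrightarrow> lin P W (\<lambda>p. T m n p)"
      "\<And>m p. m \<in> carrier M \<Longrightarrow> p \<in> carrier P \<Longrightarrow> lin N W (\<lambda>n. T m n p)"
      "\<And>n p. n \<in> carrier N \<Longrightarrow> p \<in> carrier P \<Longrightarrow> lin M W (\<lambda>m. T m n p)"
    and t: "t \<in> carrier (M \<otimes> N \<otimes> P)"
  shows "tensor_lift M (N \<otimes> P) W (\<lambda>m. tensor_lift N P W (T m)) (assoc M N P t) =
    tensor_lift (M \<otimes> N) P W (\<lambda>s p. tensor_lift M N W (\<lambda>m n. T m n p) s) t"
  by (rule lin_tensor3_eqI[OF V W _ _ _ t]) (simp_all add: V W T vs assoc_pure lift_pure)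


end

lemma assoc_natural:
  assumes V: "is_vspace M" "is_vspace N" "is_vspace P" and V': "is_vspace M'" "is_vspace N'" "is_vspace P'"
    and fgh: "lin M M' f" "lin N N' g" "lin P P' h" and t: "t \<in> carrier (M \<otimes> N \<otimes> P)"
  shows "assoc M' N' P' (tensor_map (M \<otimes> N) P (M' \<otimes> N') P' (tensor_map M N M' N' f g) h t) =
    tensor_map M (N \<otimes> P) M' (N' \<otimes> P') f (tensor_map N P N' P' g h) (assoc M N P t)"
  by (rule lin_tensor3_eqI[OF V is_vspace_tensor[of M' "N' \<otimes> P'"] _ _ _ t])
    (simp_all add: V V' fgh vs assoc_pure lin_tensor_map tensor_map_pure
      lin_mem[OF fgh(1)] lin_mem[OF fgh(2)] lin_mem[OF fgh(3)])


text \<open>The trilinear \<open>F\<close> induces a linear map \<open>?L\<close> on T \<otimes> (K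
  \<otimes> K), and applying it to both sides of coassociativity gives the equality of sums. Keeping
  T apart from K makes the rule serve the comultiplication (\<open>comult_coassoc\<close>) as well
  as coactions (\<open>coact_coassoc\<close>).\<close>

lemma coassoc_sweedler:
  assumes V: "is_vspace T" "is_vspace K" "is_vspace W"
    and \<rho>: "lin T (T \<otimes> K) \<rho>" and D: "lin K (K \<otimes> K) D" and t: "t \<in> carrier T"
    and coassoc: "assoc T K K (tensor_map T K (T \<otimes> K) K \<rho> id (\<rho> t)) = tensor_map T K T (K \<otimes> K) id D (\<rho> t)"
    and F: "\<And>m n. m \<in> carrier T \<Longrightarrow> n \<in> carrier K \<Longrightarrow> lin K W (\<lambda>p. F m n p)"
      "\<And>m p. m \<in> carrier T \<Longrightarrow> p \<in> carrier K \<Longrightarrow> lin K W (\<lambda>n. F m n p)"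
      "\<And>n p. n \<in> carrier K \<Longrightarrow> p \<in> carrier K \<Longrightarrow> lin T W (\<lambda>m. F m n p)"
  shows "tensor_lift T K W (\<lambda>t0 t1. tensor_lift T K W (\<lambda>a b. F a b t1) (\<rho> t0)) (\<rho> t) =
    tensor_lift T K W (\<lambda>t0 t1. tensor_lift K K W (\<lambda>b c. F t0 b c) (D t1)) (\<rho> t)"
proof -
  let ?L = "tensor_lift T (K \<otimes> K) W (\<lambda>m. tensor_lift K K W (F m))"
  note mem = lin_mem[OF \<rho> t]
  have l: "lin T W (\<lambda>m. tensor_lift K K W (F m) s)" if "s \<in> carrier (K \<otimes> K)" for s
    using lin_tensor_lift_body[OF V(2,2,3,1), where B = F] that F V by (simp add: vs)
  have "?L (assoc T K K (tensor_map T K (T \<otimes> K) K \<rho> id (\<rho> t))) =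
    tensor_lift (T \<otimes> K) K W (\<lambda>s p. tensor_lift T K W (\<lambda>m n. F m n p) s) (tensor_map T K (T \<otimes> K) K \<rho> id (\<rho> t))"
    using V \<rho> D mem F by (intro lift_assoc) (simp_all add: vs)
  also have "\<dots> = tensor_lift T K W (\<lambda>t0 t1. tensor_lift T K W (\<lambda>a b. F a b t1) (\<rho> t0)) (\<rho> t)"
    using V \<rho> D mem F by (subst lift_tensor_map) (simp_all add: vs)
  finally have 1: "?L (assoc T K K (tensor_map T K (T \<otimes> K) K \<rho> id (\<rho> t))) = \<dots>" .
  have "?L (tensor_map T K T (K \<otimes> K) id D (\<rho> t)) =
    tensor_lift T K W (\<lambda>t0 t1. tensor_lift K K W (\<lambda>b c. F t0 b c) (D t1)) (\<rho> t)"
    using V \<rho> D mem F by (subst lift_tensor_map) (simp_all add: vs l)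
  then show ?thesis
    using 1 coassoc by simp
qed

section \<open>Coassociative coactions\<close>

text \<open>Puts a coaction on any vector space record and forgets further fields. The vector space
  notions read only the four vector space fields, so the simp rules that follow erase
  \<open>with_coact\<close> from them, and facts about the bare space carry over.\<close>

definition with_coact ::
    "('k::field, 'm, 'z) vspace_scheme \<Rightarrow> ('m \<Rightarrow> ('k, 'm, 'h) tensor) \<Rightarrow> ('k, 'h, 'm) comod" where
  "with_coact V \<rho> = \<lparr>carrier = carrier V, add = add V, zero = zero V, scale = scale V, coact = \<rho>\<rparr>"

lemma extend_eq_with_coact: "vspace.extend S (comod.fields \<rho>) = with_coact S \<rho>"
  by (simp add: with_coact_def vspace.defs comod.defs)

lemma with_coact_sel [simp]:
  "carrier (with_coact V \<rho>) = carrier V" "add (with_coact V \<rho>) = add V"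
  "zero (with_coact V \<rho>) = zero V" "scale (with_coact V \<rho>) = scale V"
  "coact (with_coact V \<rho>) = \<rho>"
  by (simp_all add: with_coact_def)

lemma with_coact_vspace [simp]:
  "is_vspace (with_coact V \<rho>) = is_vspace V"
  "linear_maps (with_coact V \<rho>) W = linear_maps V W" "linear_maps U (with_coact V \<rho>) = linear_maps U V"
  "lin (with_coact V \<rho>) W = lin V W" "lin U (with_coact V \<rho>) = lin U V"
  "restrict_vspace (with_coact V \<rho>) X = restrict_vspace V X"
  by (simp_all add: is_vspace_def linear_maps_def lin_def[abs_def] restrict_vspace_def)

lemma with_coact_tensor [simp]:
  "tensor_class (with_coact V \<rho>) N = tensor_class V N" "tensor_class M (with_coact V \<rho>) = tensor_class M V"
  "with_coact V \<rho> \<otimes> N = V \<otimes> N" "M \<otimes> with_coact V \<rho> = M \<otimes> V"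
  "tensor_elt m (with_coact V \<rho>) N = tensor_elt m V N"
  "tensor_elt n M (with_coact V \<rho>) = tensor_elt n M V"
  by (simp_all add: tensor_class_def[abs_def] tensor_relations_def tensor_space_def tensor_elt_def[abs_def])

lemma with_coact_lift [simp]:
  "tensor_lift (with_coact V \<rho>) N W = tensor_lift V N W" "tensor_lift M (with_coact V \<rho>) W = tensor_lift M V W"
  "tensor_lift M N (with_coact V \<rho>) = tensor_lift M N V"
  by (simp_all add: tensor_lift_def[abs_def])

lemma with_coact_map [simp]:
  "tensor_map (with_coact V \<rho>) N M' N' = tensor_map V N M' N'"
  "tensor_map M (with_coact V \<rho>) M' N' = tensor_map M V M' N'"
  "tensor_map M N (with_coact V \<rho>) N' = tensor_map M N V N'"
  "tensor_map M N M' (with_coact V \<rho>) = tensor_map M N M' V"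
  by (simp_all add: tensor_map_def[abs_def])

lemma with_coact_assoc [simp]:
  "assoc (with_coact V \<rho>) N P = assoc V N P" "assoc M (with_coact V \<rho>) P = assoc M V P"
  "assoc M N (with_coact V \<rho>) = assoc M N V"
  "assoc_inv (with_coact V \<rho>) N P = assoc_inv V N P" "assoc_inv M (with_coact V \<rho>) P = assoc_inv M V P"
  "assoc_inv M N (with_coact V \<rho>) = assoc_inv M N V"
  by (simp_all add: assoc_def[abs_def] assoc_inv_def[abs_def])

text \<open>The tensor product of two comodules, with the diagonal coaction, is coassociative but not
  counital.  The map \<open>(id \<otimes> \<epsilon>) \<circ> \<rho>\<close> of such a precomodule is idempotent and leaves \<open>\<rho>\<close> unchanged; its
  fixed points form a comodule, and the product in the category of comodules arises in this way.\<close>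

definition precomodule :: "('k::field, 'h) bialg \<Rightarrow> ('k, 'h, 'm) comod \<Rightarrow> bool" where
  "precomodule H T \<longleftrightarrow>
    is_vspace T \<and>
    coact T \<in> linear_maps T (T \<otimes> H) \<and>
    (\<forall>t\<in>carrier T.
      assoc T H H (tensor_map T H (T \<otimes> H) H (coact T) id (coact T t)) =
        tensor_map T H T (H \<otimes> H) id (comult H) (coact T t))"

definition counit_proj :: "('k::field, 'h) bialg \<Rightarrow> ('k, 'h, 'm) comod \<Rightarrow> 'm \<Rightarrow> 'm" where
  "counit_proj H T t = tensor_lift T H T (\<lambda>t0 t1. scale T (counit H t1) t0) (coact T t)"

lemma comodule_iff:
  "comodule H M \<longleftrightarrow> precomodule H M \<and> (\<forall>m\<in>carrier M. counit_proj H M m = m)"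
  by (auto simp: comodule_def precomodule_def counit_proj_def)

section \<open>Sweedler rules for a weak bialgebra and its coactions\<close>

locale weak_bialg =
  fixes H :: "('k::field, 'h) bialg"
  assumes weak_bialgebra: "weak_bialgebra H"
begin

lemma algebra_H: "algebra H (mult H) (one H)"
  and coalgebra_H: "coalgebra H (comult H) (counit H)"
  using weak_bialgebra by (simp_all add: weak_bialgebra_def)

lemma is_vspace_H [vs]: "is_vspace H"
  using algebra_H by (simp add: algebra_def)

lemma mult_closed [vs]: "a \<in> carrier H \<Longrightarrow> b \<in> carrier H \<Longrightarrow> mult H a b \<in> carrier H"
  and one_mem [vs]: "one H \<in> carrier H"
  using algebra_H by (auto simp: algebra_def linear_maps_iff lin_def)

lemma mult_laws:
  shows "a \<in> carrier H \<Longrightarrow> b \<in> carrier H \<Longrightarrow> c \<in> carrier H \<Longrightarrow>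
      mult H (mult H a b) c = mult H a (mult H b c)"
    and "a \<in> carrier H \<Longrightarrow> mult H (one H) a = a" "a \<in> carrier H \<Longrightarrow> mult H a (one H) = a"
  using algebra_H by (auto simp: algebra_def)

lemma lin_mult [vs]:
  assumes "b \<in> carrier H" "is_vspace V" "lin V H g"
  shows "lin V H (\<lambda>x. mult H (g x) b)" "lin V H (\<lambda>x. mult H b (g x))"
proof -
  have "lin H H (\<lambda>x\<in>carrier H. mult H x b)" "lin H H (mult H b)"
    using assms algebra_H by (auto simp: algebra_def linear_maps_iff)
  then have "lin H H (\<lambda>x. mult H x b)" "lin H H (mult H b)"
    using lin_cong[of H "\<lambda>x\<in>carrier H. mult H x b" "\<lambda>x. mult H x b"] is_vspace_H by auto
  then show "lin V H (\<lambda>x. mult H (g x) b)" "lin V H (\<lambda>x. mult H b (g x))"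
    using assms(3) lin_comp by blast+
qed

lemma comult_linear_maps: "comult H \<in> linear_maps H (H \<otimes> H)"
  and counit_linear_maps: "counit H \<in> linear_maps H ground"
  using coalgebra_H by (simp_all add: coalgebra_def)

lemmas lin_comult [vs] = linear_mapsD[OF comult_linear_maps]
lemmas lin_counit [vs] = linear_mapsD[OF counit_linear_maps]
lemmas comult_mem [vs] = lin_comult[THEN lin_mem]
lemmas lin_counit_arg [vs] = lin_counit[THEN lin_comp[rotated]]

lemma push_H [push]:
  assumes "is_vspace M" "is_vspace N" "bilin M N H B" "t \<in> carrier (M \<otimes> N)"
  shows "b \<in> carrier H \<Longrightarrow> mult H (tensor_lift M N H B t) b = tensor_lift M N H (\<lambda>m n. mult H (B m n) b) t"
    and "b \<in> carrier H \<Longrightarrow> mult H b (tensor_lift M N H B t) = tensor_lift M N H (\<lambda>m n. mult H b (B m n)) t"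
    and "counit H (tensor_lift M N H B t) = tensor_lift M N ground (\<lambda>m n. counit H (B m n)) t"
    and "comult H (tensor_lift M N H B t) = tensor_lift M N (H \<otimes> H) (\<lambda>m n. comult H (B m n)) t"
  using assms
  by (intro lift_push[of M N H H B "\<lambda>x. mult H x b"] lift_push[of M N H H B "mult H b"]
      lift_push[of M N H ground B "counit H"] lift_push[of M N H "H \<otimes> H" B "comult H"]; simp add: vs)+

lemma comult_coassoc:
  assumes "is_vspace W" "h \<in> carrier H"
    and "\<And>m n. m \<in> carrier H \<Longrightarrow> n \<in> carrier H \<Longrightarrow> lin H W (\<lambda>p. F m n p)"
      "\<And>m p. m \<in> carrier H \<Longrightarrow> p \<in> carrier H \<Longrightarrow> lin H W (\<lambda>n. F m n p)"
      "\<And>n p. n \<in> carrier H \<Longrightarrow> p \<in> carrier H \<Longrightarrow> lin H W (\<lambda>m. F m n p)"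
  shows "tensor_lift H H W (\<lambda>h1 h2. tensor_lift H H W (\<lambda>a b. F a b h2) (comult H h1)) (comult H h) =
    tensor_lift H H W (\<lambda>h1 h2. tensor_lift H H W (\<lambda>b c. F h1 b c) (comult H h2)) (comult H h)"
  using assms coalgebra_H by (intro coassoc_sweedler) (simp_all add: vs coalgebra_def)

text \<open>The linear map \<open>f\<close> lets the counit laws act inside a sum with values in any
  space.\<close>

lemma comult_counit:
  assumes "is_vspace W" "h \<in> carrier H" "lin H W f"
  shows "tensor_lift H H W (\<lambda>a b. scale W (counit H a) (f b)) (comult H h) = f h"
    and "tensor_lift H H W (\<lambda>a b. scale W (counit H b) (f a)) (comult H h) = f h"
proof -
  have *: "tensor_lift H H H (\<lambda>a b. scale H (counit H a) b) (comult H h) = h"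
    "tensor_lift H H H (\<lambda>a b. scale H (counit H b) a) (comult H h) = h"
    using coalgebra_H assms by (simp_all add: coalgebra_def)
  have f: "f (scale H c b) = scale W c (f b)" if "b \<in> carrier H" for b c
    using assms(3) that by (simp add: lin_def)
  note lift_push[of H H H W _ f "comult H h"]
  from this[of "\<lambda>a b. scale H (counit H a) b"] this[of "\<lambda>a b. scale H (counit H b) a"]
  show "tensor_lift H H W (\<lambda>a b. scale W (counit H a) (f b)) (comult H h) = f h"
    "tensor_lift H H W (\<lambda>a b. scale W (counit H b) (f a)) (comult H h) = f h"
    using assms by (simp_all add: vs * f)
qed

lemma comult_mult:
  assumes "is_vspace W" "bilin H H W B" "a \<in> carrier H" "b \<in> carrier H"
  shows "tensor_lift H H W B (comult H (mult H a b)) =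
    tensor_lift H H W (\<lambda>a1 a2. tensor_lift H H W (\<lambda>b1 b2. B (mult H a1 b1) (mult H a2 b2)) (comult H b)) (comult H a)"
proof -
  have "comult H (mult H a b) = tensor_lift H H (H \<otimes> H) (\<lambda>a1 a2.
      tensor_lift H H (H \<otimes> H) (\<lambda>b1 b2. mult H a1 b1 \<otimes>\<^bsub>H,H\<^esub> mult H a2 b2) (comult H b)) (comult H a)"
    using weak_bialgebra assms by (simp add: weak_bialgebra_def tensor_mult_def)
  then show ?thesis
    using assms by (simp add: push vs lift_pure)
qed

lemma counit_mult3:
  assumes "a \<in> carrier H" "b \<in> carrier H" "c \<in> carrier H"
  shows "tensor_lift H H ground (\<lambda>b1 b2. counit H (mult H a b1) * counit H (mult H b2 c)) (comult H b) =
      counit H (mult H a (mult H b c))"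
    and "tensor_lift H H ground (\<lambda>b1 b2. counit H (mult H a b2) * counit H (mult H b1 c)) (comult H b) =
      counit H (mult H a (mult H b c))"
proof -
  have "\<forall>a\<in>carrier H. \<forall>b\<in>carrier H. \<forall>c\<in>carrier H.
      counit H (mult H (mult H a b) c) =
        tensor_lift H H ground (\<lambda>b1 b2. counit H (mult H a b1) * counit H (mult H b2 c)) (comult H b) \<and>
      counit H (mult H (mult H a b) c) =
        tensor_lift H H ground (\<lambda>b1 b2. counit H (mult H a b2) * counit H (mult H b1 c)) (comult H b)"
    using weak_bialgebra unfolding weak_bialgebra_def by blast
  then show "tensor_lift H H ground (\<lambda>b1 b2. counit H (mult H a b1) * counit H (mult H b2 c)) (comult H b) =
      counit H (mult H a (mult H b c))"
    "tensor_lift H H ground (\<lambda>b1 b2. counit H (mult H a b2) * counit H (mult H b1 c)) (comult H b) =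
      counit H (mult H a (mult H b c))"
    using assms mult_laws(1)[OF assms] by metis+
qed

lemma precomodule_vspace [vs]: "precomodule H T \<Longrightarrow> is_vspace T"
  by (simp add: precomodule_def)

lemma coact_linear_maps: "precomodule H T \<Longrightarrow> coact T \<in> linear_maps T (T \<otimes> H)"
  by (simp add: precomodule_def)

lemmas lin_coact [vs] = coact_linear_maps[THEN linear_mapsD]
lemmas coact_mem [vs] = lin_coact[THEN lin_mem]
lemmas lin_coact_arg [vs] = lin_coact[THEN lin_comp[rotated]]

lemma push_coact [push]:
  assumes "precomodule H T" "is_vspace M" "is_vspace N" "bilin M N T B" "t \<in> carrier (M \<otimes> N)"
  shows "coact T (tensor_lift M N T B t) = tensor_lift M N (T \<otimes> H) (\<lambda>m n. coact T (B m n)) t"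
  using assms by (intro lift_push) (simp_all add: vs)

lemma coact_coassoc:
  assumes "precomodule H T" "is_vspace W" "t \<in> carrier T"
    and "\<And>m n. m \<in> carrier T \<Longrightarrow> n \<in> carrier H \<Longrightarrow> lin H W (\<lambda>p. F m n p)"
      "\<And>m p. m \<in> carrier T \<Longrightarrow> p \<in> carrier H \<Longrightarrow> lin H W (\<lambda>n. F m n p)"
      "\<And>n p. n \<in> carrier H \<Longrightarrow> p \<in> carrier H \<Longrightarrow> lin T W (\<lambda>m. F m n p)"
  shows "tensor_lift T H W (\<lambda>t0 t1. tensor_lift T H W (\<lambda>a b. F a b t1) (coact T t0)) (coact T t) =
    tensor_lift T H W (\<lambda>t0 t1. tensor_lift H H W (\<lambda>b c. F t0 b c) (comult H t1)) (coact T t)"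
  using assms by (intro coassoc_sweedler) (simp_all add: vs precomodule_def)

lemma lin_scale_arg: "lin V W f \<Longrightarrow> x \<in> carrier V \<Longrightarrow> f (scale V c x) = scale W c (f x)"
  by (simp add: lin_def)

lemma lin_counit_proj [vs]:
  "precomodule H T \<Longrightarrow> lin V T g \<Longrightarrow> lin V T (\<lambda>x. counit_proj H T (g x))"
  unfolding counit_proj_def by (simp add: vs)

lemma counit_proj_mem [vs]: "precomodule H T \<Longrightarrow> t \<in> carrier T \<Longrightarrow> counit_proj H T t \<in> carrier T"
  unfolding counit_proj_def by (simp add: vs)

text \<open>Coassociativity rewrites the coaction of \<open>t\<^sub>0 \<epsilon>(t\<^sub>1)\<close>
  as \<open>t\<^sub>0 \<otimes> t\<^sub>1 \<epsilon>(t\<^sub>2)\<close>, where the counit now meets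
  a comultiplication of H and cancels.\<close>

lemma coact_counit_proj:
  assumes T: "precomodule H T" and t: "t \<in> carrier T"
  shows "coact T (counit_proj H T t) = coact T t"
proof -
  have "coact T (counit_proj H T t) =
      tensor_lift T H (T \<otimes> H) (\<lambda>t0 t1. scale (T \<otimes> H) (counit H t1) (coact T t0)) (coact T t)"
    using T t by (simp add: counit_proj_def push vs lin_scale_arg[OF lin_coact])
  also have "\<dots> = tensor_lift T H (T \<otimes> H) (\<lambda>t0 t1. tensor_lift T H (T \<otimes> H)
      (\<lambda>a b. scale (T \<otimes> H) (counit H t1) (a \<otimes>\<^bsub>T,H\<^esub> b)) (coact T t0)) (coact T t)"
    using T t by (simp add: vs lift_tensor_elt push_scale[symmetric])
  also have "\<dots> = tensor_lift T H (T \<otimes> H) (\<lambda>t0 t1. tensor_lift H H (T \<otimes> H)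
      (\<lambda>b c. scale (T \<otimes> H) (counit H c) (t0 \<otimes>\<^bsub>T,H\<^esub> b)) (comult H t1)) (coact T t)"
    using T t by (intro coact_coassoc) (simp_all add: vs)
  also have "\<dots> = coact T t"
    using T t by (simp add: vs comult_counit lift_tensor_elt)
  finally show ?thesis .
qed

text \<open>The projection is computed from the coaction alone, and the coaction of t agrees with
  that of its projection.\<close>

lemma counit_proj_idem:
  "precomodule H T \<Longrightarrow> t \<in> carrier T \<Longrightarrow> counit_proj H T (counit_proj H T t) = counit_proj H T t"
  using coact_counit_proj[of T t] by (simp add: counit_proj_def)

text \<open>Companion of \<open>coact_counit_proj\<close> on the first leg: coassociativity produces
  \<open>t\<^sub>0 \<otimes> \<epsilon>(t\<^sub>1) t\<^sub>2\<close>, and this time the left counit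
  law of H applies.\<close>

lemma lift_coact_counit_proj:
  assumes T: "precomodule H T" and W: "is_vspace W" and t: "t \<in> carrier T" and B: "bilin T H W B"
  shows "tensor_lift T H W (\<lambda>t0 t1. B (counit_proj H T t0) t1) (coact T t) = tensor_lift T H W B (coact T t)"
proof -
  have l: "b \<in> carrier H \<Longrightarrow> lin T W (\<lambda>a. B a b)" "a \<in> carrier T \<Longrightarrow> lin H W (\<lambda>b. B a b)" for a b
    using B by (simp_all add: bilin_def)
  have "tensor_lift T H W (\<lambda>t0 t1. B (counit_proj H T t0) t1) (coact T t) =
    tensor_lift T H W (\<lambda>t0 t1. tensor_lift T H W (\<lambda>a b. scale W (counit H b) (B a t1)) (coact T t0)) (coact T t)"
    unfolding counit_proj_def
    using T W t by (simp add: vs l lift_push[where f = "\<lambda>a. B a _"] lin_scale_arg[OF l(1)])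
  also have "\<dots> = tensor_lift T H W (\<lambda>t0 t1. tensor_lift H H W
      (\<lambda>b c. scale W (counit H b) (B t0 c)) (comult H t1)) (coact T t)"
    using T W t by (intro coact_coassoc) (simp_all add: vs l lin_mem[OF l(1)])
  also have "\<dots> = tensor_lift T H W B (coact T t)"
    using T W t by (simp add: vs comult_counit l)
  finally show ?thesis .
qed

lemma map_coact_counit_proj:
  assumes T: "precomodule H T" and t: "t \<in> carrier T"
  shows "tensor_map T H T H (counit_proj H T) id (coact T t) = coact T t"
  unfolding tensor_map_def
  using lift_coact_counit_proj[OF T is_vspace_tensor[of T H] t, where B = "\<lambda>m n. m \<otimes>\<^bsub>T,H\<^esub> n"] T t
  by (simp add: vs lift_tensor_elt)

end

lemma restrict_vspace_sel [simp]:
  "carrier (restrict_vspace V S) = S" "zero (restrict_vspace V S) = zero V"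
  "x \<in> S \<Longrightarrow> y \<in> S \<Longrightarrow> add (restrict_vspace V S) x y = add V x y"
  "x \<in> S \<Longrightarrow> scale (restrict_vspace V S) c x = scale V c x"
  by (simp_all add: restrict_vspace_def)

lemma is_vspace_fixed_points:
  assumes V: "is_vspace V" and r: "lin V V r"
  shows "is_vspace (restrict_vspace V {x \<in> carrier V. r x = x})"
proof -
  let ?S = "restrict_vspace V {x \<in> carrier V. r x = x}"
  have rz: "r (zero V) = zero V"
    using lin_zero[OF V V r] .
  have neg: "\<exists>y\<in>carrier ?S. add ?S x y = zero ?S" if x: "x \<in> carrier ?S" for x
  proof -
    have x: "x \<in> carrier V" "r x = x" using x by auto
    obtain y where y: "y \<in> carrier V" "add V x y = zero V"
      using vspace_neg[OF V x(1)] .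
    \<comment> \<open>Applying r to the sum of x and y shows that \<open>r y\<close> is a further
      inverse of x, so it equals y.\<close>
    have *: "add V x (r y) = zero V"
      using r x y rz unfolding lin_def by metis
    then have "r y = y"
      using y x vspace_laws(1,2,3)[OF V] lin_mem[OF r y(1)] by metis
    then show ?thesis
      using x y by (intro bexI[of _ y]) simp_all
  qed
  show ?thesis
    unfolding is_vspace_def PiE_def
    using r rz
    by (intro conjI allI ballI IntI Pi_I neg)
      (simp_all add: vspace_closed[OF V] vspace_laws(1,3-7)[OF V] lin_def,
        auto simp: restrict_vspace_def intro: vspace_laws(2)[OF V])
qed

lemma lin_into_restrict:
  assumes "lin U V f" "\<And>x. x \<in> carrier U \<Longrightarrow> f x \<in> S"
  shows "lin U (restrict_vspace V S) f"
  using assms by (simp add: lin_def)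

lemma lin_from_restrict:
  assumes "lin V W f" "S \<subseteq> carrier V"
  shows "lin (restrict_vspace V S) W f"
  using assms by (simp add: lin_def subset_iff)

text \<open>Stands to \<open>comodule_homs\<close> as \<open>lin\<close> stands to
  \<open>linear_maps\<close>.\<close>

definition colinear ::
    "('k::field, 'h) bialg \<Rightarrow> ('k, 'h, 'm) comod \<Rightarrow> ('k, 'h, 'n) comod \<Rightarrow> ('m \<Rightarrow> 'n) \<Rightarrow> bool" where
  "colinear H M N f \<longleftrightarrow> lin M N f \<and> (\<forall>m\<in>carrier M. coact N (f m) = tensor_map M H N H f id (coact M m))"

lemma comodule_homs_iff: "f \<in> comodule_homs H M N \<longleftrightarrow> colinear H M N f \<and> f \<in> extensional (carrier M)"
  by (auto simp: comodule_homs_def colinear_def linear_maps_iff)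

lemma colinear_lin: "colinear H M N f \<Longrightarrow> lin M N f"
  by (simp add: colinear_def)

lemma colinear_coact: "colinear H M N f \<Longrightarrow> m \<in> carrier M \<Longrightarrow> coact N (f m) = tensor_map M H N H f id (coact M m)"
  by (simp add: colinear_def)

definition fixed_comodule ::
    "('k::field, 'h) bialg \<Rightarrow> ('k, 'h, 'm) comod \<Rightarrow> ('m \<Rightarrow> 'm) \<Rightarrow> ('k, 'h, 'm) comod" where
  "fixed_comodule H T r =
    (let S = restrict_vspace T {x \<in> carrier T. r x = x} in with_coact S (corestrict_coact H S T (coact T)))"

text \<open>Compatibility of r with the coaction is asked on the fixed points of r, since only these
  are to receive a coaction. For \<open>eps_s\<close> on H it can fail elsewhere: over a bialgebra
  \<open>eps_s H x\<close> is \<epsilon>(x) 1, and the left side becomes 1 \<otimes> t.\<close>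

definition coaction_projection ::
    "('k::field, 'h) bialg \<Rightarrow> ('k, 'h, 'm) comod \<Rightarrow> ('m \<Rightarrow> 'm) \<Rightarrow> bool" where
  "coaction_projection H T r \<longleftrightarrow> precomodule H T \<and> lin T T r \<and>
    (\<forall>t\<in>carrier T. r (r t) = r t \<and>
      (r t = t \<longrightarrow> tensor_map T H T H r id (coact T t) = coact T t))"

context weak_bialg
begin

abbreviation cosum where "cosum T W t B \<equiv> tensor_lift T H W B (coact T t)"
abbreviation hsum where "hsum W h B \<equiv> tensor_lift H H W B (comult H h)"

lemma colinear_comp:
  assumes "precomodule H M" "precomodule H N" "precomodule H P" "colinear H M N f" "colinear H N P g"
  shows "colinear H M P (\<lambda>x. g (f x))"
  unfolding colinear_def
proof (intro conjI ballI)
  show "lin M P (\<lambda>x. g (f x))"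
    using assms by (blast intro: lin_comp colinear_lin)
  fix m assume m: "m \<in> carrier M"
  have "coact P (g (f m)) = tensor_map N H P H g id (tensor_map M H N H f id (coact M m))"
    using assms m by (simp add: colinear_coact lin_mem[OF colinear_lin])
  also have "\<dots> = tensor_map M H P H (\<lambda>x. g (f x)) (\<lambda>x. id (id x)) (coact M m)"
    using assms m by (intro tensor_map_comp) (simp_all add: colinear_lin vs)
  finally show "coact P (g (f m)) = tensor_map M H P H (\<lambda>x. g (f x)) id (coact M m)"
    by (simp add: id_def)
qed

lemma colinear_cong:
  assumes "precomodule H M" "colinear H M N f" "\<And>x. x \<in> carrier M \<Longrightarrow> f x = g x"
  shows "colinear H M N g"
  using assms lin_cong[of M f g N] tensor_map_cong[of M f g H id id N H]
  unfolding colinear_def by (simp add: vs)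

lemma colinear_counit_proj: "precomodule H T \<Longrightarrow> colinear H T T (counit_proj H T)"
  unfolding colinear_def by (simp add: vs coact_counit_proj map_coact_counit_proj)

lemma lift_coact_colinear:
  assumes "precomodule H M" "precomodule H N" "is_vspace W" "bilin N H W B" "colinear H M N f" "m \<in> carrier M"
  shows "cosum N W (f m) B = cosum M W m (\<lambda>m0 m1. B (f m0) m1)"
  using assms by (simp add: colinear_coact lift_tensor_map colinear_lin vs)

text \<open>(id \<otimes> \<epsilon>) \<circ> \<rho> is natural for maps that intertwine coactions.
  Through this lemma fixed tensors remain fixed under tensor products of colinear maps and under the
  associator.\<close>

lemma colinear_counit_proj_commute:
  assumes M: "precomodule H M" and N: "precomodule H N" and f: "colinear H M N f" and m: "m \<in> carrier M"
  shows "f (counit_proj H M m) = counit_proj H N (f m)"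
proof -
  note l = colinear_lin[OF f]
  have "f (counit_proj H M m) = cosum M N m (\<lambda>m0 m1. f (scale M (counit H m1) m0))"
    unfolding counit_proj_def using M N m l by (intro lift_push) (simp_all add: vs)
  also have "\<dots> = cosum M N m (\<lambda>m0 m1. scale N (counit H m1) (f m0))"
    by (simp add: lin_scale_arg[OF l])
  also have "\<dots> = counit_proj H N (f m)"
    unfolding counit_proj_def using M N m f by (simp add: lift_coact_colinear vs)
  finally show ?thesis .
qed

text \<open>Gives colinearity of \<open>assoc_inv\<close> from that of \<open>assoc\<close>, without
  a second Sweedler computation.\<close>

lemma colinear_inverse:
  assumes M: "precomodule H M" and N: "precomodule H N" and f: "colinear H M N f" and g: "lin N M g"
    and gf: "\<And>m. m \<in> carrier M \<Longrightarrow> g (f m) = m" and fg: "\<And>n. n \<in> carrier N \<Longrightarrow> f (g n) = n"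
  shows "colinear H N M g"
  unfolding colinear_def
proof (intro conjI ballI g)
  fix n assume n: "n \<in> carrier N"
  note l = colinear_lin[OF f]
  have "coact N n = tensor_map M H N H f id (coact M (g n))"
    using colinear_coact[OF f lin_mem[OF g n]] fg[OF n] by simp
  then have "tensor_map N H M H g id (coact N n) = tensor_map M H M H (\<lambda>x. g (f x)) (\<lambda>x. id (id x)) (coact M (g n))"
    using M N l g n lin_mem[OF g n] by (simp add: tensor_map_comp vs)
  also have "\<dots> = coact M (g n)"
    using M lin_mem[OF g n] gf by (intro tensor_map_ident) (simp_all add: vs)
  finally show "coact M (g n) = tensor_map N H M H g id (coact N n)" ..
qed

section \<open>The comodule of fixed points of a projection\<close>

context
  fixes T :: "('k, 'h, 'm) comod" and r
  assumes proj: "coaction_projection H T r"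
begin

abbreviation (input) "fixed_part \<equiv> fixed_comodule H T r"
abbreviation (input) "fixed_space \<equiv> restrict_vspace T {x \<in> carrier T. r x = x}"

private lemma T: "precomodule H T" and r: "lin T T r"
    and idem: "t \<in> carrier T \<Longrightarrow> r (r t) = r t"
    and coact_r: "t \<in> carrier T \<Longrightarrow> r t = t \<Longrightarrow> tensor_map T H T H r id (coact T t) = coact T t"
  using proj by (simp_all add: coaction_projection_def)

lemma fixed_part_eq: "fixed_part = with_coact fixed_space (corestrict_coact H fixed_space T (coact T))"
  by (simp add: fixed_comodule_def Let_def)

lemma is_vspace_fixed_space: "is_vspace fixed_space"
  by (rule is_vspace_fixed_points) (simp_all add: T r vs)

lemma carrier_fixed: "carrier fixed_part = {x \<in> carrier T. r x = x}"
  by (simp add: fixed_part_eq)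

lemma is_vspace_fixed: "is_vspace fixed_part"
  by (simp add: fixed_part_eq is_vspace_fixed_space)

lemma lin_fixed: "lin fixed_part T id" "lin T fixed_part r" "lin fixed_part T (\<lambda>x. x)"
  unfolding fixed_part_eq with_coact_vspace
  using r by (auto intro!: lin_into_restrict lin_from_restrict simp: idem vs lin_mem)

lemma lin_into_fixed: "lin V T f \<Longrightarrow> (\<And>x. x \<in> carrier V \<Longrightarrow> r (f x) = f x) \<Longrightarrow> lin V fixed_part f"
  unfolding fixed_part_eq with_coact_vspace by (intro lin_into_restrict) (auto simp: lin_mem)

text \<open>Since r fixes the subspace pointwise, r \<otimes> id splits the injection of tensor
  products. This yields injectivity, and with it control over \<open>inv_into\<close>.\<close>

lemma retract_inclusion:
  assumes "is_vspace K" "t \<in> carrier (fixed_part \<otimes> K)"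
  shows "tensor_map T K fixed_part K r id (tensor_map fixed_part K T K id id t) = t"
proof -
  have "tensor_map T K fixed_part K r id (tensor_map fixed_part K T K id id t) = tensor_map fixed_part K fixed_part K (\<lambda>x. r (id x)) (\<lambda>x. id (id x)) t"
    using assms lin_fixed is_vspace_fixed T by (intro tensor_map_comp) (simp_all add: vs)
  also have "\<dots> = t"
    using assms is_vspace_fixed by (intro tensor_map_ident) (simp_all add: carrier_fixed)
  finally show ?thesis .
qed

lemma inclusion_retract:
  assumes "is_vspace K" "t \<in> carrier (T \<otimes> K)"
  shows "tensor_map fixed_part K T K id id (tensor_map T K fixed_part K r id t) = tensor_map T K T K r id t"
  using assms lin_fixed is_vspace_fixed T
  by (subst tensor_map_comp) (simp_all add: vs id_def)

lemma coact_fixed: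
  assumes t: "t \<in> carrier fixed_part"
  shows "tensor_map fixed_part H T H id id (coact fixed_part t) = coact T t"
    and "coact fixed_part t = tensor_map T H fixed_part H r id (coact T t)"
proof -
  have t': "t \<in> carrier T" "r t = t" using t by (auto simp: carrier_fixed)
  \<comment> \<open>A preimage under the injection: r \<otimes> id applied to the coaction of t. The
    injection returns it to the coaction because t is a fixed point. Once some preimage exists, the
    chosen one is recovered from its image by the same retraction.\<close>
  have "coact T t = tensor_map fixed_part H T H id id (tensor_map T H fixed_part H r id (coact T t))"
    using t' T coact_r by (simp add: inclusion_retract vs)
  moreover have "tensor_map T H fixed_part H r id (coact T t) \<in> carrier (fixed_part \<otimes> H)"
    using t' T lin_fixed is_vspace_fixed by (simp add: vs)
  ultimately have "coact T t \<in> tensor_map fixed_part H T H id id ` carrier (fixed_part \<otimes> H)"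
    by (rule image_eqI)
  note * = this[unfolded fixed_part_eq with_coact_tensor with_coact_map]
  have "coact fixed_part t = inv_into (carrier (fixed_space \<otimes> H)) (tensor_map fixed_space H T H id id) (coact T t)"
    using t' by (simp add: fixed_part_eq corestrict_coact_def)
  then have "coact fixed_part t \<in> carrier (fixed_part \<otimes> H)" "tensor_map fixed_part H T H id id (coact fixed_part t) = coact T t"
    unfolding fixed_part_eq with_coact_tensor with_coact_map
    using inv_into_into[OF *] f_inv_into_f[OF *] by simp_all
  then show 1: "tensor_map fixed_part H T H id id (coact fixed_part t) = coact T t"
    and "coact fixed_part t = tensor_map T H fixed_part H r id (coact T t)"
    using retract_inclusion[of H "coact fixed_part t"] by (simp_all add: vs)
qed

lemma lin_coact_fixed: "lin fixed_part (fixed_part \<otimes> H) (coact fixed_part)"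
  by (subst lin_cong[of _ _ "\<lambda>t. tensor_map T H fixed_part H r id (coact T t)"])
    (simp_all add: coact_fixed(2) T vs is_vspace_fixed lin_fixed)

text \<open>Both sides of coassociativity are sent into T \<otimes> (H \<otimes> H), where they
  become the two sides of coassociativity of T; the split injection reflects the equality.\<close>

lemma precomodule_fixed: "precomodule H fixed_part"
proof -
  have "coact fixed_part \<in> linear_maps fixed_part (fixed_part \<otimes> H)"
    unfolding linear_maps_iff using lin_coact_fixed by (simp add: fixed_part_eq corestrict_coact_def)
  moreover have "assoc fixed_part H H (tensor_map fixed_part H (fixed_part \<otimes> H) H (coact fixed_part) id (coact fixed_part t)) =
        tensor_map fixed_part H fixed_part (H \<otimes> H) id (comult H) (coact fixed_part t)" (is "?l = ?r") if t: "t \<in> carrier fixed_part" for t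
  proof -
    note [simp] = T is_vspace_fixed lin_fixed lin_coact_fixed lin_mem[OF lin_coact_fixed t] vs lin_tensor_map
    have t': "t \<in> carrier T" using t by (auto simp: carrier_fixed)
    have "tensor_map fixed_part (H \<otimes> H) T (H \<otimes> H) id (tensor_map H H H H id id) ?l =
      assoc T H H (tensor_map (fixed_part \<otimes> H) H (T \<otimes> H) H (tensor_map fixed_part H T H id id) id
        (tensor_map fixed_part H (fixed_part \<otimes> H) H (coact fixed_part) id (coact fixed_part t)))"
      by (rule assoc_natural[symmetric]) simp_all
    also have "tensor_map (fixed_part \<otimes> H) H (T \<otimes> H) H (tensor_map fixed_part H T H id id) id
        (tensor_map fixed_part H (fixed_part \<otimes> H) H (coact fixed_part) id (coact fixed_part t)) =
        tensor_map fixed_part H (T \<otimes> H) H (\<lambda>x. coact T (id x)) (\<lambda>x. id (id x)) (coact fixed_part t)"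
      by (subst tensor_map_comp, simp_all, rule tensor_map_cong, unfold coact_fixed(1), simp_all)
    also have "\<dots> = tensor_map T H (T \<otimes> H) H (coact T) id (tensor_map fixed_part H T H id id (coact fixed_part t))"
      by (rule tensor_map_comp[symmetric]) simp_all
    also have "assoc T H H \<dots> = tensor_map T H T (H \<otimes> H) id (comult H) (tensor_map fixed_part H T H id id (coact fixed_part t))"
      using T t t' by (simp add: coact_fixed(1) precomodule_def)
    also have "\<dots> = tensor_map fixed_part H T (H \<otimes> H) (\<lambda>x. id (id x)) (\<lambda>x. comult H (id x)) (coact fixed_part t)"
      by (rule tensor_map_comp) simp_all
    also have "\<dots> = tensor_map fixed_part H T (H \<otimes> H) (\<lambda>x. id (id x)) (\<lambda>x. id (comult H x)) (coact fixed_part t)"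
      by simp
    also have "\<dots> = tensor_map fixed_part (H \<otimes> H) T (H \<otimes> H) id id ?r"
      by (rule tensor_map_comp[symmetric]) simp_all
    finally have "tensor_map fixed_part (H \<otimes> H) T (H \<otimes> H) id (tensor_map H H H H id id) ?l =
      tensor_map fixed_part (H \<otimes> H) T (H \<otimes> H) id id ?r" .
    \<comment> \<open>\<open>assoc_natural\<close> produces the tensor product of two identities,
      which has to be recognised as the identity of H \<otimes> H.\<close>
    moreover have "tensor_map fixed_part (H \<otimes> H) T (H \<otimes> H) id (tensor_map H H H H id id) ?l =
      tensor_map fixed_part (H \<otimes> H) T (H \<otimes> H) id id ?l"
      by (rule tensor_map_cong) (simp_all add: tensor_map_ident)
    moreover have "?l \<in> carrier (fixed_part \<otimes> (H \<otimes> H))" "?r \<in> carrier (fixed_part \<otimes> (H \<otimes> H))"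
      by simp_all
    ultimately show ?thesis
      using retract_inclusion[OF is_vspace_tensor[of H H]] by metis
  qed
  ultimately show ?thesis
    by (simp add: precomodule_def is_vspace_fixed)
qed

lemma colinear_inclusion_fixed: "colinear H fixed_part T id" "colinear H fixed_part T (\<lambda>x. x)"
  unfolding colinear_def using lin_fixed
  by (simp_all add: coact_fixed(1) id_def[symmetric])

lemma colinear_into_fixed:
  assumes "precomodule H V" "colinear H V T f" "\<And>x. x \<in> carrier V \<Longrightarrow> r (f x) = f x"
  shows "colinear H V fixed_part f"
  unfolding colinear_def
proof (intro conjI ballI)
  show f: "lin V fixed_part f" using assms by (intro lin_into_fixed) (simp_all add: colinear_lin)
  fix v assume v: "v \<in> carrier V"
  have "coact fixed_part (f v) = tensor_map T H fixed_part H r id (tensor_map V H T H f id (coact V v))"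
    using v assms lin_mem[OF f v] by (simp add: coact_fixed(2) colinear_coact)
  also have "\<dots> = tensor_map V H fixed_part H (\<lambda>x. r (f x)) (\<lambda>x. id (id x)) (coact V v)"
    using assms lin_fixed is_vspace_fixed T v by (intro tensor_map_comp) (simp_all add: vs colinear_lin)
  also have "\<dots> = tensor_map V H fixed_part H f id (coact V v)"
    using assms by (intro tensor_map_cong) simp_all
  finally show "coact fixed_part (f v) = tensor_map V H fixed_part H f id (coact V v)" .
qed

end

end

section \<open>The tensor product of comodules\<close>

text \<open>The full tensor product, before passing to fixed points. Maps are composed and compared
  here, where associators are the ones of vector spaces and no preimages are chosen.\<close>

definition tens ::
    "('k::field, 'h) bialg \<Rightarrow> ('k, 'h, 'm) comod \<Rightarrow> ('k, 'h, 'n) comod \<Rightarrow> ('k, 'h, ('k, 'm, 'n) tensor) comod" where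
  "tens H M N = with_coact (M \<otimes> N) (diag_coact H M N)"

lemma tens_sel [simp]:
  "carrier (tens H M N) = carrier (M \<otimes> N)" "add (tens H M N) = add (M \<otimes> N)"
  "zero (tens H M N) = zero (M \<otimes> N)" "scale (tens H M N) = scale (M \<otimes> N)"
  "coact (tens H M N) = diag_coact H M N"
  by (simp_all add: tens_def)

lemma tens_vspace [simp]:
  "is_vspace (tens H M N) = is_vspace (M \<otimes> N)"
  "linear_maps (tens H M N) W = linear_maps (M \<otimes> N) W" "linear_maps U (tens H M N) = linear_maps U (M \<otimes> N)"
  "lin (tens H M N) W = lin (M \<otimes> N) W" "lin U (tens H M N) = lin U (M \<otimes> N)"
  "restrict_vspace (tens H M N) X = restrict_vspace (M \<otimes> N) X"
  by (simp_all add: tens_def)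

lemma tens_tensor [simp]:
  "tens H M N \<otimes> P = (M \<otimes> N) \<otimes> P" "P \<otimes> tens H M N = P \<otimes> (M \<otimes> N)"
  "tensor_elt m (tens H M N) P = tensor_elt m (M \<otimes> N) P"
  "tensor_elt p P (tens H M N) = tensor_elt p P (M \<otimes> N)"
  "tensor_lift (tens H M N) P W = tensor_lift (M \<otimes> N) P W"
  "tensor_lift P (tens H M N) W = tensor_lift P (M \<otimes> N) W"
  "tensor_lift P Q (tens H M N) = tensor_lift P Q (M \<otimes> N)"
  by (simp_all add: tens_def)

lemma tens_map [simp]:
  "tensor_map (tens H M N) P M' N' = tensor_map (M \<otimes> N) P M' N'"
  "tensor_map P (tens H M N) M' N' = tensor_map P (M \<otimes> N) M' N'"
  "tensor_map P Q (tens H M N) N' = tensor_map P Q (M \<otimes> N) N'"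
  "tensor_map P Q M' (tens H M N) = tensor_map P Q M' (M \<otimes> N)"
  by (simp_all add: tens_def)

lemma tens_assoc [simp]:
  "assoc (tens H M N) P Q = assoc (M \<otimes> N) P Q" "assoc P (tens H M N) Q = assoc P (M \<otimes> N) Q"
  "assoc P Q (tens H M N) = assoc P Q (M \<otimes> N)"
  by (simp_all add: tens_def)

context weak_bialg
begin

lemma diag_coact_linear_maps:
  assumes "precomodule H M" "precomodule H N"
  shows "diag_coact H M N \<in> linear_maps (M \<otimes> N) (M \<otimes> N \<otimes> H)"
  unfolding diag_coact_def using assms by (intro tensor_lift_linear_maps) (simp_all add: vs)

lemmas lin_diag_coact [vs] = diag_coact_linear_maps[THEN linear_mapsD]
lemmas diag_coact_mem [vs] = lin_diag_coact[THEN lin_mem]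
lemmas lin_diag_coact_arg [vs] = lin_diag_coact[THEN lin_comp[rotated]]

lemma diag_coact_pure:
  assumes "precomodule H M" "precomodule H N" "m \<in> carrier M" "n \<in> carrier N"
  shows "diag_coact H M N (m \<otimes>\<^bsub>M,N\<^esub> n) =
    cosum M (M \<otimes> N \<otimes> H) m (\<lambda>m0 m1. cosum N (M \<otimes> N \<otimes> H) n (\<lambda>n0 n1.
      (m0 \<otimes>\<^bsub>M,N\<^esub> n0) \<otimes>\<^bsub>M \<otimes> N, H\<^esub> mult H m1 n1))"
  unfolding diag_coact_def using assms by (subst lift_pure) (simp_all add: vs)

lemma lift_diag_coact:
  assumes "precomodule H M" "precomodule H N" "is_vspace W" "bilin (M \<otimes> N) H W B"
    "m \<in> carrier M" "n \<in> carrier N"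
  shows "tensor_lift (M \<otimes> N) H W B (diag_coact H M N (m \<otimes>\<^bsub>M,N\<^esub> n)) =
    cosum M W m (\<lambda>m0 m1. cosum N W n (\<lambda>n0 n1. B (m0 \<otimes>\<^bsub>M,N\<^esub> n0) (mult H m1 n1)))"
proof -
  have l: "h \<in> carrier H \<Longrightarrow> lin (M \<otimes> N) W (\<lambda>s. B s h)" "s \<in> carrier (M \<otimes> N) \<Longrightarrow> lin H W (B s)" for s h
    using assms(4) by (simp_all add: bilin_def)
  show ?thesis
    unfolding diag_coact_pure[OF assms(1,2,5,6)]
    using assms by (simp add: push lift_pure vs lin_mem[OF l(1)])
qed

text \<open>The sums over m and over n are separated, each is coassociated on its own, and
  multiplicativity of the comultiplication merges the two comultiplied legs into the
  comultiplication of a product.\<close>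

lemma diag_coact_coassoc_pure:
  assumes M: "precomodule H M" and N: "precomodule H N" and m: "m \<in> carrier M" and n: "n \<in> carrier N"
    and W: "is_vspace W"
    and F: "\<And>s h. s \<in> carrier (M \<otimes> N) \<Longrightarrow> h \<in> carrier H \<Longrightarrow> lin H W (\<lambda>k. F s h k)"
      "\<And>s k. s \<in> carrier (M \<otimes> N) \<Longrightarrow> k \<in> carrier H \<Longrightarrow> lin H W (\<lambda>h. F s h k)"
      "\<And>h k. h \<in> carrier H \<Longrightarrow> k \<in> carrier H \<Longrightarrow> lin (M \<otimes> N) W (\<lambda>s. F s h k)"
  shows "cosum M W m (\<lambda>m0 m1. cosum N W n (\<lambda>n0 n1. cosum M W m0 (\<lambda>a b. cosum N W n0 (\<lambda>c d.
      F (a \<otimes>\<^bsub>M,N\<^esub> c) (mult H b d) (mult H m1 n1))))) =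
    cosum M W m (\<lambda>m0 m1. cosum N W n (\<lambda>n0 n1. hsum W (mult H m1 n1) (\<lambda>h k. F (m0 \<otimes>\<^bsub>M,N\<^esub> n0) h k)))"
proof -
  note F' = F(1)[THEN lin_comp[rotated]] F(2)[THEN lin_comp[rotated]] F(3)[THEN lin_comp[rotated]] lin_mem[OF F(1)]
  note [simp] = vs M N W m n
  note [simp] = F'
  have "cosum M W m (\<lambda>m0 m1. cosum N W n (\<lambda>n0 n1. cosum M W m0 (\<lambda>a b. cosum N W n0 (\<lambda>c d.
      F (a \<otimes>\<^bsub>M,N\<^esub> c) (mult H b d) (mult H m1 n1))))) =
    cosum M W m (\<lambda>m0 m1. cosum M W m0 (\<lambda>a b. cosum N W n (\<lambda>n0 n1. cosum N W n0 (\<lambda>c d.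
      F (a \<otimes>\<^bsub>M,N\<^esub> c) (mult H b d) (mult H m1 n1)))))"
    by (intro tensor_lift_cong refl lift_swap) simp_all
  also have "\<dots> = cosum M W m (\<lambda>m0 m1. hsum W m1 (\<lambda>b b'. cosum N W n (\<lambda>n0 n1. cosum N W n0 (\<lambda>c d.
      F (m0 \<otimes>\<^bsub>M,N\<^esub> c) (mult H b d) (mult H b' n1)))))"
    by (intro coact_coassoc) simp_all
  also have "\<dots> = cosum M W m (\<lambda>m0 m1. hsum W m1 (\<lambda>b b'. cosum N W n (\<lambda>n0 n1. hsum W n1 (\<lambda>d d'.
      F (m0 \<otimes>\<^bsub>M,N\<^esub> n0) (mult H b d) (mult H b' d')))))"
    by (intro tensor_lift_cong refl coact_coassoc) simp_all
  also have "\<dots> = cosum M W m (\<lambda>m0 m1. cosum N W n (\<lambda>n0 n1. hsum W m1 (\<lambda>b b'. hsum W n1 (\<lambda>d d'.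
      F (m0 \<otimes>\<^bsub>M,N\<^esub> n0) (mult H b d) (mult H b' d')))))"
    by (intro tensor_lift_cong refl lift_swap) simp_all
  also have "\<dots> = cosum M W m (\<lambda>m0 m1. cosum N W n (\<lambda>n0 n1. hsum W (mult H m1 n1) (\<lambda>h k. F (m0 \<otimes>\<^bsub>M,N\<^esub> n0) h k)))"
    by (intro tensor_lift_cong refl comult_mult[symmetric]) simp_all
  finally show ?thesis .
qed

lemma precomodule_tens [vs]:
  assumes M: "precomodule H M" and N: "precomodule H N"
  shows "precomodule H (tens H M N)"
proof -
  note [simp] = vs M N
  have "assoc (M \<otimes> N) H H (tensor_map (M \<otimes> N) H (M \<otimes> N \<otimes> H) H (diag_coact H M N) id (diag_coact H M N t)) =
        tensor_map (M \<otimes> N) H (M \<otimes> N) (H \<otimes> H) id (comult H) (diag_coact H M N t)"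
    if "t \<in> carrier (M \<otimes> N)" for t
  proof (rule lin_tensor_eqI[OF _ _ _ _ is_vspace_tensor[of "M \<otimes> N" "H \<otimes> H"] _ that])
    fix m n assume mn [simp]: "m \<in> carrier M" "n \<in> carrier N"
    let ?W = "(M \<otimes> N) \<otimes> (H \<otimes> H)"
    have "assoc (M \<otimes> N) H H (tensor_map (M \<otimes> N) H (M \<otimes> N \<otimes> H) H (diag_coact H M N) id (diag_coact H M N (m \<otimes>\<^bsub>M,N\<^esub> n))) =
      tensor_lift (M \<otimes> N) H ?W (\<lambda>s k. assoc (M \<otimes> N) H H (diag_coact H M N s \<otimes>\<^bsub>M \<otimes> N \<otimes> H,H\<^esub> k)) (diag_coact H M N (m \<otimes>\<^bsub>M,N\<^esub> n))"
      unfolding tensor_map_def by (subst lift_push[where f = "assoc (M \<otimes> N) H H"]) (simp_all add: lin_assoc)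
    also have "\<dots> = cosum M ?W m (\<lambda>m0 m1. cosum N ?W n (\<lambda>n0 n1.
      assoc (M \<otimes> N) H H (diag_coact H M N (m0 \<otimes>\<^bsub>M,N\<^esub> n0) \<otimes>\<^bsub>M \<otimes> N \<otimes> H,H\<^esub> mult H m1 n1)))"
      by (subst lift_diag_coact) simp_all
    also have "\<dots> = cosum M ?W m (\<lambda>m0 m1. cosum N ?W n (\<lambda>n0 n1.
        tensor_lift (M \<otimes> N) H ?W (\<lambda>s h. s \<otimes>\<^bsub>M \<otimes> N,H \<otimes> H\<^esub> (h \<otimes>\<^bsub>H,H\<^esub> mult H m1 n1)) (diag_coact H M N (m0 \<otimes>\<^bsub>M,N\<^esub> n0))))"
    proof (intro tensor_lift_cong refl)
      fix m0 m1 n0 n1 assume [simp]: "m0 \<in> carrier M" "n0 \<in> carrier N" "m1 \<in> carrier H" "n1 \<in> carrier H"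
      show "assoc (M \<otimes> N) H H (diag_coact H M N (m0 \<otimes>\<^bsub>M,N\<^esub> n0) \<otimes>\<^bsub>M \<otimes> N \<otimes> H,H\<^esub> mult H m1 n1) =
        tensor_lift (M \<otimes> N) H ?W (\<lambda>s h. s \<otimes>\<^bsub>M \<otimes> N,H \<otimes> H\<^esub> (h \<otimes>\<^bsub>H,H\<^esub> mult H m1 n1)) (diag_coact H M N (m0 \<otimes>\<^bsub>M,N\<^esub> n0))"
        by (rule lift_eqI[where f = "\<lambda>t. assoc (M \<otimes> N) H H (t \<otimes>\<^bsub>M \<otimes> N \<otimes> H,H\<^esub> mult H m1 n1)"])
          (simp_all add: assoc_pure)
    qed
    also have "\<dots> = cosum M ?W m (\<lambda>m0 m1. cosum N ?W n (\<lambda>n0 n1. cosum M ?W m0 (\<lambda>a b. cosum N ?W n0 (\<lambda>c d.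
        (a \<otimes>\<^bsub>M,N\<^esub> c) \<otimes>\<^bsub>M \<otimes> N,H \<otimes> H\<^esub> (mult H b d \<otimes>\<^bsub>H,H\<^esub> mult H m1 n1)))))"
      by (intro tensor_lift_cong refl lift_diag_coact) simp_all
    also have "\<dots> = cosum M ?W m (\<lambda>m0 m1. cosum N ?W n (\<lambda>n0 n1. hsum ?W (mult H m1 n1) (\<lambda>h k.
        (m0 \<otimes>\<^bsub>M,N\<^esub> n0) \<otimes>\<^bsub>M \<otimes> N,H \<otimes> H\<^esub> (h \<otimes>\<^bsub>H,H\<^esub> k))))"
      by (rule diag_coact_coassoc_pure) simp_all
    also have "\<dots> = cosum M ?W m (\<lambda>m0 m1. cosum N ?W n (\<lambda>n0 n1.
        (m0 \<otimes>\<^bsub>M,N\<^esub> n0) \<otimes>\<^bsub>M \<otimes> N,H \<otimes> H\<^esub> comult H (mult H m1 n1)))"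
      by (intro tensor_lift_cong refl) (simp add: push_tensor_elt[symmetric] lift_tensor_elt)
    also have "\<dots> = tensor_map (M \<otimes> N) H (M \<otimes> N) (H \<otimes> H) id (comult H) (diag_coact H M N (m \<otimes>\<^bsub>M,N\<^esub> n))"
      unfolding tensor_map_def by (subst lift_diag_coact) simp_all
    finally show "assoc (M \<otimes> N) H H (tensor_map (M \<otimes> N) H (M \<otimes> N \<otimes> H) H (diag_coact H M N) id (diag_coact H M N (m \<otimes>\<^bsub>M,N\<^esub> n))) =
        tensor_map (M \<otimes> N) H (M \<otimes> N) (H \<otimes> H) id (comult H) (diag_coact H M N (m \<otimes>\<^bsub>M,N\<^esub> n))" .
  qed simp_all
  then show ?thesis
    using diag_coact_linear_maps[OF M N] by (simp add: precomodule_def)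
qed

lemma colinear_tensor_map:
  assumes V: "precomodule H M" "precomodule H N" "precomodule H M'" "precomodule H N'"
    and f: "colinear H M M' f" and g: "colinear H N N' g"
  shows "colinear H (tens H M N) (tens H M' N') (tensor_map M N M' N' f g)"
proof -
  note [simp] = vs V colinear_lin[OF f] colinear_lin[OF g] lin_mem[OF colinear_lin[OF f]] lin_mem[OF colinear_lin[OF g]]
    lin_tensor_map lin_comp[OF _ colinear_lin[OF f]] lin_comp[OF _ colinear_lin[OF g]]
  have "diag_coact H M' N' (tensor_map M N M' N' f g t) =
    tensor_map (M \<otimes> N) H (M' \<otimes> N') H (tensor_map M N M' N' f g) id (diag_coact H M N t)"
    if "t \<in> carrier (M \<otimes> N)" for t
  proof (rule lin_tensor_eqI[OF _ _ _ _ is_vspace_tensor[of "M' \<otimes> N'" "H"] _ that])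
    fix m n assume mn [simp]: "m \<in> carrier M" "n \<in> carrier N"
    let ?W = "(M' \<otimes> N') \<otimes> H"
    have "diag_coact H M' N' (tensor_map M N M' N' f g (m \<otimes>\<^bsub>M,N\<^esub> n)) =
      cosum M ?W m (\<lambda>m0 m1. cosum N ?W n (\<lambda>n0 n1. (f m0 \<otimes>\<^bsub>M',N'\<^esub> g n0) \<otimes>\<^bsub>M' \<otimes> N', H\<^esub> mult H m1 n1))"
      by (simp add: tensor_map_pure diag_coact_pure lift_coact_colinear[OF V(1,3) _ _ f]
          lift_coact_colinear[OF V(2,4) _ _ g])
    also have "\<dots> = tensor_map (M \<otimes> N) H (M' \<otimes> N') H (tensor_map M N M' N' f g) id (diag_coact H M N (m \<otimes>\<^bsub>M,N\<^esub> n))"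
      unfolding tensor_map_def[of "M \<otimes> N"] by (subst lift_diag_coact) (simp_all add: tensor_map_pure)
    finally show "diag_coact H M' N' (tensor_map M N M' N' f g (m \<otimes>\<^bsub>M,N\<^esub> n)) = \<dots>" .
  qed simp_all
  then show ?thesis
    by (simp add: colinear_def)
qed

text \<open>On pure tensors the two coactions differ only in the bracketing of \<open>m1\<close>,
  \<open>n1\<close> and \<open>p1\<close> in H.\<close>

lemma colinear_assoc:
  assumes V: "precomodule H M" "precomodule H N" "precomodule H P"
  shows "colinear H (tens H (tens H M N) P) (tens H M (tens H N P)) (assoc M N P)"
    and "colinear H (tens H M (tens H N P)) (tens H (tens H M N) P) (assoc_inv M N P)"
proof -
  note [simp] = vs V lin_assoc
  note pc = precomodule_tens[OF V(1,2)] precomodule_tens[OF V(2,3)]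
  have d [simp]: "lin (M \<otimes> N \<otimes> P) ((M \<otimes> N) \<otimes> P \<otimes> H) (diag_coact H (tens H M N) P)"
     "lin (M \<otimes> (N \<otimes> P)) (M \<otimes> (N \<otimes> P) \<otimes> H) (diag_coact H M (tens H N P))"
    using lin_diag_coact[OF pc(1) V(3)] lin_diag_coact[OF V(1) pc(2)] by simp_all
  note [simp] = d[THEN lin_mem] d[THEN lin_comp[rotated]]
  have "diag_coact H M (tens H N P) (assoc M N P t) =
    tensor_map ((M \<otimes> N) \<otimes> P) H (M \<otimes> (N \<otimes> P)) H (assoc M N P) id (diag_coact H (tens H M N) P t)"
    if "t \<in> carrier ((M \<otimes> N) \<otimes> P)" for t
  proof (rule lin_tensor3_eqI[OF _ _ _ is_vspace_tensor[of "M \<otimes> (N \<otimes> P)" "H"] _ _ _ that])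
    fix m n p assume mn [simp]: "m \<in> carrier M" "n \<in> carrier N" "p \<in> carrier P"
    let ?W = "(M \<otimes> (N \<otimes> P)) \<otimes> H"
    have "diag_coact H M (tens H N P) (assoc M N P ((m \<otimes>\<^bsub>M,N\<^esub> n) \<otimes>\<^bsub>M \<otimes> N,P\<^esub> p)) =
      cosum M ?W m (\<lambda>m0 m1. tensor_lift (N \<otimes> P) H ?W (\<lambda>s h.
        (m0 \<otimes>\<^bsub>M,N \<otimes> P\<^esub> s) \<otimes>\<^bsub>M \<otimes> (N \<otimes> P),H\<^esub> mult H m1 h) (diag_coact H N P (n \<otimes>\<^bsub>N,P\<^esub> p)))"
      using diag_coact_pure[OF V(1) pc(2), of m "n \<otimes>\<^bsub>N,P\<^esub> p"] by (simp add: assoc_pure)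
    also have "\<dots> = cosum M ?W m (\<lambda>m0 m1. cosum N ?W n (\<lambda>n0 n1. cosum P ?W p (\<lambda>p0 p1.
        (m0 \<otimes>\<^bsub>M,N \<otimes> P\<^esub> (n0 \<otimes>\<^bsub>N,P\<^esub> p0)) \<otimes>\<^bsub>M \<otimes> (N \<otimes> P),H\<^esub> mult H m1 (mult H n1 p1))))"
      by (intro tensor_lift_cong refl lift_diag_coact) simp_all
    also have "\<dots> = cosum M ?W m (\<lambda>m0 m1. cosum N ?W n (\<lambda>n0 n1. cosum P ?W p (\<lambda>p0 p1.
        (assoc M N P ((m0 \<otimes>\<^bsub>M,N\<^esub> n0) \<otimes>\<^bsub>M \<otimes> N,P\<^esub> p0)) \<otimes>\<^bsub>M \<otimes> (N \<otimes> P),H\<^esub> mult H (mult H m1 n1) p1)))"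
      by (simp add: assoc_pure mult_laws)
    also have "\<dots> = tensor_lift (M \<otimes> N) H ?W (\<lambda>s h. cosum P ?W p (\<lambda>p0 p1.
        (assoc M N P (s \<otimes>\<^bsub>M \<otimes> N,P\<^esub> p0)) \<otimes>\<^bsub>M \<otimes> (N \<otimes> P),H\<^esub> mult H h p1)) (diag_coact H M N (m \<otimes>\<^bsub>M,N\<^esub> n))"
      by (subst lift_diag_coact) simp_all
    also have "\<dots> = tensor_map ((M \<otimes> N) \<otimes> P) H (M \<otimes> (N \<otimes> P)) H (assoc M N P) id
        (diag_coact H (tens H M N) P ((m \<otimes>\<^bsub>M,N\<^esub> n) \<otimes>\<^bsub>M \<otimes> N,P\<^esub> p))"
      unfolding tensor_map_def
      using lift_diag_coact[OF pc(1) V(3), of ?W "\<lambda>s h. assoc M N P s \<otimes>\<^bsub>M \<otimes> (N \<otimes> P),H\<^esub> h" "m \<otimes>\<^bsub>M,N\<^esub> n" p]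
      by simp
    finally show "diag_coact H M (tens H N P) (assoc M N P ((m \<otimes>\<^bsub>M,N\<^esub> n) \<otimes>\<^bsub>M \<otimes> N,P\<^esub> p)) = \<dots>" .
  qed simp_all
  then show *: "colinear H (tens H (tens H M N) P) (tens H M (tens H N P)) (assoc M N P)"
    by (simp add: colinear_def)
  show "colinear H (tens H M (tens H N P)) (tens H (tens H M N) P) (assoc_inv M N P)"
    by (rule colinear_inverse[OF _ _ *]) (simp_all add: assoc_inverse)
qed

section \<open>The projection onto the monoidal product\<close>

lemma counit_proj_tens_pure:
  assumes "precomodule H M" "precomodule H N" "m \<in> carrier M" "n \<in> carrier N"
  shows "counit_proj H (tens H M N) (m \<otimes>\<^bsub>M,N\<^esub> n) =
    cosum M (M \<otimes> N) m (\<lambda>m0 m1. cosum N (M \<otimes> N) n (\<lambda>n0 n1.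
      scale (M \<otimes> N) (counit H (mult H m1 n1)) (m0 \<otimes>\<^bsub>M,N\<^esub> n0)))"
  unfolding counit_proj_def using assms by (simp add: lift_diag_coact vs)

lemma counit_proj_tens_mem:
  "precomodule H M \<Longrightarrow> precomodule H N \<Longrightarrow> t \<in> carrier (M \<otimes> N) \<Longrightarrow> counit_proj H (tens H M N) t \<in> carrier (M \<otimes> N)"
  using counit_proj_mem[OF precomodule_tens[of M N], of t] by simp

lemma lin_counit_proj_tens:
  "precomodule H M \<Longrightarrow> precomodule H N \<Longrightarrow> lin (M \<otimes> N) (M \<otimes> N) (counit_proj H (tens H M N))"
  using lin_counit_proj[OF precomodule_tens[of M N] lin_ident(1)] by simp

text \<open>Identifies the idempotent in the definition of the product with the projection of the
  diagonal coaction, so that the general facts about \<open>counit_proj\<close> govern the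
  product.\<close>

lemma mtensor_proj_eq:
  assumes "precomodule H M" "precomodule H N" "t \<in> carrier (M \<otimes> N)"
  shows "mtensor_proj H M N t = counit_proj H (tens H M N) t"
proof -
  have "counit_proj H (tens H M N) t = tensor_lift M N (M \<otimes> N) (\<lambda>m n. cosum M (M \<otimes> N) m (\<lambda>m0 m1. cosum N (M \<otimes> N) n (\<lambda>n0 n1.
      scale (M \<otimes> N) (counit H (mult H m1 n1)) (m0 \<otimes>\<^bsub>M,N\<^esub> n0)))) t"
    using assms by (subst lift_eqI[symmetric, OF _ _ _ _ lin_counit_proj_tens]) (simp_all add: vs counit_proj_tens_pure)
  then show ?thesis
    by (simp add: mtensor_proj_def)
qed


abbreviation "cp M N \<equiv> counit_proj H (tens H M N)"

lemma scale_scale: "is_vspace V \<Longrightarrow> x \<in> carrier V \<Longrightarrow> scale V c (scale V d x) = scale V (c * d) x"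
  by (simp add: vspace_laws)

text \<open>Each leg that \<open>cp\<close> leaves in M or N is the zeroth component of a coaction,
  on which the projection acts trivially by \<open>lift_coact_counit_proj\<close>. When a factor is
  itself a tensor product, a tensor fixed by the outer projection is thereby fixed by the inner one
  too.\<close>

lemma counit_proj_absorb:
  assumes V: "precomodule H M" "precomodule H N" and t: "t \<in> carrier (M \<otimes> N)"
  shows "tensor_map M N M N id (counit_proj H N) (cp M N t) = cp M N t"
    and "tensor_map M N M N (counit_proj H M) id (cp M N t) = cp M N t"
proof -
  note [simp] = vs V lin_counit_proj[OF V(1) lin_ident(1)] lin_counit_proj[OF V(2) lin_ident(1)]
    lin_counit_proj_tens counit_proj_tens_mem lin_comp[OF _ lin_counit_proj_tens]
  note pure = counit_proj_tens_pure[OF V]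
  show "tensor_map M N M N id (counit_proj H N) (cp M N t) = cp M N t"
  proof (rule lin_tensor_eqI[OF _ _ _ _ is_vspace_tensor[of M N] _ t])
    fix m n assume mn [simp]: "m \<in> carrier M" "n \<in> carrier N"
    show "tensor_map M N M N id (counit_proj H N) (cp M N (m \<otimes>\<^bsub>M,N\<^esub> n)) = cp M N (m \<otimes>\<^bsub>M,N\<^esub> n)"
      by (simp add: pure push tensor_map_pure lin_scale_arg[OF lin_tensor_map]
        lift_coact_counit_proj[where B = "\<lambda>n0 n1. scale (M \<otimes> N) (counit H (mult H _ n1)) (_ \<otimes>\<^bsub>M,N\<^esub> n0)"])
  qed simp_all
  show "tensor_map M N M N (counit_proj H M) id (cp M N t) = cp M N t"
  proof (rule lin_tensor_eqI[OF _ _ _ _ is_vspace_tensor[of M N] _ t])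
    fix m n assume mn [simp]: "m \<in> carrier M" "n \<in> carrier N"
    have "tensor_map M N M N (counit_proj H M) id (cp M N (m \<otimes>\<^bsub>M,N\<^esub> n)) =
      cosum M (M \<otimes> N) m (\<lambda>m0 m1. cosum N (M \<otimes> N) n (\<lambda>n0 n1.
        scale (M \<otimes> N) (counit H (mult H m1 n1)) (counit_proj H M m0 \<otimes>\<^bsub>M,N\<^esub> n0)))"
      by (simp add: pure push tensor_map_pure lin_scale_arg[OF lin_tensor_map])
    also have "\<dots> = cp M N (m \<otimes>\<^bsub>M,N\<^esub> n)"
      unfolding pure[OF mn]
      by (rule lift_coact_counit_proj[where B = "\<lambda>m0 m1. cosum N (M \<otimes> N) n (\<lambda>n0 n1.
        scale (M \<otimes> N) (counit H (mult H m1 n1)) (m0 \<otimes>\<^bsub>M,N\<^esub> n0))"]) simp_all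
    finally show "tensor_map M N M N (counit_proj H M) id (cp M N (m \<otimes>\<^bsub>M,N\<^esub> n)) = cp M N (m \<otimes>\<^bsub>M,N\<^esub> n)" .
  qed simp_all
qed

text \<open>The two multiplicativity axioms of the counit say that projecting two adjacent pairs of
  factors amounts to projecting the triple product.\<close>

lemma counit_proj_triple:
  assumes V: "precomodule H M" "precomodule H N" "precomodule H P" and t: "t \<in> carrier (M \<otimes> (N \<otimes> P))"
  shows "tensor_map (M \<otimes> N) P (M \<otimes> N) P (cp M N) id
      (assoc_inv M N P (tensor_map M (N \<otimes> P) M (N \<otimes> P) id (cp N P) t)) =
    cp (tens H M N) P (assoc_inv M N P t)"
proof -
  note [simp] = vs V lin_assoc scale_scale
    lin_counit_proj_tens counit_proj_tens_mem lin_comp[OF _ lin_counit_proj_tens]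
  note [simp] = lin_counit_proj_tens[OF precomodule_tens[OF V(1,2)] V(3), simplified]
  note [simp] = lin_comp[OF _ this] this[THEN lin_mem]
  show ?thesis
  proof (rule lin_tensor3_eqI'[OF _ _ _ is_vspace_tensor[of "M \<otimes> N" P] _ _ _ t])
    fix m n p assume mn [simp]: "m \<in> carrier M" "n \<in> carrier N" "p \<in> carrier P"
    let ?W = "(M \<otimes> N) \<otimes> P"
    have "tensor_map (M \<otimes> N) P (M \<otimes> N) P (cp M N) id
        (assoc_inv M N P (tensor_map M (N \<otimes> P) M (N \<otimes> P) id (cp N P) (m \<otimes>\<^bsub>M,N \<otimes> P\<^esub> (n \<otimes>\<^bsub>N,P\<^esub> p)))) =
      cosum N ?W n (\<lambda>n0 n1. cosum P ?W p (\<lambda>p0 p1.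
        tensor_map (M \<otimes> N) P (M \<otimes> N) P (cp M N) id (assoc_inv M N P
          (scale (M \<otimes> (N \<otimes> P)) (counit H (mult H n1 p1)) (m \<otimes>\<^bsub>M,N \<otimes> P\<^esub> (n0 \<otimes>\<^bsub>N,P\<^esub> p0))))))"
      by (simp add: tensor_map_pure counit_proj_tens_pure[OF V(2,3)] push scale_tensor_elt
        lift_push[where f = "assoc_inv M N P" and W' = "M \<otimes> N \<otimes> P"])
    also have "\<dots> = cosum N ?W n (\<lambda>n0 n1. cosum P ?W p (\<lambda>p0 p1.
        cosum M ?W m (\<lambda>m0 m1. cosum N ?W n0 (\<lambda>a b.
          scale ?W (counit H (mult H m1 b) * counit H (mult H n1 p1)) ((m0 \<otimes>\<^bsub>M,N\<^esub> a) \<otimes>\<^bsub>M \<otimes> N,P\<^esub> p0)))))"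
      by (simp add: lin_scale_arg[OF lin_assoc(2)] lin_scale_arg[OF lin_tensor_map] assoc_pure tensor_map_pure
        counit_proj_tens_pure[OF V(1,2)] push scale_tensor_elt mult.commute)
    \<comment> \<open>The sums over p and m move outwards, so that the two nested coactions of n
      become adjacent and coassociativity turns the inner one into a comultiplication.\<close>
    also have "\<dots> = cosum P ?W p (\<lambda>p0 p1. cosum N ?W n (\<lambda>n0 n1.
        cosum M ?W m (\<lambda>m0 m1. cosum N ?W n0 (\<lambda>a b.
          scale ?W (counit H (mult H m1 b) * counit H (mult H n1 p1)) ((m0 \<otimes>\<^bsub>M,N\<^esub> a) \<otimes>\<^bsub>M \<otimes> N,P\<^esub> p0)))))"
      by (intro lift_swap) simp_all
    also have "\<dots> = cosum P ?W p (\<lambda>p0 p1. cosum M ?W m (\<lambda>m0 m1. cosum N ?W n (\<lambda>n0 n1. cosum N ?W n0 (\<lambda>a b.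
          scale ?W (counit H (mult H m1 b) * counit H (mult H n1 p1)) ((m0 \<otimes>\<^bsub>M,N\<^esub> a) \<otimes>\<^bsub>M \<otimes> N,P\<^esub> p0)))))"
      by (intro tensor_lift_cong refl lift_swap) simp_all
    also have "\<dots> = cosum P ?W p (\<lambda>p0 p1. cosum M ?W m (\<lambda>m0 m1. cosum N ?W n (\<lambda>n0 n1. hsum ?W n1 (\<lambda>b c.
          scale ?W (counit H (mult H m1 b) * counit H (mult H c p1)) ((m0 \<otimes>\<^bsub>M,N\<^esub> n0) \<otimes>\<^bsub>M \<otimes> N,P\<^esub> p0)))))"
      by (intro tensor_lift_cong refl coact_coassoc) simp_all
    also have "\<dots> = cosum P ?W p (\<lambda>p0 p1. cosum M ?W m (\<lambda>m0 m1. cosum N ?W n (\<lambda>n0 n1. 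
          scale ?W (counit H (mult H m1 (mult H n1 p1))) ((m0 \<otimes>\<^bsub>M,N\<^esub> n0) \<otimes>\<^bsub>M \<otimes> N,P\<^esub> p0))))"
      by (simp add: push_scalar(1)[symmetric] counit_mult3)
    also have "\<dots> = cosum M ?W m (\<lambda>m0 m1. cosum P ?W p (\<lambda>p0 p1. cosum N ?W n (\<lambda>n0 n1. 
          scale ?W (counit H (mult H m1 (mult H n1 p1))) ((m0 \<otimes>\<^bsub>M,N\<^esub> n0) \<otimes>\<^bsub>M \<otimes> N,P\<^esub> p0))))"
      by (intro lift_swap) simp_all
    also have "\<dots> = cosum M ?W m (\<lambda>m0 m1. cosum N ?W n (\<lambda>n0 n1. cosum P ?W p (\<lambda>p0 p1. 
          scale ?W (counit H (mult H (mult H m1 n1) p1)) ((m0 \<otimes>\<^bsub>M,N\<^esub> n0) \<otimes>\<^bsub>M \<otimes> N,P\<^esub> p0))))"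
      unfolding lift_swap[symmetric] 
      by (intro tensor_lift_cong refl) (subst lift_swap, simp_all add: mult_laws)
    also have "\<dots> = tensor_lift (M \<otimes> N) H ?W (\<lambda>s h. cosum P ?W p (\<lambda>p0 p1.
          scale ?W (counit H (mult H h p1)) (s \<otimes>\<^bsub>M \<otimes> N,P\<^esub> p0))) (diag_coact H M N (m \<otimes>\<^bsub>M,N\<^esub> n))"
      by (subst lift_diag_coact) simp_all
    also have "\<dots> = cp (tens H M N) P (assoc_inv M N P (m \<otimes>\<^bsub>M,N \<otimes> P\<^esub> (n \<otimes>\<^bsub>N,P\<^esub> p)))"
      using counit_proj_tens_pure[OF precomodule_tens[OF V(1,2)] V(3), of "m \<otimes>\<^bsub>M,N\<^esub> n" p]
      by (simp add: assoc_pure)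
    finally show "tensor_map (M \<otimes> N) P (M \<otimes> N) P (cp M N) id
        (assoc_inv M N P (tensor_map M (N \<otimes> P) M (N \<otimes> P) id (cp N P) (m \<otimes>\<^bsub>M,N \<otimes> P\<^esub> (n \<otimes>\<^bsub>N,P\<^esub> p)))) = \<dots>" .
  qed simp_all
qed

text \<open>Projecting the first pair before the second pairs m with the later leg of n and p with
  the earlier one. This is the arrangement
  \<open>\<epsilon>(a b\<^sub>2) \<epsilon>(b\<^sub>1 c)\<close> of the second axiom, whereas
  \<open>counit_proj_triple\<close> meets
  \<open>\<epsilon>(a b\<^sub>1) \<epsilon>(b\<^sub>2 c)\<close>.\<close>

lemma counit_proj_triple':
  assumes V: "precomodule H M" "precomodule H N" "precomodule H P" and t: "t \<in> carrier (M \<otimes> N \<otimes> P)"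
  shows "tensor_map M (N \<otimes> P) M (N \<otimes> P) id (cp N P)
      (assoc M N P (tensor_map (M \<otimes> N) P (M \<otimes> N) P (cp M N) id t)) =
    cp M (tens H N P) (assoc M N P t)"
proof -
  note [simp] = vs V lin_assoc scale_scale
    lin_counit_proj_tens counit_proj_tens_mem lin_comp[OF _ lin_counit_proj_tens]
  note [simp] = lin_counit_proj_tens[OF V(1) precomodule_tens[OF V(2,3)], simplified]
  note [simp] = lin_comp[OF _ this] this[THEN lin_mem]
  show ?thesis
  proof (rule lin_tensor3_eqI[OF _ _ _ is_vspace_tensor[of M "N \<otimes> P"] _ _ _ t])
    fix m n p assume mn [simp]: "m \<in> carrier M" "n \<in> carrier N" "p \<in> carrier P"
    let ?W = "M \<otimes> (N \<otimes> P)"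
    have "tensor_map M (N \<otimes> P) M (N \<otimes> P) id (cp N P)
        (assoc M N P (tensor_map (M \<otimes> N) P (M \<otimes> N) P (cp M N) id ((m \<otimes>\<^bsub>M,N\<^esub> n) \<otimes>\<^bsub>M \<otimes> N,P\<^esub> p))) =
      cosum M ?W m (\<lambda>m0 m1. cosum N ?W n (\<lambda>n0 n1.
        tensor_map M (N \<otimes> P) M (N \<otimes> P) id (cp N P) (assoc M N P
          (scale (M \<otimes> N \<otimes> P) (counit H (mult H m1 n1)) ((m0 \<otimes>\<^bsub>M,N\<^esub> n0) \<otimes>\<^bsub>M \<otimes> N,P\<^esub> p)))))"
      by (simp add: tensor_map_pure counit_proj_tens_pure[OF V(1,2)] push scale_tensor_elt
        lift_push[where f = "assoc M N P" and W' = "M \<otimes> (N \<otimes> P)"])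
    also have "\<dots> = cosum M ?W m (\<lambda>m0 m1. cosum N ?W n (\<lambda>n0 n1.
        cosum N ?W n0 (\<lambda>a b. cosum P ?W p (\<lambda>p0 p1.
          scale ?W (counit H (mult H m1 n1) * counit H (mult H b p1)) (m0 \<otimes>\<^bsub>M,N \<otimes> P\<^esub> (a \<otimes>\<^bsub>N,P\<^esub> p0))))))"
      by (simp add: lin_scale_arg[OF lin_assoc(1)] lin_scale_arg[OF lin_tensor_map] assoc_pure tensor_map_pure
        counit_proj_tens_pure[OF V(2,3)] push scale_tensor_elt mult.commute)
    also have "\<dots> = cosum M ?W m (\<lambda>m0 m1. cosum N ?W n (\<lambda>n0 n1.
        hsum ?W n1 (\<lambda>b c. cosum P ?W p (\<lambda>p0 p1.
          scale ?W (counit H (mult H m1 c) * counit H (mult H b p1)) (m0 \<otimes>\<^bsub>M,N \<otimes> P\<^esub> (n0 \<otimes>\<^bsub>N,P\<^esub> p0))))))"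
      by (intro tensor_lift_cong refl coact_coassoc) simp_all
    also have "\<dots> = cosum M ?W m (\<lambda>m0 m1. cosum N ?W n (\<lambda>n0 n1. cosum P ?W p (\<lambda>p0 p1.
        hsum ?W n1 (\<lambda>b c. 
          scale ?W (counit H (mult H m1 c) * counit H (mult H b p1)) (m0 \<otimes>\<^bsub>M,N \<otimes> P\<^esub> (n0 \<otimes>\<^bsub>N,P\<^esub> p0))))))"
      by (intro tensor_lift_cong refl lift_swap) simp_all
    also have "\<dots> = cosum M ?W m (\<lambda>m0 m1. cosum N ?W n (\<lambda>n0 n1. cosum P ?W p (\<lambda>p0 p1.
          scale ?W (counit H (mult H m1 (mult H n1 p1))) (m0 \<otimes>\<^bsub>M,N \<otimes> P\<^esub> (n0 \<otimes>\<^bsub>N,P\<^esub> p0)))))"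
      by (simp add: push_scalar(1)[symmetric] counit_mult3)
    also have "\<dots> = cosum M ?W m (\<lambda>m0 m1. tensor_lift (N \<otimes> P) H ?W (\<lambda>s h.
          scale ?W (counit H (mult H m1 h)) (m0 \<otimes>\<^bsub>M,N \<otimes> P\<^esub> s)) (diag_coact H N P (n \<otimes>\<^bsub>N,P\<^esub> p)))"
      by (intro tensor_lift_cong refl, subst lift_diag_coact) simp_all
    also have "\<dots> = cp M (tens H N P) (assoc M N P ((m \<otimes>\<^bsub>M,N\<^esub> n) \<otimes>\<^bsub>M \<otimes> N,P\<^esub> p))"
      using counit_proj_tens_pure[OF V(1) precomodule_tens[OF V(2,3)], of m "n \<otimes>\<^bsub>N,P\<^esub> p"]
      by (simp add: assoc_pure)
    finally show "tensor_map M (N \<otimes> P) M (N \<otimes> P) id (cp N P)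
        (assoc M N P (tensor_map (M \<otimes> N) P (M \<otimes> N) P (cp M N) id ((m \<otimes>\<^bsub>M,N\<^esub> n) \<otimes>\<^bsub>M \<otimes> N,P\<^esub> p))) = \<dots>" .
  qed simp_all
qed


section \<open>The monoidal product and its associator\<close>

lemma comoduleD [vs]: "comodule H M \<Longrightarrow> precomodule H M"
  and comodule_counit_proj: "comodule H M \<Longrightarrow> m \<in> carrier M \<Longrightarrow> counit_proj H M m = m"
  by (simp_all add: comodule_iff)

lemma mtensor_eq:
  assumes "precomodule H M" "precomodule H N"
  shows "mtensor H M N = fixed_comodule H (tens H M N) (cp M N)"
proof -
  have *: "{t \<in> carrier (M \<otimes> N). mtensor_proj H M N t = t} = {t \<in> carrier (M \<otimes> N). cp M N t = t}"
    using mtensor_proj_eq[OF assms] by auto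
  have "corestrict_coact H S (M \<otimes> N) \<rho> = corestrict_coact H S (tens H M N) \<rho>" for S \<rho>
    by (simp add: corestrict_coact_def)
  then show ?thesis
    by (simp add: mtensor_def fixed_comodule_def Let_def extend_eq_with_coact *)
qed

context
  fixes M :: "('k, 'h, 'm) comod" and N :: "('k, 'h, 'n) comod"
  assumes V: "precomodule H M" "precomodule H N"
begin

lemma fixed_mtensor: "coaction_projection H (tens H M N) (cp M N)"
proof -
  have T: "precomodule H (tens H M N)" using V by (rule precomodule_tens)
  show ?thesis
    unfolding coaction_projection_def
    using T lin_counit_proj[OF T lin_ident(1)] counit_proj_idem[OF T] map_coact_counit_proj[OF T] by blast
qed

lemma carrier_mtensor: "carrier (mtensor H M N) = {t \<in> carrier (M \<otimes> N). cp M N t = t}"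
  unfolding mtensor_eq[OF V] carrier_fixed[OF fixed_mtensor] by simp

lemma mtensor_fixed: "t \<in> carrier (mtensor H M N) \<Longrightarrow> cp M N t = t"
  and mtensor_subset: "t \<in> carrier (mtensor H M N) \<Longrightarrow> t \<in> carrier (M \<otimes> N)"
  by (simp_all add: carrier_mtensor)

lemma cp_idem: "t \<in> carrier (M \<otimes> N) \<Longrightarrow> cp M N (cp M N t) = cp M N t"
  using counit_proj_idem[OF precomodule_tens[OF V]] by simp

lemma cp_mem_mtensor: "t \<in> carrier (M \<otimes> N) \<Longrightarrow> cp M N t \<in> carrier (mtensor H M N)"
  by (simp add: carrier_mtensor counit_proj_tens_mem cp_idem V)

lemma precomodule_mtensor [vs]: "precomodule H (mtensor H M N)"
  unfolding mtensor_eq[OF V] by (rule precomodule_fixed[OF fixed_mtensor])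

lemma colinear_mtensor_inclusion:
  "colinear H (mtensor H M N) (tens H M N) id" "colinear H (mtensor H M N) (tens H M N) (\<lambda>x. x)"
  unfolding mtensor_eq[OF V] by (rule colinear_inclusion_fixed[OF fixed_mtensor])+

lemma colinear_mtensor_proj: "colinear H (tens H M N) (mtensor H M N) (cp M N)"
  unfolding mtensor_eq[OF V]
  by (rule colinear_into_fixed[OF fixed_mtensor])
    (simp_all add: precomodule_tens V colinear_counit_proj cp_idem)

lemma colinear_into_mtensor:
  assumes "precomodule H P" "colinear H P (tens H M N) f"
    "\<And>x. x \<in> carrier P \<Longrightarrow> f x \<in> carrier (mtensor H M N)"
  shows "colinear H P (mtensor H M N) f"
  unfolding mtensor_eq[OF V]
  by (rule colinear_into_fixed[OF fixed_mtensor assms(1,2)]) (auto dest: mtensor_fixed assms(3))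

lemma lin_mtensor:
  "lin (mtensor H M N) (M \<otimes> N) id" "lin (mtensor H M N) (M \<otimes> N) (\<lambda>x. x)" "lin (M \<otimes> N) (mtensor H M N) (cp M N)"
  using colinear_mtensor_inclusion[THEN colinear_lin] colinear_mtensor_proj[THEN colinear_lin] by simp_all

lemma mtensor_retract:
  assumes "is_vspace K"
  shows "t \<in> carrier (mtensor H M N \<otimes> K) \<Longrightarrow>
      tensor_map (M \<otimes> N) K (mtensor H M N) K (cp M N) id (tensor_map (mtensor H M N) K (M \<otimes> N) K id id t) = t"
    and "t \<in> carrier ((M \<otimes> N) \<otimes> K) \<Longrightarrow>
      tensor_map (mtensor H M N) K (M \<otimes> N) K id id (tensor_map (M \<otimes> N) K (mtensor H M N) K (cp M N) id t) =
      tensor_map (M \<otimes> N) K (M \<otimes> N) K (cp M N) id t"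
  using retract_inclusion[OF fixed_mtensor assms] inclusion_retract[OF fixed_mtensor assms]
  unfolding mtensor_eq[OF V, symmetric] by simp_all

lemma mtensor_retract':
  assumes "is_vspace K"
  shows "t \<in> carrier (K \<otimes> mtensor H M N) \<Longrightarrow>
      tensor_map K (M \<otimes> N) K (mtensor H M N) id (cp M N) (tensor_map K (mtensor H M N) K (M \<otimes> N) id id t) = t"
    and "t \<in> carrier (K \<otimes> (M \<otimes> N)) \<Longrightarrow>
      tensor_map K (mtensor H M N) K (M \<otimes> N) id id (tensor_map K (M \<otimes> N) K (mtensor H M N) id (cp M N) t) =
      tensor_map K (M \<otimes> N) K (M \<otimes> N) id (cp M N) t"
proof -
  note [simp] = vs assms V lin_mtensor precomodule_mtensor
  show "tensor_map K (M \<otimes> N) K (mtensor H M N) id (cp M N) (tensor_map K (mtensor H M N) K (M \<otimes> N) id id t) = t"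
    if "t \<in> carrier (K \<otimes> mtensor H M N)"
  proof -
    have "tensor_map K (M \<otimes> N) K (mtensor H M N) id (cp M N) (tensor_map K (mtensor H M N) K (M \<otimes> N) id id t) =
        tensor_map K (mtensor H M N) K (mtensor H M N) (\<lambda>x. id (id x)) (\<lambda>x. cp M N (id x)) t"
      using that by (intro tensor_map_comp) simp_all
    also have "\<dots> = t"
      using that by (intro tensor_map_ident) (simp_all add: mtensor_fixed)
    finally show ?thesis .
  qed
  show "tensor_map K (mtensor H M N) K (M \<otimes> N) id id (tensor_map K (M \<otimes> N) K (mtensor H M N) id (cp M N) t) =
      tensor_map K (M \<otimes> N) K (M \<otimes> N) id (cp M N) t" if "t \<in> carrier (K \<otimes> (M \<otimes> N))"
    using that by (subst tensor_map_comp) (simp_all add: id_def)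
qed

end

text \<open>A tensor product of colinear maps is colinear for the diagonal coactions, hence commutes
  with the projections and preserves their fixed points. On these, \<open>mtensor_map\<close> may be
  replaced by \<open>tensor_map\<close>.\<close>

lemma colinear_mtensor_map:
  assumes V: "precomodule H M" "precomodule H N" "precomodule H M'" "precomodule H N'"
    and f: "colinear H M M' f" and g: "colinear H N N' g"
  shows "colinear H (mtensor H M N) (mtensor H M' N') (tensor_map M N M' N' f g)"
    and "t \<in> carrier (mtensor H M N) \<Longrightarrow> tensor_map M N M' N' f g t \<in> carrier (mtensor H M' N')"
    and "t \<in> carrier (mtensor H M N) \<Longrightarrow> mtensor_map H M N M' N' f g t = tensor_map M N M' N' f g t"
proof -
  note fg = colinear_tensor_map[OF V f g]
  note V' = V[THEN precomodule_vspace]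
  have l: "lin (M \<otimes> N) (M' \<otimes> N') (tensor_map M N M' N' f g)"
    by (rule lin_tensor_map[OF V' colinear_lin[OF f] colinear_lin[OF g]])
  show mem: "t \<in> carrier (mtensor H M N) \<Longrightarrow> tensor_map M N M' N' f g t \<in> carrier (mtensor H M' N')" for t
    using colinear_counit_proj_commute[OF precomodule_tens[OF V(1,2)] precomodule_tens[OF V(3,4)] fg, of t] lin_mem[OF l]
    by (simp add: carrier_mtensor V)
  show "colinear H (mtensor H M N) (mtensor H M' N') (tensor_map M N M' N' f g)"
    by (rule colinear_into_mtensor[OF V(3,4) precomodule_mtensor[OF V(1,2)]
      colinear_comp[OF precomodule_mtensor[OF V(1,2)] precomodule_tens[OF V(1,2)] precomodule_tens[OF V(3,4)]
         colinear_mtensor_inclusion(2)[OF V(1,2)] fg]]) (rule mem)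
  show "t \<in> carrier (mtensor H M N) \<Longrightarrow> mtensor_map H M N M' N' f g t = tensor_map M N M' N' f g t"
    by (simp add: mtensor_map_def)
qed

lemma colinear_ident: "precomodule H M \<Longrightarrow> colinear H M M id" "precomodule H M \<Longrightarrow> colinear H M M (\<lambda>x. x)"
  unfolding colinear_def using tensor_map_ident[of M H _ "id" id] tensor_map_ident[of M H _ "\<lambda>x. x" id]
  by (simp_all add: vs)

context
  fixes X :: "('k, 'h, 'x) comod" and Y :: "('k, 'h, 'y) comod" and Z :: "('k, 'h, 'z) comod"
  assumes XYZ: "precomodule H X" "precomodule H Y" "precomodule H Z"
begin

abbreviation (input) "XY \<equiv> mtensor H X Y"
abbreviation (input) "YZ \<equiv> mtensor H Y Z"
abbreviation (input) "incl_left \<equiv> tensor_map XY Z (X \<otimes> Y) Z id id"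
abbreviation (input) "incl_right \<equiv> tensor_map X YZ X (Y \<otimes> Z) id id"

lemmas precomodules = XYZ precomodule_tens[OF XYZ(1,2)] precomodule_tens[OF XYZ(2,3)]
  precomodule_mtensor[OF XYZ(1,2)] precomodule_mtensor[OF XYZ(2,3)]

lemma colinear_incl:
  shows "colinear H (tens H XY Z) (tens H (tens H X Y) Z) incl_left"
    and "colinear H (tens H X YZ) (tens H X (tens H Y Z)) incl_right"
    and "colinear H (tens H (tens H X Y) Z) (tens H XY Z) (tensor_map (X \<otimes> Y) Z XY Z (cp X Y) id)"
    and "colinear H (tens H X (tens H Y Z)) (tens H X YZ) (tensor_map X (Y \<otimes> Z) X YZ id (cp Y Z))"
  using colinear_tensor_map[OF precomodules(6,3,4,3) colinear_mtensor_inclusion(1)[OF XYZ(1,2)] colinear_ident(1)[OF XYZ(3)]]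
    colinear_tensor_map[OF precomodules(1,7,1,5) colinear_ident(1)[OF XYZ(1)] colinear_mtensor_inclusion(1)[OF XYZ(2,3)]]
    colinear_tensor_map[OF precomodules(4,3,6,3) colinear_mtensor_proj[OF XYZ(1,2)] colinear_ident(1)[OF XYZ(3)]]
    colinear_tensor_map[OF precomodules(1,5,1,7) colinear_ident(1)[OF XYZ(1)] colinear_mtensor_proj[OF XYZ(2,3)]]
  by (simp_all add: tens_def)

lemmas lin_incl = colinear_incl[THEN colinear_lin, simplified]
lemmas incl_mem = lin_incl[THEN lin_mem]

text \<open>Characterises the associator by its image in the full tensor power; it is used in this
  form only, and the choice made by \<open>inv_into\<close> disappears.\<close>

lemma massoc:
  assumes t: "t \<in> carrier (mtensor H XY Z)"
  shows "massoc H X Y Z t \<in> carrier (mtensor H X YZ)"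
    and "incl_right (massoc H X Y Z t) = assoc X Y Z (incl_left t)"
proof -
  note V [simp] = XYZ[THEN precomodule_vspace]
  let ?s = "assoc X Y Z (incl_left t)"
  \<comment> \<open>The witness that a preimage exists. Being fixed by the outer projection,
    \<open>?s\<close> is by \<open>counit_proj_absorb\<close> also fixed by the inner one, so
    projecting the last two factors loses nothing.\<close>
  let ?u = "tensor_map X (Y \<otimes> Z) X YZ id (cp Y Z) ?s"
  have t': "t \<in> carrier (XY \<otimes> Z)" "cp XY Z t = t"
    using t mtensor_subset[OF precomodules(6,3)] mtensor_fixed[OF precomodules(6,3)] by auto
  have i: "incl_left t \<in> carrier ((X \<otimes> Y) \<otimes> Z)"
    using incl_mem(1) t' by simp
  have s: "?s \<in> carrier (X \<otimes> (Y \<otimes> Z))"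
    using i by (simp add: assoc_mem)
  have "cp (tens H X Y) Z (incl_left t) = incl_left t"
    using colinear_counit_proj_commute[OF precomodule_tens[OF precomodules(6,3)] precomodule_tens[OF precomodules(4,3)] colinear_incl(1), of t] t' by simp
  then have fixed: "cp X (tens H Y Z) ?s = ?s"
    using colinear_counit_proj_commute[OF precomodule_tens[OF precomodules(4,3)] precomodule_tens[OF precomodules(1,5)] colinear_assoc(1)[OF XYZ], of "incl_left t"] i by simp
  have u: "?u \<in> carrier (X \<otimes> YZ)"
    using incl_mem(4) s by simp
  moreover have "cp X YZ ?u = ?u"
    using colinear_counit_proj_commute[OF precomodule_tens[OF precomodules(1,5)] precomodule_tens[OF precomodules(1,7)] colinear_incl(4), of ?s] s fixed by simp
  ultimately have u: "?u \<in> carrier (mtensor H X YZ)"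
    by (simp add: carrier_mtensor[OF precomodules(1,7)])
  have "tensor_map X (Y \<otimes> Z) X (Y \<otimes> Z) id (cp Y Z) ?s = ?s"
    using counit_proj_absorb(1)[OF precomodules(1,5), of ?s] fixed s by simp
  then have "incl_right ?u = ?s"
    using mtensor_retract'(2)[OF XYZ(2,3) V(1) s] by simp
  then have "?s \<in> incl_right ` carrier (mtensor H X YZ)"
    using u by (metis image_eqI)
  from inv_into_into[OF this] f_inv_into_f[OF this]
  show "massoc H X Y Z t \<in> carrier (mtensor H X YZ)"
    and "incl_right (massoc H X Y Z t) = assoc X Y Z (incl_left t)"
    using t by (simp_all add: massoc_def)
qed

lemma incl_right_inj:
  assumes "t \<in> carrier (mtensor H X YZ)" "t' \<in> carrier (mtensor H X YZ)" "incl_right t = incl_right t'"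
  shows "t = t'"
  using assms mtensor_retract'(1)[OF XYZ(2,3) precomodule_vspace[OF XYZ(1)]] mtensor_subset[OF precomodules(1,7)] by metis

text \<open>\<open>massoc_inv\<close> is a chosen preimage under \<open>massoc\<close>, so
  surjectivity comes first: \<open>?t\<close> retracts the rebracketed tensor, and injectivity of
  \<open>incl_right\<close> shows that \<open>massoc\<close> sends it to w. The image of the chosen
  preimage then follows by inverting the associator of vector spaces.\<close>

lemma massoc_inv:
  assumes w: "w \<in> carrier (mtensor H X YZ)"
  shows "massoc_inv H X Y Z w \<in> carrier (mtensor H XY Z)"
    and "incl_left (massoc_inv H X Y Z w) = assoc_inv X Y Z (incl_right w)"
proof -
  note V [simp] = XYZ[THEN precomodule_vspace]
  let ?s = "assoc_inv X Y Z (incl_right w)"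
  let ?t = "tensor_map (X \<otimes> Y) Z XY Z (cp X Y) id ?s"
  have w': "w \<in> carrier (X \<otimes> YZ)" "cp X YZ w = w"
    using w mtensor_subset[OF precomodules(1,7)] mtensor_fixed[OF precomodules(1,7)] by auto
  have i: "incl_right w \<in> carrier (X \<otimes> (Y \<otimes> Z))"
    using incl_mem(2) w' by simp
  have s: "?s \<in> carrier ((X \<otimes> Y) \<otimes> Z)"
    using i by (simp add: assoc_mem)
  have "cp X (tens H Y Z) (incl_right w) = incl_right w"
    using colinear_counit_proj_commute[OF precomodule_tens[OF precomodules(1,7)] precomodule_tens[OF precomodules(1,5)] colinear_incl(2), of w] w' by simp
  then have fixed: "cp (tens H X Y) Z ?s = ?s"
    using colinear_counit_proj_commute[OF precomodule_tens[OF precomodules(1,5)] precomodule_tens[OF precomodules(4,3)] colinear_assoc(2)[OF XYZ], of "incl_right w"] i by simp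
  have t: "?t \<in> carrier (XY \<otimes> Z)"
    using incl_mem(3) s by simp
  moreover have "cp XY Z ?t = ?t"
    using colinear_counit_proj_commute[OF precomodule_tens[OF precomodules(4,3)] precomodule_tens[OF precomodules(6,3)] colinear_incl(3), of ?s] s fixed by simp
  ultimately have t: "?t \<in> carrier (mtensor H XY Z)"
    by (simp add: carrier_mtensor[OF precomodules(6,3)])
  have "tensor_map (X \<otimes> Y) Z (X \<otimes> Y) Z (cp X Y) id ?s = ?s"
    using counit_proj_absorb(2)[OF precomodules(4,3), of ?s] fixed s by simp
  then have "incl_left ?t = ?s"
    using mtensor_retract(2)[OF XYZ(1,2) V(3) s] by simp
  then have "incl_right (massoc H X Y Z ?t) = incl_right w"
    using massoc(2)[OF t] assoc_inverse(2)[OF V i] by simp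
  then have "massoc H X Y Z ?t = w"
    using incl_right_inj[OF massoc(1)[OF t] w] by simp
  then have im: "w \<in> massoc H X Y Z ` carrier (mtensor H XY Z)"
    using t by blast
  let ?r = "massoc_inv H X Y Z w"
  show r: "?r \<in> carrier (mtensor H XY Z)"
    using inv_into_into[OF im] w by (simp add: massoc_inv_def)
  have "massoc H X Y Z ?r = w"
    using f_inv_into_f[OF im] w by (simp add: massoc_inv_def)
  then have "assoc X Y Z (incl_left ?r) = incl_right w"
    using massoc(2)[OF r] by simp
  moreover have "incl_left ?r \<in> carrier ((X \<otimes> Y) \<otimes> Z)"
    using incl_mem(1) mtensor_subset[OF precomodules(6,3) r] by simp
  ultimately show "incl_left ?r = ?s"
    using assoc_inverse(1)[OF V, of "incl_left ?r"] by simp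
qed

end


section \<open>The unit object\<close>

text \<open>The axiom on the iterated comultiplication of the unit, in Sweedler form. The map
  \<open>?L\<close> induced by T is evaluated at its three members, after both products in H
  \<otimes> H \<otimes> H have been written out as double sums.\<close>

lemma comult_one_triple:
  assumes W: "is_vspace W"
    and T: "\<And>m n. m \<in> carrier H \<Longrightarrow> n \<in> carrier H \<Longrightarrow> lin H W (\<lambda>p. T m n p)"
      "\<And>m p. m \<in> carrier H \<Longrightarrow> p \<in> carrier H \<Longrightarrow> lin H W (\<lambda>n. T m n p)"
      "\<And>n p. n \<in> carrier H \<Longrightarrow> p \<in> carrier H \<Longrightarrow> lin H W (\<lambda>m. T m n p)"
  shows "hsum W (one H) (\<lambda>p q. hsum W p (\<lambda>a b. T a b q)) =
      hsum W (one H) (\<lambda>a b. hsum W (one H) (\<lambda>c d. T a (mult H b c) d))"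
    and "hsum W (one H) (\<lambda>p q. hsum W p (\<lambda>a b. T a b q)) =
      hsum W (one H) (\<lambda>a b. hsum W (one H) (\<lambda>c d. T a (mult H c b) d))"
proof -
  note [simp] = vs W mult_laws(2,3) T T[THEN lin_comp[rotated]] lin_mem[OF T(1)]
  let ?D = "comult H (one H)" and ?K = "(H \<otimes> H) \<otimes> H"
  let ?D1 = "?D \<otimes>\<^bsub>H \<otimes> H, H\<^esub> one H" and ?oneD = "assoc_inv H H H (one H \<otimes>\<^bsub>H, H \<otimes> H\<^esub> ?D)"
  let ?m2 = "tensor_mult H (mult H) H (mult H)"
  let ?m3 = "tensor_mult (H \<otimes> H) ?m2 H (mult H)"
  let ?L = "tensor_lift (H \<otimes> H) H W (\<lambda>s d. tensor_lift H H W (\<lambda>a b. T a b d) s)"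
  have oneD: "?oneD = hsum ?K (one H) (\<lambda>c d. (one H \<otimes>\<^bsub>H,H\<^esub> c) \<otimes>\<^bsub>H \<otimes> H, H\<^esub> d)"
    by (rule lift_eqI[where f = "\<lambda>t. assoc_inv H H H (one H \<otimes>\<^bsub>H, H \<otimes> H\<^esub> t)"]) (simp_all add: assoc_pure)
  have m2: "t \<in> carrier (H \<otimes> H) \<Longrightarrow> lin (H \<otimes> H) (H \<otimes> H) (\<lambda>s. ?m2 s t)"
    "s \<in> carrier (H \<otimes> H) \<Longrightarrow> lin (H \<otimes> H) (H \<otimes> H) (\<lambda>t. ?m2 s t)" for s t
    unfolding tensor_mult_def by simp_all
  note [simp] = m2 lin_comp[OF _ m2(1)] lin_comp[OF _ m2(2)] lin_mem[OF m2(1)]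
  have "?m3 ?D1 ?oneD = hsum ?K (one H) (\<lambda>c d. ?m2 ?D (one H \<otimes>\<^bsub>H,H\<^esub> c) \<otimes>\<^bsub>H \<otimes> H, H\<^esub> d)"
    unfolding tensor_mult_def[of "H \<otimes> H"] oneD by (simp add: lift_pure push)
  also have "\<dots> = hsum ?K (one H) (\<lambda>c d. hsum ?K (one H) (\<lambda>a b. (a \<otimes>\<^bsub>H,H\<^esub> mult H b c) \<otimes>\<^bsub>H \<otimes> H, H\<^esub> d))"
    unfolding tensor_mult_def[of H] by (simp add: lift_pure push)
  finally have 1: "?m3 ?D1 ?oneD = \<dots>" .
  have "?m3 ?oneD ?D1 = hsum ?K (one H) (\<lambda>c d. ?m2 (one H \<otimes>\<^bsub>H,H\<^esub> c) ?D \<otimes>\<^bsub>H \<otimes> H, H\<^esub> d)"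
    unfolding tensor_mult_def[of "H \<otimes> H"] oneD by (simp add: lift_pure push)
  also have "\<dots> = hsum ?K (one H) (\<lambda>c d. hsum ?K (one H) (\<lambda>a b. (a \<otimes>\<^bsub>H,H\<^esub> mult H c b) \<otimes>\<^bsub>H \<otimes> H, H\<^esub> d))"
    unfolding tensor_mult_def[of H] by (simp add: lift_pure push)
  finally have 2: "?m3 ?oneD ?D1 = \<dots>" .
  have ax: "tensor_map H H (H \<otimes> H) H (comult H) id ?D = ?m3 ?D1 ?oneD" "?m3 ?D1 ?oneD = ?m3 ?oneD ?D1"
    using weak_bialgebra unfolding weak_bialgebra_def Let_def by blast+
  have "hsum W (one H) (\<lambda>p q. hsum W p (\<lambda>a b. T a b q)) = ?L (tensor_map H H (H \<otimes> H) H (comult H) id ?D)"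
    by (subst lift_tensor_map) simp_all
  also have "\<dots> = hsum W (one H) (\<lambda>c d. hsum W (one H) (\<lambda>a b. T a (mult H b c) d))"
    unfolding ax(1) 1 by (simp add: push lift_pure)
  also have "\<dots> = hsum W (one H) (\<lambda>a b. hsum W (one H) (\<lambda>c d. T a (mult H b c) d))"
    by (rule lift_swap) simp_all
  finally show "hsum W (one H) (\<lambda>p q. hsum W p (\<lambda>a b. T a b q)) = \<dots>" .
  have "hsum W (one H) (\<lambda>p q. hsum W p (\<lambda>a b. T a b q)) = ?L (tensor_map H H (H \<otimes> H) H (comult H) id ?D)"
    by (subst lift_tensor_map) simp_all
  also have "\<dots> = hsum W (one H) (\<lambda>c d. hsum W (one H) (\<lambda>a b. T a (mult H c b) d))"
    unfolding ax 2 by (simp add: push lift_pure)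
  also have "\<dots> = hsum W (one H) (\<lambda>a b. hsum W (one H) (\<lambda>c d. T a (mult H c b) d))"
    by (rule lift_swap) simp_all
  finally show "hsum W (one H) (\<lambda>p q. hsum W p (\<lambda>a b. T a b q)) = \<dots>" .
qed

lemma lin_eps [vs]:
  shows "lin V H g \<Longrightarrow> is_vspace V \<Longrightarrow> lin V H (\<lambda>x. eps_s H (g x))"
    and "lin V H g \<Longrightarrow> is_vspace V \<Longrightarrow> lin V H (\<lambda>x. eps_t H (g x))"
proof -
  have "lin H H (eps_s H)" "lin H H (eps_t H)"
    unfolding eps_s_def[abs_def] eps_t_def[abs_def] by (simp_all add: vs)
  then show "lin V H g \<Longrightarrow> is_vspace V \<Longrightarrow> lin V H (\<lambda>x. eps_s H (g x))"
    "lin V H g \<Longrightarrow> is_vspace V \<Longrightarrow> lin V H (\<lambda>x. eps_t H (g x))"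
    by (simp_all add: lin_comp[of V H g H "eps_s H"] lin_comp[of V H g H "eps_t H"])
qed

lemma eps_mem [vs]: "x \<in> carrier H \<Longrightarrow> eps_s H x \<in> carrier H" "x \<in> carrier H \<Longrightarrow> eps_t H x \<in> carrier H"
  unfolding eps_s_def eps_t_def by (simp_all add: vs)

text \<open>With z = \<open>eps_s H x\<close>, the comultiplication of z is
  \<open>\<Delta>(1\<^sub>1) \<epsilon>(x 1\<^sub>2)\<close>, and the two forms of the triple
  comultiplication of 1 extract a factor z on either side of the second leg. For
  \<open>eps_t\<close>, coassociativity first moves the comultiplication to the first leg. The last
  two facts place the legs of \<open>\<Delta>(1)\<close> in H_s and H_t: there the formula for the
  triple comultiplication is read backwards, and the counit falls on the middle leg.\<close>

lemma
  assumes W: "is_vspace W" and B: "bilin H H W B" and x: "x \<in> carrier H"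
  shows comult_eps_s: "hsum W (eps_s H x) B = hsum W (one H) (\<lambda>a b. B a (mult H b (eps_s H x)))"
      "hsum W (eps_s H x) B = hsum W (one H) (\<lambda>a b. B a (mult H (eps_s H x) b))"
    and comult_eps_t: "hsum W (eps_t H x) B = hsum W (one H) (\<lambda>a b. B (mult H (eps_t H x) a) b)"
      "hsum W (eps_t H x) B = hsum W (one H) (\<lambda>a b. B (mult H a (eps_t H x)) b)"
    and lift_one_eps_s: "hsum W (one H) (\<lambda>a b. B (eps_s H a) b) = hsum W (one H) B"
    and lift_one_eps_t: "hsum W (one H) (\<lambda>a b. B a (eps_t H b)) = hsum W (one H) B"
proof -
  have l: "b \<in> carrier H \<Longrightarrow> lin H W (\<lambda>a. B a b)" "a \<in> carrier H \<Longrightarrow> lin H W (\<lambda>b. B a b)" for a b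
    using B by (simp_all add: bilin_def)
  note [simp] = vs W x l l[THEN lin_comp[rotated]] lin_mem[OF l(1)] lin_scale_arg[OF l(1)] lin_scale_arg[OF l(2)]
  have pushB: "B a (tensor_lift H H H f t) = tensor_lift H H W (\<lambda>p q. B a (f p q)) t"
     "B (tensor_lift H H H f t) a = tensor_lift H H W (\<lambda>p q. B (f p q) a) t"
    if "a \<in> carrier H" "bilin H H H f" "t \<in> carrier (H \<otimes> H)" for a f t
    using that by (intro lift_push[where f = "B a"] lift_push[where f = "\<lambda>x. B x a"]; simp)+
  have s: "hsum W (eps_s H x) B = hsum W (one H) (\<lambda>p q. hsum W p (\<lambda>a b. scale W (counit H (mult H x q)) (B a b)))"
    unfolding eps_s_def by (simp add: push lin_scale_arg[OF lin_comult] lin_scale_arg[OF lin_tensor_lift])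
  also have "\<dots> = hsum W (one H) (\<lambda>a b. hsum W (one H) (\<lambda>c d. scale W (counit H (mult H x d)) (B a (mult H b c))))"
    by (rule comult_one_triple(1)) simp_all
  also have "\<dots> = hsum W (one H) (\<lambda>a b. B a (mult H b (eps_s H x)))"
    unfolding eps_s_def by (simp add: push pushB lin_scale_arg[OF lin_mult(2)[OF _ _ lin_ident(1)]])
  finally show "hsum W (eps_s H x) B = hsum W (one H) (\<lambda>a b. B a (mult H b (eps_s H x)))" .
  note s
  also have "hsum W (one H) (\<lambda>p q. hsum W p (\<lambda>a b. scale W (counit H (mult H x q)) (B a b))) =
      hsum W (one H) (\<lambda>a b. hsum W (one H) (\<lambda>c d. scale W (counit H (mult H x d)) (B a (mult H c b))))"
    by (rule comult_one_triple(2)) simp_all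
  also have "\<dots> = hsum W (one H) (\<lambda>a b. B a (mult H (eps_s H x) b))"
    unfolding eps_s_def by (simp add: push pushB lin_scale_arg[OF lin_mult(1)[OF _ _ lin_ident(1)]])
  finally show "hsum W (eps_s H x) B = hsum W (one H) (\<lambda>a b. B a (mult H (eps_s H x) b))" .
  have "hsum W (eps_t H x) B = hsum W (one H) (\<lambda>p q. hsum W q (\<lambda>b c. scale W (counit H (mult H p x)) (B b c)))"
    unfolding eps_t_def by (simp add: push lin_scale_arg[OF lin_comult] lin_scale_arg[OF lin_tensor_lift])
  also have "\<dots> = hsum W (one H) (\<lambda>p q. hsum W p (\<lambda>a b. scale W (counit H (mult H a x)) (B b q)))"
    by (rule comult_coassoc[symmetric]) simp_all
  finally have t: "hsum W (eps_t H x) B = \<dots>" .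
  also have "\<dots> = hsum W (one H) (\<lambda>a b. hsum W (one H) (\<lambda>c d. scale W (counit H (mult H a x)) (B (mult H b c) d)))"
    by (rule comult_one_triple(1)) simp_all
  also have "\<dots> = hsum W (one H) (\<lambda>c d. hsum W (one H) (\<lambda>a b. scale W (counit H (mult H a x)) (B (mult H b c) d)))"
    by (rule lift_swap) simp_all
  also have "\<dots> = hsum W (one H) (\<lambda>a b. B (mult H (eps_t H x) a) b)"
    unfolding eps_t_def by (simp add: push pushB lin_scale_arg[OF lin_mult(1)[OF _ _ lin_ident(1)]])
  finally show "hsum W (eps_t H x) B = hsum W (one H) (\<lambda>a b. B (mult H (eps_t H x) a) b)" .
  note t
  also have "hsum W (one H) (\<lambda>p q. hsum W p (\<lambda>a b. scale W (counit H (mult H a x)) (B b q))) =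
      hsum W (one H) (\<lambda>a b. hsum W (one H) (\<lambda>c d. scale W (counit H (mult H a x)) (B (mult H c b) d)))"
    by (rule comult_one_triple(2)) simp_all
  also have "\<dots> = hsum W (one H) (\<lambda>c d. hsum W (one H) (\<lambda>a b. scale W (counit H (mult H a x)) (B (mult H c b) d)))"
    by (rule lift_swap) simp_all
  also have "\<dots> = hsum W (one H) (\<lambda>a b. B (mult H a (eps_t H x)) b)"
    unfolding eps_t_def by (simp add: push pushB lin_scale_arg[OF lin_mult(2)[OF _ _ lin_ident(1)]])
  finally show "hsum W (eps_t H x) B = hsum W (one H) (\<lambda>a b. B (mult H a (eps_t H x)) b)" .
  have "hsum W (one H) (\<lambda>a b. B (eps_s H a) b) = 
      hsum W (one H) (\<lambda>a b. hsum W (one H) (\<lambda>c d. scale W (counit H (mult H a d)) (B c b)))"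
    unfolding eps_s_def by (simp add: pushB)
  also have "\<dots> = hsum W (one H) (\<lambda>c d. hsum W (one H) (\<lambda>a b. scale W (counit H (mult H a d)) (B c b)))"
    by (rule lift_swap) simp_all
  also have "\<dots> = hsum W (one H) (\<lambda>p q. hsum W p (\<lambda>a b. scale W (counit H b) (B a q)))"
    by (rule comult_one_triple(2)[symmetric]) simp_all
  also have "\<dots> = hsum W (one H) B"
    by (simp add: comult_counit)
  finally show "hsum W (one H) (\<lambda>a b. B (eps_s H a) b) = hsum W (one H) B" .
  have "hsum W (one H) (\<lambda>a b. B a (eps_t H b)) = 
      hsum W (one H) (\<lambda>a b. hsum W (one H) (\<lambda>c d. scale W (counit H (mult H c b)) (B a d)))"
    unfolding eps_t_def by (simp add: pushB)
  also have "\<dots> = hsum W (one H) (\<lambda>p q. hsum W p (\<lambda>a b. scale W (counit H b) (B a q)))"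
    by (rule comult_one_triple(2)[symmetric]) simp_all
  also have "\<dots> = hsum W (one H) B"
    by (simp add: comult_counit)
  finally show "hsum W (one H) (\<lambda>a b. B a (eps_t H b)) = hsum W (one H) B" .
qed

text \<open>For z = \<open>eps_s H x\<close>, the value
  \<open>1\<^sub>1 \<epsilon>(z 1\<^sub>2)\<close> is id \<otimes> \<epsilon> applied to the
  comultiplication of z, hence z.\<close>

lemma eps_s_idem: assumes x: "x \<in> carrier H" shows "eps_s H (eps_s H x) = eps_s H x"
  unfolding eps_s_def[of H "eps_s H x"]
  using comult_eps_s(2)[OF is_vspace_H _ x, of "\<lambda>a b. scale H (counit H b) a"]
    comult_counit(2)[of H "eps_s H x" "\<lambda>x. x"] x by (simp add: vs)

lemma eps_t_idem: assumes x: "x \<in> carrier H" shows "eps_t H (eps_t H x) = eps_t H x"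
  unfolding eps_t_def[of H "eps_t H x"]
  using comult_eps_t(2)[OF is_vspace_H _ x, of "\<lambda>a b. scale H (counit H a) b"]
    comult_counit(1)[of H "eps_t H x" "\<lambda>x. x"] x by (simp add: vs)

lemma eps_s_one: "eps_s H (one H) = one H"
proof -
  have "eps_s H (one H) = hsum H (one H) (\<lambda>p q. scale H (counit H q) p)"
    unfolding eps_s_def by (simp add: mult_laws)
  then show ?thesis
    using comult_counit(2)[of H "one H" "\<lambda>x. x"] by (simp add: vs)
qed

definition regular :: "('k, 'h, 'h) comod" where
  "regular = with_coact H (comult H)"

lemma precomodule_regular: "precomodule H regular"
  using coalgebra_H by (simp add: regular_def precomodule_def coalgebra_def)

text \<open>For z in H_s the comultiplication is \<open>1\<^sub>1 \<otimes> 1\<^sub>2 z\<close>, and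
  \<open>eps_s\<close> on its first leg changes nothing by \<open>lift_one_eps_s\<close>.\<close>

lemma eps_s_coaction_projection: "coaction_projection H regular (eps_s H)"
  unfolding coaction_projection_def
proof (intro conjI ballI impI precomodule_regular)
  show "lin regular regular (eps_s H)"
    using lin_eps(1)[OF lin_ident(1)] by (simp add: regular_def vs)
  fix t assume "t \<in> carrier regular"
  then have t: "t \<in> carrier H" by (simp add: regular_def)
  then show "eps_s H (eps_s H t) = eps_s H t"
    by (rule eps_s_idem)
  assume e: "eps_s H t = t"
  have "hsum (H \<otimes> H) (eps_s H t) (\<lambda>a b. eps_s H a \<otimes>\<^bsub>H,H\<^esub> b) = hsum (H \<otimes> H) (one H) (\<lambda>a b. eps_s H a \<otimes>\<^bsub>H,H\<^esub> mult H b (eps_s H t))"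
    using t by (intro comult_eps_s) (simp_all add: vs)
  also have "\<dots> = hsum (H \<otimes> H) (one H) (\<lambda>a b. a \<otimes>\<^bsub>H,H\<^esub> mult H b (eps_s H t))"
    using t by (intro lift_one_eps_s[where B = "\<lambda>a b. a \<otimes>\<^bsub>H,H\<^esub> mult H b (eps_s H t)"]) (simp_all add: vs)
  also have "\<dots> = hsum (H \<otimes> H) (eps_s H t) (\<lambda>a b. a \<otimes>\<^bsub>H,H\<^esub> b)"
    using t by (intro comult_eps_s(1)[symmetric]) (simp_all add: vs)
  finally show "tensor_map regular H regular H (eps_s H) id (coact regular t) = coact regular t"
    using e t by (simp add: regular_def tensor_map_def lift_tensor_elt vs)
qed

text \<open>Idempotence turns the image of \<open>eps_s\<close> into its set of fixed points, so the
  unit object falls under the same construction as the product.\<close>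

lemma munit_eq: "munit H = fixed_comodule H regular (eps_s H)"
proof -
  have "eps_s H ` carrier H = {x \<in> carrier H. eps_s H x = x}"
    using eps_s_idem eps_mem(1) by force
  then show ?thesis
    by (simp add: munit_def H_s_def fixed_comodule_def Let_def regular_def extend_eq_with_coact corestrict_coact_def)
qed

lemma carrier_munit: "carrier (munit H) = {x \<in> carrier H. eps_s H x = x}"
  unfolding munit_eq carrier_fixed[OF eps_s_coaction_projection] by (simp add: regular_def)

lemma munit_mem: "x \<in> carrier (munit H) \<Longrightarrow> x \<in> carrier H"
  and munit_fixed: "x \<in> carrier (munit H) \<Longrightarrow> eps_s H x = x"
  and one_munit [vs]: "one H \<in> carrier (munit H)"
  and eps_s_munit: "x \<in> carrier H \<Longrightarrow> eps_s H x \<in> carrier (munit H)"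
  by (simp_all add: carrier_munit eps_s_one eps_s_idem vs)

lemma precomodule_munit [vs]: "precomodule H (munit H)"
  unfolding munit_eq by (rule precomodule_fixed[OF eps_s_coaction_projection])

lemma colinear_munit_inclusion: "colinear H (munit H) regular id" "colinear H (munit H) regular (\<lambda>x. x)"
  unfolding munit_eq by (rule colinear_inclusion_fixed[OF eps_s_coaction_projection])+

lemma lin_munit: "lin (munit H) H id" "lin (munit H) H (\<lambda>x. x)" "lin H (munit H) (eps_s H)"
  using colinear_munit_inclusion[THEN colinear_lin] lin_fixed(2)[OF eps_s_coaction_projection]
  unfolding munit_eq[symmetric] by (simp_all add: regular_def)

lemma colinear_into_munit:
  assumes "precomodule H P" "colinear H P regular f" "\<And>x. x \<in> carrier P \<Longrightarrow> f x \<in> carrier (munit H)"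
  shows "colinear H P (munit H) f"
  unfolding munit_eq
  by (rule colinear_into_fixed[OF eps_s_coaction_projection assms(1,2)]) (auto dest: munit_fixed assms(3))

text \<open>Removes the chosen preimages from sums over the coaction of the unit object: they become
  sums over \<open>comult H\<close>.\<close>

lemma lift_coact_munit:
  assumes "is_vspace W" "bilin H H W B" "x \<in> carrier (munit H)"
  shows "tensor_lift (munit H) H W B (coact (munit H) x) = hsum W x B"
  using lift_coact_colinear[OF precomodule_munit precomodule_regular assms(1) _ colinear_munit_inclusion(2) assms(3), of B] assms(2)
  by (simp add: regular_def bilin_def)

lemma tensor_map_inclusion_inj:
  assumes V: "is_vspace S" "is_vspace T" "is_vspace K" and i: "lin S T (\<lambda>x. x)" and r: "lin T S r"
    and ri: "\<And>s. s \<in> carrier S \<Longrightarrow> r s = s"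
  shows "t \<in> carrier (S \<otimes> K) \<Longrightarrow> t' \<in> carrier (S \<otimes> K) \<Longrightarrow>
      tensor_map S K T K id id t = tensor_map S K T K id id t' \<Longrightarrow> t = t'"
    and "u \<in> carrier (K \<otimes> S) \<Longrightarrow> u' \<in> carrier (K \<otimes> S) \<Longrightarrow>
      tensor_map K S K T id id u = tensor_map K S K T id id u' \<Longrightarrow> u = u'"
proof -
  have i': "lin S T id" using i by (simp add: id_def)
  have 1: "tensor_map T K S K r id (tensor_map S K T K id id t) = t" if "t \<in> carrier (S \<otimes> K)" for t
  proof -
    have "tensor_map T K S K r id (tensor_map S K T K id id t) = tensor_map S K S K (\<lambda>x. r (id x)) (\<lambda>x. id (id x)) t"
      using that V i' r by (intro tensor_map_comp) (simp_all add: vs)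
    also have "\<dots> = t"
      using that V ri by (intro tensor_map_ident) simp_all
    finally show ?thesis .
  qed
  have 2: "tensor_map K T K S id r (tensor_map K S K T id id u) = u" if "u \<in> carrier (K \<otimes> S)" for u
  proof -
    have "tensor_map K T K S id r (tensor_map K S K T id id u) = tensor_map K S K S (\<lambda>x. id (id x)) (\<lambda>x. r (id x)) u"
      using that V i' r by (intro tensor_map_comp) (simp_all add: vs)
    also have "\<dots> = u"
      using that V ri by (intro tensor_map_ident) simp_all
    finally show ?thesis .
  qed
  show "t \<in> carrier (S \<otimes> K) \<Longrightarrow> t' \<in> carrier (S \<otimes> K) \<Longrightarrow>
      tensor_map S K T K id id t = tensor_map S K T K id id t' \<Longrightarrow> t = t'"
    using 1 by metis
  show "u \<in> carrier (K \<otimes> S) \<Longrightarrow> u' \<in> carrier (K \<otimes> S) \<Longrightarrow>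
      tensor_map K S K T id id u = tensor_map K S K T id id u' \<Longrightarrow> u = u'"
    using 2 by metis
qed

lemmas munit_inclusion_inj =
  tensor_map_inclusion_inj[OF precomodule_vspace[OF precomodule_munit] is_vspace_H _ lin_munit(2,3) munit_fixed]

end

section \<open>Comodule coalgebras\<close>

definition counit_in_comod ::
    "('k::field, 'h) bialg \<Rightarrow> ('k, 'h, 'v) comod \<Rightarrow> ('v \<Rightarrow> 'k) \<Rightarrow> 'v \<Rightarrow> 'h" where
  "counit_in_comod H C \<epsilon> = (\<lambda>c\<in>carrier C. tensor_lift C H H (\<lambda>c0 c1. scale H (\<epsilon> c0) c1) (coact C c))"

context weak_bialg
begin

lemma lift_diag_coact':
  assumes "precomodule H M" "precomodule H N" "is_vspace W" "bilin (M \<otimes> N) H W B" "t \<in> carrier (M \<otimes> N)"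
  shows "tensor_lift (M \<otimes> N) H W B (diag_coact H M N t) =
    tensor_lift M N W (\<lambda>m n. cosum M W m (\<lambda>m0 m1. cosum N W n (\<lambda>n0 n1. B (m0 \<otimes>\<^bsub>M,N\<^esub> n0) (mult H m1 n1)))) t"
proof -
  have l: "h \<in> carrier H \<Longrightarrow> lin (M \<otimes> N) W (\<lambda>s. B s h)" "s \<in> carrier (M \<otimes> N) \<Longrightarrow> lin H W (B s)" for s h
    using assms(4) by (simp_all add: bilin_def)
  note [simp] = vs assms l l[THEN lin_comp[rotated]] lin_mem[OF l(1)]
  show ?thesis
    by (rule lift_eqI[where f = "\<lambda>t. tensor_lift (M \<otimes> N) H W B (diag_coact H M N t)"])
      (simp_all add: lift_diag_coact)
qed

text \<open>Both sides of the restricted condition lie in the product of C with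
  \<open>mtensor H C C\<close>. The injection into C \<otimes> (C \<otimes> C) sends them to the two
  sides of ordinary coassociativity.\<close>

lemma mtensor_coassoc_iff:
  assumes C: "precomodule H C" and \<Delta>: "colinear H C (mtensor H C C) \<Delta>" and c: "c \<in> carrier C"
  shows "massoc H C C C (mtensor_map H C C (mtensor H C C) C \<Delta> id (\<Delta> c)) =
      mtensor_map H C C C (mtensor H C C) id \<Delta> (\<Delta> c) \<longleftrightarrow>
    assoc C C C (tensor_map C C (C \<otimes> C) C \<Delta> id (\<Delta> c)) = tensor_map C C C (C \<otimes> C) id \<Delta> (\<Delta> c)"
proof -
  let ?M = "mtensor H C C"
  note P = precomodule_mtensor[OF C C]
  note [simp] = vs C P colinear_lin[OF \<Delta>] lin_mtensor[OF C C]
  have d: "\<Delta> c \<in> carrier ?M" using c by (rule lin_mem[OF colinear_lin[OF \<Delta>]])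
  have d' [simp]: "\<Delta> c \<in> carrier (C \<otimes> C)" using mtensor_subset[OF C C d] .
  note L = colinear_mtensor_map[OF C C P C \<Delta> colinear_ident(1)[OF C]]
  note R = colinear_mtensor_map[OF C C C P colinear_ident(1)[OF C] \<Delta>]
  have 1: "tensor_map ?M C (C \<otimes> C) C id id (tensor_map C C ?M C \<Delta> id (\<Delta> c)) = tensor_map C C (C \<otimes> C) C \<Delta> id (\<Delta> c)"
    by (subst tensor_map_comp) (simp_all add: id_def)
  have 2: "tensor_map C ?M C (C \<otimes> C) id id (tensor_map C C C ?M id \<Delta> (\<Delta> c)) = tensor_map C C C (C \<otimes> C) id \<Delta> (\<Delta> c)"
    by (subst tensor_map_comp) (simp_all add: id_def)
  show ?thesis
    unfolding L(3)[OF d] R(3)[OF d]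
    using massoc[OF C C C L(2)[OF d]] incl_right_inj[OF C C C massoc(1)[OF C C C L(2)[OF d]] R(2)[OF d]]
    unfolding 1 using 2 by metis
qed

section \<open>From comodule coalgebras to coalgebras in the category of comodules\<close>

context
  fixes C :: "('k, 'h, 'v) comod" and \<Delta> \<epsilon>
  assumes cc: "comodule_coalgebra H C \<Delta> \<epsilon>"
begin

lemma C_comodule: "comodule H C"
  and C_coalgebra: "coalgebra C \<Delta> \<epsilon>"
  using cc by (simp_all add: comodule_coalgebra_def)

lemmas precomodule_C = comoduleD[OF C_comodule]

lemma lin_C [vs]: "lin C (C \<otimes> C) \<Delta>" "lin C ground \<epsilon>"
  using C_coalgebra by (simp_all add: coalgebra_def linear_maps_iff)

lemma comult_C_mem [vs]: "c \<in> carrier C \<Longrightarrow> \<Delta> c \<in> carrier (C \<otimes> C)"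
  by (rule lin_mem[OF lin_C(1)])

lemma colinear_comult: "colinear H C (tens H C C) \<Delta>"
  using lin_C cc by (simp add: colinear_def comodule_coalgebra_def)

lemma comult_C_mtensor: "c \<in> carrier C \<Longrightarrow> \<Delta> c \<in> carrier (mtensor H C C)"
  using colinear_counit_proj_commute[OF precomodule_C precomodule_tens[OF precomodule_C precomodule_C] colinear_comult, of c]
  by (simp add: carrier_mtensor[OF precomodule_C precomodule_C] comodule_counit_proj[OF C_comodule] vs)

lemma comult_homs: "\<Delta> \<in> comodule_homs H C (mtensor H C C)"
  unfolding comodule_homs_iff
  using colinear_into_mtensor[OF precomodule_C precomodule_C precomodule_C colinear_comult comult_C_mtensor] C_coalgebra
  by (simp add: coalgebra_def linear_maps_iff)

text \<open>The formula of \<open>counit_in_comod\<close> without the restriction to the carrier,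
  for use in linear calculations.\<close>

definition "zeta c = cosum C H c (\<lambda>c0 c1. scale H (\<epsilon> c0) c1)"

lemma lin_zeta: "lin C H zeta"
  unfolding zeta_def[abs_def] by (simp add: vs precomodule_C)

lemma zeta_munit:
  assumes c: "c \<in> carrier C" shows "zeta c \<in> carrier (munit H)"
proof -
  have "eps_s H (zeta c) = cosum C H c (\<lambda>c0 c1. eps_s H (scale H (\<epsilon> c0) c1))"
    unfolding zeta_def using c precomodule_C by (intro lift_push) (simp_all add: vs)
  also have "\<dots> = zeta c"
    using cc c by (simp add: lin_scale_arg[OF lin_eps(1)[OF lin_ident(1) is_vspace_H]] zeta_def comodule_coalgebra_def)
  finally show ?thesis
    using c lin_mem[OF lin_zeta c] by (simp add: carrier_munit)
qed

text \<open>By coassociativity \<open>\<epsilon>(c\<^sub>0) \<Delta>(c\<^sub>1)\<close> equals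
  \<open>\<epsilon>(c\<^sub>0) c\<^sub>1 \<otimes> c\<^sub>2\<close>, whose first leg is again a
  value of \<open>zeta\<close>.\<close>

lemma colinear_zeta: "colinear H C regular zeta"
proof -
  have "comult H (zeta c) = tensor_map C H H H zeta id (coact C c)" if c: "c \<in> carrier C" for c
  proof -
    note [simp] = vs precomodule_C c
    have "comult H (zeta c) = cosum C (H \<otimes> H) c (\<lambda>c0 c1. scale (H \<otimes> H) (\<epsilon> c0) (comult H c1))"
      unfolding zeta_def by (simp add: push lin_scale_arg[OF lin_comult])
    also have "\<dots> = cosum C (H \<otimes> H) c (\<lambda>c0 c1. hsum (H \<otimes> H) c1 (\<lambda>a b. scale (H \<otimes> H) (\<epsilon> c0) (a \<otimes>\<^bsub>H,H\<^esub> b)))"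
      by (simp add: push_scale[symmetric] lift_tensor_elt)
    also have "\<dots> = cosum C (H \<otimes> H) c (\<lambda>c0 c1. cosum C (H \<otimes> H) c0 (\<lambda>a b. scale (H \<otimes> H) (\<epsilon> a) (b \<otimes>\<^bsub>H,H\<^esub> c1)))"
      by (rule coact_coassoc[symmetric]) simp_all
    also have "\<dots> = cosum C (H \<otimes> H) c (\<lambda>c0 c1. zeta c0 \<otimes>\<^bsub>H,H\<^esub> c1)"
      unfolding zeta_def by (simp add: push scale_tensor_elt)
    finally show ?thesis by (simp add: tensor_map_def)
  qed
  then show ?thesis
    using lin_zeta by (simp add: colinear_def regular_def)
qed

lemma lift_comult_counit:
  assumes "is_vspace W" "lin C W f" "c \<in> carrier C"
  shows "tensor_lift C C W (\<lambda>a b. scale W (\<epsilon> a) (f b)) (\<Delta> c) = f c"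
    and "tensor_lift C C W (\<lambda>a b. scale W (\<epsilon> b) (f a)) (\<Delta> c) = f c"
proof -
  have *: "tensor_lift C C C (\<lambda>a b. scale C (\<epsilon> a) b) (\<Delta> c) = c"
    "tensor_lift C C C (\<lambda>a b. scale C (\<epsilon> b) a) (\<Delta> c) = c"
    using C_coalgebra assms by (simp_all add: coalgebra_def)
  note lift_push[of C C C W _ f "\<Delta> c"]
  from this[of "\<lambda>a b. scale C (\<epsilon> a) b"] this[of "\<lambda>a b. scale C (\<epsilon> b) a"]
  show "tensor_lift C C W (\<lambda>a b. scale W (\<epsilon> a) (f b)) (\<Delta> c) = f c"
    "tensor_lift C C W (\<lambda>a b. scale W (\<epsilon> b) (f a)) (\<Delta> c) = f c"
    using assms precomodule_C by (simp_all add: vs * lin_scale_arg[OF assms(2)])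
qed

lemma lift_coact_comult:
  assumes W: "is_vspace W" and F: "bilin (C \<otimes> C) H W F" and c: "c \<in> carrier C"
  shows "cosum C W c (\<lambda>c0 c1. F (\<Delta> c0) c1) =
    tensor_lift C C W (\<lambda>a b. cosum C W a (\<lambda>a0 a1. cosum C W b (\<lambda>b0 b1. F (a0 \<otimes>\<^bsub>C,C\<^esub> b0) (mult H a1 b1)))) (\<Delta> c)"
proof -
  have "cosum C W c (\<lambda>c0 c1. F (\<Delta> c0) c1) = tensor_lift (C \<otimes> C) H W F (tensor_map C H (C \<otimes> C) H \<Delta> id (coact C c))"
    using W F c precomodule_C by (subst lift_tensor_map) (simp_all add: vs)
  also have "\<dots> = tensor_lift (C \<otimes> C) H W F (diag_coact H C C (\<Delta> c))"
    using cc c by (simp add: comodule_coalgebra_def)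
  finally show ?thesis
    using W F c precomodule_C by (simp add: lift_diag_coact' vs)
qed

text \<open>The counit of C is inserted at \<open>c\<^sub>0\<close>, and then the comultiplication
  is exchanged with the coaction. The leg that meets the counit turns into a value of
  \<open>zeta\<close>, which stays behind as a factor in H.\<close>

lemma coact_via_comult:
  assumes W: "is_vspace W" and B: "bilin C H W B" and c: "c \<in> carrier C"
  shows "cosum C W c B =
      tensor_lift C C W (\<lambda>a b. cosum C W b (\<lambda>b0 b1. B b0 (mult H (zeta a) b1))) (\<Delta> c)"
    and "cosum C W c B =
      tensor_lift C C W (\<lambda>a b. cosum C W a (\<lambda>a0 a1. B a0 (mult H a1 (zeta b)))) (\<Delta> c)"
proof -
  have l: "b \<in> carrier H \<Longrightarrow> lin C W (\<lambda>a. B a b)" "a \<in> carrier C \<Longrightarrow> lin H W (\<lambda>b. B a b)" for a b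
    using B by (simp_all add: bilin_def)
  note [simp] = vs precomodule_C W c l l[THEN lin_comp[rotated]] lin_mem[OF l(1)]
  have pushB: "B a (tensor_lift C H H f t) = tensor_lift C H W (\<lambda>p q. B a (f p q)) t"
    if "a \<in> carrier C" "bilin C H H f" "t \<in> carrier (C \<otimes> H)" for a f t
    using that by (intro lift_push[where f = "B a"]; simp)
  have "cosum C W c B = cosum C W c (\<lambda>c0 c1. tensor_lift C C W (\<lambda>a b. scale W (\<epsilon> a) (B b c1)) (\<Delta> c0))"
    by (simp add: lift_comult_counit)
  also have "\<dots> = tensor_lift C C W (\<lambda>a b. cosum C W a (\<lambda>a0 a1. cosum C W b (\<lambda>b0 b1. scale W (\<epsilon> a0) (B b0 (mult H a1 b1))))) (\<Delta> c)"
    by (subst lift_coact_comult[where F = "\<lambda>s h. tensor_lift C C W (\<lambda>a b. scale W (\<epsilon> a) (B b h)) s"])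
      (simp_all add: lift_pure)
  also have "\<dots> = tensor_lift C C W (\<lambda>a b. cosum C W b (\<lambda>b0 b1. cosum C W a (\<lambda>a0 a1. scale W (\<epsilon> a0) (B b0 (mult H a1 b1))))) (\<Delta> c)"
    by (intro tensor_lift_cong refl lift_swap) simp_all
  also have "\<dots> = tensor_lift C C W (\<lambda>a b. cosum C W b (\<lambda>b0 b1. B b0 (mult H (zeta a) b1))) (\<Delta> c)"
    unfolding zeta_def by (simp add: push pushB lin_scale_arg[OF lin_mult(1)[OF _ _ lin_ident(1)]] lin_scale_arg[OF l(2)])
  finally show "cosum C W c B = \<dots>" .
  have "cosum C W c B = cosum C W c (\<lambda>c0 c1. tensor_lift C C W (\<lambda>a b. scale W (\<epsilon> b) (B a c1)) (\<Delta> c0))"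
    by (simp add: lift_comult_counit)
  also have "\<dots> = tensor_lift C C W (\<lambda>a b. cosum C W a (\<lambda>a0 a1. cosum C W b (\<lambda>b0 b1. scale W (\<epsilon> b0) (B a0 (mult H a1 b1))))) (\<Delta> c)"
    by (subst lift_coact_comult[where F = "\<lambda>s h. tensor_lift C C W (\<lambda>a b. scale W (\<epsilon> b) (B a h)) s"])
      (simp_all add: lift_pure)
  also have "\<dots> = tensor_lift C C W (\<lambda>a b. cosum C W a (\<lambda>a0 a1. B a0 (mult H a1 (zeta b)))) (\<Delta> c)"
    unfolding zeta_def by (simp add: push pushB lin_scale_arg[OF lin_mult(2)[OF _ _ lin_ident(1)]] lin_scale_arg[OF l(2)])
  finally show "cosum C W c B = \<dots>" .
qed

text \<open>Collecting the scalars, the left side is \<epsilon> applied to the projection of c, and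
  c is its own projection.\<close>

lemma zeta_counit:
  assumes c: "c \<in> carrier C" shows "counit H (zeta c) = \<epsilon> c"
proof -
  note [simp] = vs precomodule_C c
  have "counit H (zeta c) = cosum C ground c (\<lambda>c0 c1. \<epsilon> c0 * counit H c1)"
    unfolding zeta_def by (simp add: push lin_scale_arg[OF lin_counit])
  also have "\<dots> = cosum C ground c (\<lambda>c0 c1. \<epsilon> (scale C (counit H c1) c0))"
    by (simp add: lin_scale_arg[OF lin_C(2)] mult.commute)
  also have "\<dots> = \<epsilon> (counit_proj H C c)"
    unfolding counit_proj_def by (rule lift_push[symmetric]) simp_all
  finally show ?thesis
    by (simp add: comodule_counit_proj[OF C_comodule])
qed

lemma map_zeta_cp:
  assumes t: "t \<in> carrier (C \<otimes> C)"
  shows "tensor_map C C H C zeta id (cp C C t) =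
      tensor_lift C C (H \<otimes> C) (\<lambda>a b. cosum C (H \<otimes> C) a (\<lambda>a0 a1. cosum C (H \<otimes> C) b (\<lambda>b0 b1.
        scale (H \<otimes> C) (counit H (mult H a1 b1)) (zeta a0 \<otimes>\<^bsub>H,C\<^esub> b0)))) t"
    and "tensor_map C C C H id zeta (cp C C t) =
      tensor_lift C C (C \<otimes> H) (\<lambda>a b. cosum C (C \<otimes> H) a (\<lambda>a0 a1. cosum C (C \<otimes> H) b (\<lambda>b0 b1.
        scale (C \<otimes> H) (counit H (mult H a1 b1)) (a0 \<otimes>\<^bsub>C,H\<^esub> zeta b0)))) t"
proof -
  note [simp] = vs precomodule_C lin_zeta lin_mem[OF lin_zeta] lin_comp[OF _ lin_zeta] lin_counit_proj_tens[OF precomodule_C precomodule_C]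
    lin_comp[OF _ lin_counit_proj_tens[OF precomodule_C precomodule_C]]
  show "tensor_map C C H C zeta id (cp C C t) =
      tensor_lift C C (H \<otimes> C) (\<lambda>a b. cosum C (H \<otimes> C) a (\<lambda>a0 a1. cosum C (H \<otimes> C) b (\<lambda>b0 b1.
        scale (H \<otimes> C) (counit H (mult H a1 b1)) (zeta a0 \<otimes>\<^bsub>H,C\<^esub> b0)))) t"
    by (rule lift_eqI[where f = "\<lambda>t. tensor_map C C H C zeta id (cp C C t)", OF _ _ _ _ _ _ t])
      (simp_all add: counit_proj_tens_pure push tensor_map_pure lin_scale_arg[OF lin_tensor_map])
  show "tensor_map C C C H id zeta (cp C C t) =
      tensor_lift C C (C \<otimes> H) (\<lambda>a b. cosum C (C \<otimes> H) a (\<lambda>a0 a1. cosum C (C \<otimes> H) b (\<lambda>b0 b1.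
        scale (C \<otimes> H) (counit H (mult H a1 b1)) (a0 \<otimes>\<^bsub>C,H\<^esub> zeta b0)))) t"
    by (rule lift_eqI[where f = "\<lambda>t. tensor_map C C C H id zeta (cp C C t)", OF _ _ _ _ _ _ t])
      (simp_all add: counit_proj_tens_pure push tensor_map_pure lin_scale_arg[OF lin_tensor_map])
qed

lemma lift_coact_zeta:
  assumes "is_vspace W" "bilin H H W B" "a \<in> carrier C"
  shows "cosum C W a (\<lambda>a0 a1. B (zeta a0) a1) = hsum W (zeta a) B"
  using lift_coact_colinear[OF precomodule_C precomodule_regular assms(1) _ colinear_zeta assms(3), of B] assms(2)
  by (simp add: regular_def bilin_def)

text \<open>\<open>coact_via_comult\<close> puts a value of \<open>zeta\<close> next to the second
  leg of \<open>\<Delta>(1)\<close>. As that value lies in H_s, the product is its comultiplication;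
  colinearity of \<open>zeta\<close> turns this into a coaction on C, and what results is the
  projection of \<open>\<Delta> c\<close>, which is fixed. The left condition needs
  \<open>1\<^sub>1 \<otimes> 1\<^sub>2 z\<close>, the right one
  \<open>1\<^sub>1 \<otimes> z 1\<^sub>2\<close>.\<close>

lemma zeta_lunit:
  assumes c: "c \<in> carrier C"
  shows "cosum C (H \<otimes> C) c (\<lambda>c0 c1. hsum (H \<otimes> C) (one H) (\<lambda>p q.
      scale (H \<otimes> C) (counit H (mult H q c1)) (p \<otimes>\<^bsub>H,C\<^esub> c0))) = tensor_map C C H C zeta id (\<Delta> c)" (is "?l = _")
    and "cosum C (C \<otimes> H) c (\<lambda>c0 c1. hsum (C \<otimes> H) (one H) (\<lambda>p q.
      scale (C \<otimes> H) (counit H (mult H c1 q)) (c0 \<otimes>\<^bsub>C,H\<^esub> p))) = tensor_map C C C H id zeta (\<Delta> c)" (is "?r = _")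
proof -
  note [simp] = vs precomodule_C c lin_zeta lin_mem[OF lin_zeta] lin_comp[OF _ lin_zeta] mult_laws(1)
  have zz: "eps_s H (zeta a) = zeta a" if "a \<in> carrier C" for a
    using munit_fixed[OF zeta_munit[OF that]] .
  have D: "cp C C (\<Delta> c) = \<Delta> c" by (rule mtensor_fixed[OF precomodule_C precomodule_C comult_C_mtensor[OF c]])
  have "?l = tensor_lift C C (H \<otimes> C) (\<lambda>a b. cosum C (H \<otimes> C) b (\<lambda>b0 b1. hsum (H \<otimes> C) (one H) (\<lambda>p q.
      scale (H \<otimes> C) (counit H (mult H q (mult H (zeta a) b1))) (p \<otimes>\<^bsub>H,C\<^esub> b0)))) (\<Delta> c)"
    by (rule coact_via_comult(1)) simp_all
  also have "\<dots> = tensor_lift C C (H \<otimes> C) (\<lambda>a b. cosum C (H \<otimes> C) b (\<lambda>b0 b1. hsum (H \<otimes> C) (zeta a) (\<lambda>p q.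
      scale (H \<otimes> C) (counit H (mult H q b1)) (p \<otimes>\<^bsub>H,C\<^esub> b0)))) (\<Delta> c)"
  proof (rule tensor_lift_cong[OF refl refl refl refl], rule tensor_lift_cong[OF refl refl refl refl])
    fix a b b0 b1 assume [simp]: "a \<in> carrier C" "b0 \<in> carrier C" "b1 \<in> carrier H"
    show "hsum (H \<otimes> C) (one H) (\<lambda>p q. scale (H \<otimes> C) (counit H (mult H q (mult H (zeta a) b1))) (p \<otimes>\<^bsub>H,C\<^esub> b0)) =
      hsum (H \<otimes> C) (zeta a) (\<lambda>p q. scale (H \<otimes> C) (counit H (mult H q b1)) (p \<otimes>\<^bsub>H,C\<^esub> b0))"
      using comult_eps_s(1)[of "H \<otimes> C" "\<lambda>p q. scale (H \<otimes> C) (counit H (mult H q b1)) (p \<otimes>\<^bsub>H,C\<^esub> b0)" "zeta a"]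
      by (simp add: zz)
  qed
  also have "\<dots> = tensor_lift C C (H \<otimes> C) (\<lambda>a b. cosum C (H \<otimes> C) b (\<lambda>b0 b1. cosum C (H \<otimes> C) a (\<lambda>a0 a1.
      scale (H \<otimes> C) (counit H (mult H a1 b1)) (zeta a0 \<otimes>\<^bsub>H,C\<^esub> b0)))) (\<Delta> c)"
    by (intro tensor_lift_cong refl lift_coact_zeta[symmetric]) simp_all
  also have "\<dots> = tensor_lift C C (H \<otimes> C) (\<lambda>a b. cosum C (H \<otimes> C) a (\<lambda>a0 a1. cosum C (H \<otimes> C) b (\<lambda>b0 b1.
      scale (H \<otimes> C) (counit H (mult H a1 b1)) (zeta a0 \<otimes>\<^bsub>H,C\<^esub> b0)))) (\<Delta> c)"
    by (intro tensor_lift_cong refl lift_swap) simp_all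
  also have "\<dots> = tensor_map C C H C zeta id (\<Delta> c)"
    using map_zeta_cp(1)[of "\<Delta> c"] D by simp
  finally show "?l = tensor_map C C H C zeta id (\<Delta> c)" .
  have "?r = tensor_lift C C (C \<otimes> H) (\<lambda>a b. cosum C (C \<otimes> H) a (\<lambda>a0 a1. hsum (C \<otimes> H) (one H) (\<lambda>p q.
      scale (C \<otimes> H) (counit H (mult H (mult H a1 (zeta b)) q)) (a0 \<otimes>\<^bsub>C,H\<^esub> p)))) (\<Delta> c)"
    by (rule coact_via_comult(2)) simp_all
  also have "\<dots> = tensor_lift C C (C \<otimes> H) (\<lambda>a b. cosum C (C \<otimes> H) a (\<lambda>a0 a1. hsum (C \<otimes> H) (zeta b) (\<lambda>p q.
      scale (C \<otimes> H) (counit H (mult H a1 q)) (a0 \<otimes>\<^bsub>C,H\<^esub> p)))) (\<Delta> c)"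
  proof (rule tensor_lift_cong[OF refl refl refl refl], rule tensor_lift_cong[OF refl refl refl refl])
    fix b a0 a1 assume [simp]: "b \<in> carrier C" "a0 \<in> carrier C" "a1 \<in> carrier H"
    show "hsum (C \<otimes> H) (one H) (\<lambda>p q. scale (C \<otimes> H) (counit H (mult H (mult H a1 (zeta b)) q)) (a0 \<otimes>\<^bsub>C,H\<^esub> p)) =
      hsum (C \<otimes> H) (zeta b) (\<lambda>p q. scale (C \<otimes> H) (counit H (mult H a1 q)) (a0 \<otimes>\<^bsub>C,H\<^esub> p))"
      using comult_eps_s(2)[of "C \<otimes> H" "\<lambda>p q. scale (C \<otimes> H) (counit H (mult H a1 q)) (a0 \<otimes>\<^bsub>C,H\<^esub> p)" "zeta b"]
      by (simp add: zz)
  qed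
  also have "\<dots> = tensor_lift C C (C \<otimes> H) (\<lambda>a b. cosum C (C \<otimes> H) a (\<lambda>a0 a1. cosum C (C \<otimes> H) b (\<lambda>b0 b1.
      scale (C \<otimes> H) (counit H (mult H a1 b1)) (a0 \<otimes>\<^bsub>C,H\<^esub> zeta b0)))) (\<Delta> c)"
    by (intro tensor_lift_cong refl lift_coact_zeta[symmetric]) simp_all
  also have "\<dots> = tensor_map C C C H id zeta (\<Delta> c)"
    using map_zeta_cp(2)[of "\<Delta> c"] D by simp
  finally show "?r = tensor_map C C C H id zeta (\<Delta> c)" .
qed

end

text \<open>Both inverse unit isomorphisms start from the coaction of the unit object at 1.
  Including H_s in H replaces it by \<open>comult H (one H)\<close>, and swapping sums gives the
  shape of \<open>zeta_lunit\<close>.\<close>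

lemma unit_inv_inclusion:
  assumes M: "precomodule H M" and m: "m \<in> carrier M"
  shows "lunit_inv H M m \<in> carrier (munit H \<otimes> M)" "runit_inv H M m \<in> carrier (M \<otimes> munit H)"
    and "tensor_map (munit H) M H M id id (lunit_inv H M m) =
      cosum M (H \<otimes> M) m (\<lambda>m0 m1. hsum (H \<otimes> M) (one H) (\<lambda>p q.
        scale (H \<otimes> M) (counit H (mult H q m1)) (p \<otimes>\<^bsub>H,M\<^esub> m0)))"
    and "tensor_map M (munit H) M H id id (runit_inv H M m) =
      cosum M (M \<otimes> H) m (\<lambda>m0 m1. hsum (M \<otimes> H) (one H) (\<lambda>p q.
        scale (M \<otimes> H) (counit H (mult H m1 q)) (m0 \<otimes>\<^bsub>M,H\<^esub> p)))"
proof -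
  note [simp] = vs M m lin_munit munit_mem
  show "lunit_inv H M m \<in> carrier (munit H \<otimes> M)" "runit_inv H M m \<in> carrier (M \<otimes> munit H)"
    by (simp_all add: lunit_inv_def runit_inv_def)
  have "tensor_map (munit H) M H M id id (lunit_inv H M m) =
      tensor_lift (munit H) H (H \<otimes> M) (\<lambda>p q. cosum M (H \<otimes> M) m (\<lambda>m0 m1.
        scale (H \<otimes> M) (counit H (mult H q m1)) (p \<otimes>\<^bsub>H,M\<^esub> m0))) (coact (munit H) (one H))"
    by (simp add: lunit_inv_def push lin_scale_arg[OF lin_tensor_map] tensor_map_pure)
  also have "\<dots> = hsum (H \<otimes> M) (one H) (\<lambda>p q. cosum M (H \<otimes> M) m (\<lambda>m0 m1.
        scale (H \<otimes> M) (counit H (mult H q m1)) (p \<otimes>\<^bsub>H,M\<^esub> m0)))"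
    by (rule lift_coact_munit) simp_all
  also have "\<dots> = cosum M (H \<otimes> M) m (\<lambda>m0 m1. hsum (H \<otimes> M) (one H) (\<lambda>p q.
        scale (H \<otimes> M) (counit H (mult H q m1)) (p \<otimes>\<^bsub>H,M\<^esub> m0)))"
    by (rule lift_swap) simp_all
  finally show "tensor_map (munit H) M H M id id (lunit_inv H M m) = \<dots>" .
  have "tensor_map M (munit H) M H id id (runit_inv H M m) =
      tensor_lift (munit H) H (M \<otimes> H) (\<lambda>p q. cosum M (M \<otimes> H) m (\<lambda>m0 m1.
        scale (M \<otimes> H) (counit H (mult H m1 q)) (m0 \<otimes>\<^bsub>M,H\<^esub> p))) (coact (munit H) (one H))"
    by (simp add: runit_inv_def push lin_scale_arg[OF lin_tensor_map] tensor_map_pure)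
  also have "\<dots> = hsum (M \<otimes> H) (one H) (\<lambda>p q. cosum M (M \<otimes> H) m (\<lambda>m0 m1.
        scale (M \<otimes> H) (counit H (mult H m1 q)) (m0 \<otimes>\<^bsub>M,H\<^esub> p)))"
    by (rule lift_coact_munit) simp_all
  also have "\<dots> = cosum M (M \<otimes> H) m (\<lambda>m0 m1. hsum (M \<otimes> H) (one H) (\<lambda>p q.
        scale (M \<otimes> H) (counit H (mult H m1 q)) (m0 \<otimes>\<^bsub>M,H\<^esub> p)))"
    by (rule lift_swap) simp_all
  finally show "tensor_map M (munit H) M H id id (runit_inv H M m) = \<dots>" .
qed

text \<open>The counit conditions are equations in tensor products with H_s. They are compared after
  the split injections into H \<otimes> C and C \<otimes> H, where \<open>zeta_lunit\<close> and
  \<open>unit_inv_inclusion\<close> supply the two sides.\<close>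

lemma coalgebra_in_comod_if:
  assumes cc: "comodule_coalgebra H C \<Delta> \<epsilon>"
  shows "coalgebra_in_comod H C \<Delta> (counit_in_comod H C \<epsilon>)"
proof -
  note Cc = C_comodule[OF cc] and C = precomodule_C[OF cc]
  let ?z = "zeta C \<epsilon>"
  have e: "counit_in_comod H C \<epsilon> = restrict ?z (carrier C)"
    by (rule ext) (simp add: counit_in_comod_def zeta_def[OF cc] restrict_def)
  have ez: "counit_in_comod H C \<epsilon> c = ?z c" if "c \<in> carrier C" for c
    using that by (simp add: e)
  have z: "colinear H C (munit H) ?z"
    by (rule colinear_into_munit[OF C colinear_zeta[OF cc] zeta_munit[OF cc]])
  have z': "colinear H C (munit H) (counit_in_comod H C \<epsilon>)"
    by (rule colinear_cong[OF C z]) (simp add: ez)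
  have hom: "counit_in_comod H C \<epsilon> \<in> comodule_homs H C (munit H)"
    using z' by (simp add: comodule_homs_iff e)
  note idC = colinear_ident(1)[OF C]
  note [simp] = vs C lin_munit colinear_lin[OF z] lin_C[OF cc] comult_C_mem[OF cc] id_def[symmetric]
  have "mtensor_map H C C (munit H) C (counit_in_comod H C \<epsilon>) id (\<Delta> c) = lunit_inv H C c" if c: "c \<in> carrier C" for c
  proof (rule munit_inclusion_inj(1)[of C])
    have "mtensor_map H C C (munit H) C (counit_in_comod H C \<epsilon>) id (\<Delta> c) = tensor_map C C (munit H) C ?z id (\<Delta> c)"
      using colinear_mtensor_map(3)[OF C C precomodule_munit C z' idC comult_C_mtensor[OF cc c]]
      by (simp add: tensor_map_cong[of C "counit_in_comod H C \<epsilon>" ?z, OF ez])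
    then show "tensor_map (munit H) C H C id id (mtensor_map H C C (munit H) C (counit_in_comod H C \<epsilon>) id (\<Delta> c)) =
        tensor_map (munit H) C H C id id (lunit_inv H C c)"
      and "mtensor_map H C C (munit H) C (counit_in_comod H C \<epsilon>) id (\<Delta> c) \<in> carrier (munit H \<otimes> C)"
      using c zeta_lunit(1)[OF cc c] unit_inv_inclusion(3)[OF C c]
      by (simp_all add: tensor_map_comp)
  qed (use unit_inv_inclusion[OF C c] in simp_all)
  moreover have "mtensor_map H C C C (munit H) id (counit_in_comod H C \<epsilon>) (\<Delta> c) = runit_inv H C c" if c: "c \<in> carrier C" for c
  proof (rule munit_inclusion_inj(2)[of C])
    have "mtensor_map H C C C (munit H) id (counit_in_comod H C \<epsilon>) (\<Delta> c) = tensor_map C C C (munit H) id ?z (\<Delta> c)"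
      using colinear_mtensor_map(3)[OF C C C precomodule_munit idC z' comult_C_mtensor[OF cc c]]
      by (simp add: tensor_map_cong[of C id id C "counit_in_comod H C \<epsilon>" ?z, OF _ ez])
    then show "tensor_map C (munit H) C H id id (mtensor_map H C C C (munit H) id (counit_in_comod H C \<epsilon>) (\<Delta> c)) =
        tensor_map C (munit H) C H id id (runit_inv H C c)"
      and "mtensor_map H C C C (munit H) id (counit_in_comod H C \<epsilon>) (\<Delta> c) \<in> carrier (C \<otimes> munit H)"
      using c zeta_lunit(2)[OF cc c] unit_inv_inclusion(4)[OF C c]
      by (simp_all add: tensor_map_comp)
  qed (use unit_inv_inclusion[OF C c] in simp_all)
  ultimately show ?thesis
    using Cc comult_homs[OF cc] hom mtensor_coassoc_iff[OF C] C_coalgebra[OF cc]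
    unfolding coalgebra_in_comod_def by (simp add: comodule_homs_iff coalgebra_def)
qed

end

text \<open>Both isomorphisms of the theorem fix every morphism, so equality of hom sets, identities
  and compositions suffices. Quantifiers over the objects of \<D> become quantifiers over the
  objects of \<C>, and the category axioms carry over.\<close>

lemma isomorphic_categoriesI:
  assumes C: "category \<C>"
    and F: "\<And>X. X \<in> objs \<C> \<Longrightarrow> F X \<in> objs \<D>" "\<And>X. X \<in> objs \<C> \<Longrightarrow> G (F X) = X"
    and G: "\<And>Y. Y \<in> objs \<D> \<Longrightarrow> G Y \<in> objs \<C>" "\<And>Y. Y \<in> objs \<D> \<Longrightarrow> F (G Y) = Y"
    and homs: "\<And>X Y. X \<in> objs \<C> \<Longrightarrow> Y \<in> objs \<C> \<Longrightarrow> homs \<D> (F X) (F Y) = homs \<C> X Y"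
    and ident: "\<And>X. X \<in> objs \<C> \<Longrightarrow> ident \<D> (F X) = ident \<C> X"
    and comp: "\<And>X Y Z. X \<in> objs \<C> \<Longrightarrow> comp \<D> (F X) (F Y) (F Z) = comp \<C> X Y Z"
  shows "\<C> \<cong> \<D>"
proof -
  have ball: "(\<forall>Y\<in>objs \<D>. P Y) \<longleftrightarrow> (\<forall>X\<in>objs \<C>. P (F X))" for P
    using F(1) G by metis
  have D: "category \<D>"
    using C unfolding category_def ball by (simp add: homs ident comp)
  have 1: "is_functor \<C> \<D> F (\<lambda>X Y f. f)"
    by (simp add: is_functor_def F homs ident comp)
  have 2: "is_functor \<D> \<C> G (\<lambda>X Y f. f)"
    unfolding is_functor_def ball by (simp add: F homs ident comp)
  show ?thesis
    unfolding isomorphic_categories_def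
    using C D 1 2 F(2) G(2) by (intro conjI exI[of _ F] exI[of _ "\<lambda>X Y f. f"] exI[of _ G]) auto
qed

section \<open>The category of comodule coalgebras\<close>

context weak_bialg
begin

lemma comodule_homs_compose:
  assumes "precomodule H M" "precomodule H N" "precomodule H P"
    "f \<in> comodule_homs H M N" "g \<in> comodule_homs H N P"
  shows "compose (carrier M) g f \<in> comodule_homs H M P"
  using assms colinear_cong[OF assms(1) colinear_comp[OF assms(1-3)], of f g "compose (carrier M) g f"]
  by (simp add: comodule_homs_iff compose_eq)

lemma comodule_homs_ident: "precomodule H M \<Longrightarrow> (\<lambda>x\<in>carrier M. x) \<in> comodule_homs H M M"
  using colinear_cong[OF _ colinear_ident(2), of M "\<lambda>x\<in>carrier M. x"] by (simp add: comodule_homs_iff)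

lemma comodule_homs_mem: "f \<in> comodule_homs H M N \<Longrightarrow> x \<in> carrier M \<Longrightarrow> f x \<in> carrier N"
  using lin_mem[OF colinear_lin, of H M N f x] by (simp add: comodule_homs_iff)

lemma comodule_homs_linear_maps: "f \<in> comodule_homs H M N \<Longrightarrow> f \<in> linear_maps M N"
  by (simp add: comodule_homs_def)

lemma coalgebra_hom_compose:
  assumes C: "is_vspace C" "is_vspace C'" "is_vspace C''"
    and \<Delta>: "\<And>c. c \<in> carrier C \<Longrightarrow> \<Delta> c \<in> carrier (C \<otimes> C)"
    and f: "coalgebra_hom C \<Delta> \<epsilon> C' \<Delta>' \<epsilon>' f" and g: "coalgebra_hom C' \<Delta>' \<epsilon>' C'' \<Delta>'' \<epsilon>'' g"
  shows "coalgebra_hom C \<Delta> \<epsilon> C'' \<Delta>'' \<epsilon>'' (compose (carrier C) g f)"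
proof -
  have l: "lin C C' f" "lin C' C'' g"
    using f g by (simp_all add: coalgebra_hom_def linear_maps_iff)
  have eq: "compose (carrier C) g f c = g (f c)" if "c \<in> carrier C" for c
    using that by (simp add: compose_eq)
  have "lin C C'' (compose (carrier C) g f)"
    using lin_cong[of C "compose (carrier C) g f" "\<lambda>x. g (f x)" C''] lin_comp[OF l] eq C by simp
  then show ?thesis
    using f g l \<Delta> C
    by (simp add: coalgebra_hom_def linear_maps_iff eq lin_mem[OF l(1)] tensor_map_comp
        tensor_map_cong[of C "compose (carrier C) g f" "\<lambda>x. g (f x)" C "compose (carrier C) g f" "\<lambda>x. g (f x)", OF eq eq])
qed

lemma coalgebra_hom_ident:
  assumes "is_vspace C" "\<And>c. c \<in> carrier C \<Longrightarrow> \<Delta> c \<in> carrier (C \<otimes> C)"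
  shows "coalgebra_hom C \<Delta> \<epsilon> C \<Delta> \<epsilon> (\<lambda>x\<in>carrier C. x)"
proof -
  have "lin C C (\<lambda>x\<in>carrier C. x)"
    using lin_cong[of C "\<lambda>x\<in>carrier C. x" "\<lambda>x. x" C] lin_ident(1) assms by simp
  then show ?thesis
    using assms by (simp add: coalgebra_hom_def linear_maps_iff tensor_map_ident)
qed

lemma compose_restrict_ident:
  assumes "f \<in> comodule_homs H M N"
  shows "compose (carrier M) f (\<lambda>x\<in>carrier M. x) = f" "compose (carrier M) (\<lambda>x\<in>carrier N. x) f = f"
proof -
  have f: "f \<in> extensional (carrier M)" using assms by (simp add: comodule_homs_iff)
  show "compose (carrier M) f (\<lambda>x\<in>carrier M. x) = f" "compose (carrier M) (\<lambda>x\<in>carrier N. x) f = f"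
    using comodule_homs_mem[OF assms] by (auto intro!: extensionalityI[OF _ f] simp: compose_eq)
qed

lemma compose_assoc_homs:
  "f \<in> comodule_homs H M N \<Longrightarrow> compose (carrier M) h (compose (carrier M) g f) = compose (carrier M) (compose (carrier N) h g) f"
  by (rule compose_assoc) (auto dest: comodule_homs_mem)

lemma category_ComodCoalg: "category (ComodCoalg H :: (('k, 'h, 'v) coalg_obj, 'v \<Rightarrow> 'v) cat)"
proof -
  have *: "precomodule H C" "is_vspace C" "\<And>c. c \<in> carrier C \<Longrightarrow> \<Delta> c \<in> carrier (C \<otimes> C)"
    if "comodule_coalgebra H C \<Delta> \<epsilon>" for C :: "('k, 'h, 'v) comod" and \<Delta> \<epsilon>
    using precomodule_C[OF that] comult_C_mem[OF that] by (simp_all add: vs)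
  show ?thesis
    unfolding category_def ComodCoalg_def
    by (auto simp: * comodule_homs_ident coalgebra_hom_ident comodule_homs_compose[OF *(1) *(1) *(1)]
        compose_restrict_ident compose_assoc_homs intro: coalgebra_hom_compose[OF *(2) *(2) *(2) *(3)])
qed

section \<open>From coalgebras in the category of comodules to comodule coalgebras\<close>

context
  fixes C :: "('k, 'h, 'v) comod" and \<Delta> \<epsilon>
  assumes co: "coalgebra_in_comod H C \<Delta> \<epsilon>"
begin

lemma mC_comodule: "comodule H C"
  and mcomult_colinear: "colinear H C (mtensor H C C) \<Delta>"
  and mcounit_colinear: "colinear H C (munit H) \<epsilon>"
  and mcounit_extensional: "\<epsilon> \<in> extensional (carrier C)"
  and mcomult_extensional: "\<Delta> \<in> extensional (carrier C)"
  using co by (simp_all add: coalgebra_in_comod_def comodule_homs_iff)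

lemmas mC = comoduleD[OF mC_comodule]

lemma mcomult_mem: "c \<in> carrier C \<Longrightarrow> \<Delta> c \<in> carrier (mtensor H C C)" "c \<in> carrier C \<Longrightarrow> \<Delta> c \<in> carrier (C \<otimes> C)"
  using lin_mem[OF colinear_lin[OF mcomult_colinear]] mtensor_subset[OF mC mC] by auto

lemma mcomult_colinear': "colinear H C (tens H C C) \<Delta>"
  by (rule colinear_comp[OF mC precomodule_mtensor[OF mC mC] precomodule_tens[OF mC mC]
    mcomult_colinear colinear_mtensor_inclusion(2)[OF mC mC]])

lemma mcounit_colinear': "colinear H C regular \<epsilon>"
  by (rule colinear_comp[OF mC precomodule_munit precomodule_regular mcounit_colinear colinear_munit_inclusion(2)])

lemma lin_mcounit: "lin C H \<epsilon>" "lin C ground (\<lambda>c. counit H (\<epsilon> c))"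
  using colinear_lin[OF mcounit_colinear'] by (simp_all add: regular_def lin_counit_arg)

lemma mcounit_munit: "c \<in> carrier C \<Longrightarrow> \<epsilon> c \<in> carrier (munit H)"
  by (rule lin_mem[OF colinear_lin[OF mcounit_colinear]])

text \<open>As \<epsilon> intertwines the coaction of C with the comultiplication of H, the sum is
  the left counit law of H at \<open>\<epsilon> c\<close>.\<close>

lemma counit_mcounit:
  assumes c: "c \<in> carrier C"
  shows "cosum C H c (\<lambda>c0 c1. scale H (counit H (\<epsilon> c0)) c1) = \<epsilon> c"
proof -
  have "cosum C H c (\<lambda>c0 c1. scale H (counit H (\<epsilon> c0)) c1) = hsum H (\<epsilon> c) (\<lambda>a b. scale H (counit H a) b)"
    using lift_coact_colinear[OF mC precomodule_regular is_vspace_H _ mcounit_colinear' c, of "\<lambda>a b. scale H (counit H a) b"]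
    by (simp add: regular_def vs)
  also have "\<dots> = \<epsilon> c"
    using comult_counit(1)[of H "\<epsilon> c" "\<lambda>x. x"] lin_mem[OF lin_mcounit(1) c] by (simp add: vs)
  finally show ?thesis .
qed

text \<open>Applying \<open>counit H\<close> to the H-leg of the counit condition in the category
  leaves \<open>\<epsilon>(1\<^sub>1) \<epsilon>(1\<^sub>2 c\<^sub>1) c\<^sub>0\<close>, or its
  mirror image, which the counit laws of H and of the comodule contract to c.\<close>

lemma mcounit_laws:
  assumes c: "c \<in> carrier C"
  shows "tensor_lift C C C (\<lambda>c1 c2. scale C (counit H (\<epsilon> c1)) c2) (\<Delta> c) = c"
    and "tensor_lift C C C (\<lambda>c1 c2. scale C (counit H (\<epsilon> c2)) c1) (\<Delta> c) = c"
proof -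
  note [simp] = vs mC c lin_munit lin_mcounit lin_mem[OF lin_mcounit(1)] mcomult_mem(2) colinear_lin[OF mcounit_colinear]
    scale_scale mult_laws(2,3)
  have proj: "cosum C C c (\<lambda>c0 c1. scale C (counit H c1) c0) = c"
    using comodule_counit_proj[OF mC_comodule c] by (simp add: counit_proj_def)
  have l: "tensor_map C C (munit H) C \<epsilon> id (\<Delta> c) = lunit_inv H C c"
    "tensor_map C C C (munit H) id \<epsilon> (\<Delta> c) = runit_inv H C c"
    using co c by (simp_all add: coalgebra_in_comod_def
      colinear_mtensor_map(3)[OF mC mC precomodule_munit mC mcounit_colinear colinear_ident(1)[OF mC]]
      colinear_mtensor_map(3)[OF mC mC mC precomodule_munit colinear_ident(1)[OF mC] mcounit_colinear] mcomult_mem(1))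
  have "tensor_lift C C C (\<lambda>c1 c2. scale C (counit H (\<epsilon> c1)) c2) (\<Delta> c) =
    tensor_lift H C C (\<lambda>x m. scale C (counit H x) m) (tensor_map (munit H) C H C id id (tensor_map C C (munit H) C \<epsilon> id (\<Delta> c)))"
    by (simp add: tensor_map_comp lift_tensor_map)
  also have "\<dots> = cosum C C c (\<lambda>c0 c1. hsum C (one H) (\<lambda>p q. scale C (counit H p) (scale C (counit H (mult H q c1)) c0)))"
    unfolding l unit_inv_inclusion(3)[OF mC c] 
    by (simp add: push lift_pure lin_scale_arg[OF lin_tensor_lift] mult.commute)
  also have "\<dots> = cosum C C c (\<lambda>c0 c1. scale C (counit H c1) c0)"
  proof (rule tensor_lift_cong[OF refl refl refl refl])
    fix c0 c1 assume [simp]: "c0 \<in> carrier C" "c1 \<in> carrier H"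
    show "hsum C (one H) (\<lambda>p q. scale C (counit H p) (scale C (counit H (mult H q c1)) c0)) = scale C (counit H c1) c0"
      using comult_counit(1)[of C "one H" "\<lambda>q. scale C (counit H (mult H q c1)) c0"] by simp
  qed
  finally show "tensor_lift C C C (\<lambda>c1 c2. scale C (counit H (\<epsilon> c1)) c2) (\<Delta> c) = c"
    using proj by simp
  have "tensor_lift C C C (\<lambda>c1 c2. scale C (counit H (\<epsilon> c2)) c1) (\<Delta> c) =
    tensor_lift C H C (\<lambda>m x. scale C (counit H x) m) (tensor_map C (munit H) C H id id (tensor_map C C C (munit H) id \<epsilon> (\<Delta> c)))"
    by (simp add: tensor_map_comp lift_tensor_map)
  also have "\<dots> = cosum C C c (\<lambda>c0 c1. hsum C (one H) (\<lambda>p q. scale C (counit H p) (scale C (counit H (mult H c1 q)) c0)))"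
    unfolding l unit_inv_inclusion(4)[OF mC c] 
    by (simp add: push lift_pure lin_scale_arg[OF lin_tensor_lift] mult.commute)
  also have "\<dots> = cosum C C c (\<lambda>c0 c1. scale C (counit H c1) c0)"
  proof (rule tensor_lift_cong[OF refl refl refl refl])
    fix c0 c1 assume [simp]: "c0 \<in> carrier C" "c1 \<in> carrier H"
    show "hsum C (one H) (\<lambda>p q. scale C (counit H p) (scale C (counit H (mult H c1 q)) c0)) = scale C (counit H c1) c0"
      using comult_counit(1)[of C "one H" "\<lambda>q. scale C (counit H (mult H c1 q)) c0"] by simp
  qed
  finally show "tensor_lift C C C (\<lambda>c1 c2. scale C (counit H (\<epsilon> c2)) c1) (\<Delta> c) = c"
    using proj by simp
qed

lemma comodule_coalgebra_if: "comodule_coalgebra H C \<Delta> (\<lambda>c\<in>carrier C. counit H (\<epsilon> c))"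
proof -
  let ?e = "\<lambda>c\<in>carrier C. counit H (\<epsilon> c)"
  note [simp] = vs mC
  have lin: "\<Delta> \<in> linear_maps C (C \<otimes> C)" "?e \<in> linear_maps C ground"
    using colinear_lin[OF mcomult_colinear'] mcomult_extensional
      lin_cong[of C ?e "\<lambda>c. counit H (\<epsilon> c)" ground] lin_mcounit(2)
    by (simp_all add: linear_maps_iff)
  have "assoc C C C (tensor_map C C (C \<otimes> C) C \<Delta> id (\<Delta> c)) = tensor_map C C C (C \<otimes> C) id \<Delta> (\<Delta> c)"
    if "c \<in> carrier C" for c
    using co that mtensor_coassoc_iff[OF mC mcomult_colinear that] by (simp add: coalgebra_in_comod_def)
  then have coalg: "coalgebra C \<Delta> ?e"
    using lin mcounit_laws by (simp add: coalgebra_def)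
  \<comment> \<open>The second axiom of a comodule coalgebra: by linearity \<open>eps_s\<close> acts
    on the whole sum, which is \<open>\<epsilon> c\<close>, and it fixes H_s.\<close>
  have eps: "cosum C H c (\<lambda>c0 c1. scale H (counit H (\<epsilon> c0)) (eps_s H c1)) = \<epsilon> c" if c: "c \<in> carrier C" for c
  proof -
    have "cosum C H c (\<lambda>c0 c1. scale H (counit H (\<epsilon> c0)) (eps_s H c1)) =
      cosum C H c (\<lambda>c0 c1. eps_s H (scale H (counit H (\<epsilon> c0)) c1))"
      by (simp add: lin_scale_arg[OF lin_eps(1)[OF lin_ident(1) is_vspace_H]])
    also have "\<dots> = eps_s H (cosum C H c (\<lambda>c0 c1. scale H (counit H (\<epsilon> c0)) c1))"
      using c by (intro lift_push[symmetric]) (simp_all add: lin_mcounit)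
    also have "\<dots> = \<epsilon> c"
      using munit_fixed[OF mcounit_munit[OF c]] by (simp add: counit_mcounit[OF c])
    finally show ?thesis .
  qed
  show ?thesis
    using coalg mC_comodule colinear_coact[OF mcomult_colinear'] counit_mcounit eps
    by (simp add: comodule_coalgebra_def)
qed

lemma counit_in_comod_counit: "counit_in_comod H C (\<lambda>c\<in>carrier C. counit H (\<epsilon> c)) = \<epsilon>"
  by (rule extensionalityI[of _ "carrier C"])
    (simp_all add: counit_in_comod_def mcounit_extensional counit_mcounit)

end

lemma counit_counit_in_comod:
  assumes cc: "comodule_coalgebra H C \<Delta> \<epsilon>"
  shows "(\<lambda>c\<in>carrier C. counit H (counit_in_comod H C \<epsilon> c)) = \<epsilon>"
proof (rule extensionalityI[of _ "carrier C"])
  show "\<epsilon> \<in> extensional (carrier C)"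
    using cc by (simp add: comodule_coalgebra_def coalgebra_def linear_maps_iff)
  show "(\<lambda>c\<in>carrier C. counit H (counit_in_comod H C \<epsilon> c)) c = \<epsilon> c" if "c \<in> carrier C" for c
    using that zeta_counit[OF cc that] by (simp add: counit_in_comod_def zeta_def[OF cc])
qed simp

text \<open>The H-valued counit is computed from the scalar one and the coaction, and the scalar one
  is recovered through \<open>counit H\<close>. A colinear map respects both passages.\<close>

lemma coalgebra_hom_iff:
  assumes cc: "comodule_coalgebra H C \<Delta> \<epsilon>" and cc': "comodule_coalgebra H C' \<Delta>' \<epsilon>'"
    and f: "f \<in> comodule_homs H C C'"
  shows "coalgebra_hom C \<Delta> \<epsilon> C' \<Delta>' \<epsilon>' f \<longleftrightarrow>
    (\<forall>c\<in>carrier C. \<Delta>' (f c) = mtensor_map H C C C' C' f f (\<Delta> c) \<and>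
      counit_in_comod H C' \<epsilon>' (f c) = counit_in_comod H C \<epsilon> c)"
proof -
  note P = precomodule_C[OF cc] and P' = precomodule_C[OF cc']
  have f': "colinear H C C' f" using f by (simp add: comodule_homs_iff)
  have "(\<forall>c\<in>carrier C. \<epsilon>' (f c) = \<epsilon> c) \<longleftrightarrow>
      (\<forall>c\<in>carrier C. counit_in_comod H C' \<epsilon>' (f c) = counit_in_comod H C \<epsilon> c)" (is "?l \<longleftrightarrow> ?r")
  proof
    assume ?l
    then show ?r
      using comodule_homs_mem[OF f] lift_coact_colinear[OF P P' is_vspace_H _ f', of "\<lambda>c0 c1. scale H (\<epsilon>' c0) c1"]
      by (simp add: counit_in_comod_def vs lin_C[OF cc'] P')
  next
    assume r: ?r
    show ?l
    proof
      fix c assume c: "c \<in> carrier C"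
      have "counit H (counit_in_comod H C' \<epsilon>' (f c)) = counit H (counit_in_comod H C \<epsilon> c)"
        using r c by simp
      then show "\<epsilon>' (f c) = \<epsilon> c"
        using c comodule_homs_mem[OF f c] counit_counit_in_comod[OF cc] counit_counit_in_comod[OF cc']
        by (metis restrict_apply')
    qed
  qed
  then show ?thesis
    using comodule_homs_linear_maps[OF f] colinear_mtensor_map(3)[OF P P P' P' f' f'] comult_C_mtensor[OF cc]
    by (auto simp: coalgebra_hom_def)
qed

theorem ComodCoalg_iso:
  "(ComodCoalg H :: (('k, 'h, 'v) coalg_obj, 'v \<Rightarrow> 'v) cat) \<cong> (Coalg H :: (('k, 'h, 'v) mcoalg_obj, 'v \<Rightarrow> 'v) cat)"
  by (rule isomorphic_categoriesI[OF category_ComodCoalg,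
      where F = "\<lambda>(C, \<Delta>, \<epsilon>). (C, \<Delta>, counit_in_comod H C \<epsilon>)"
      and G = "\<lambda>(C, \<Delta>, \<epsilon>). (C, \<Delta>, \<lambda>c\<in>carrier C. counit H (\<epsilon> c))"])
    (auto simp: ComodCoalg_def Coalg_def coalgebra_in_comod_if counit_counit_in_comod comodule_coalgebra_if
      counit_in_comod_counit coalgebra_hom_iff)

end

section \<open>Comodule algebras\<close>

definition mult_in_comod ::
    "('k::field, 'h) bialg \<Rightarrow> ('k, 'h, 'v) comod \<Rightarrow> ('v \<Rightarrow> 'v \<Rightarrow> 'v) \<Rightarrow> ('k, 'v, 'v) tensor \<Rightarrow> 'v" where
  "mult_in_comod H A mul = restrict (tensor_lift A A A mul) (carrier (mtensor H A A))"

definition unit_in_comod ::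
    "('k::field, 'h) bialg \<Rightarrow> ('k, 'h, 'v) comod \<Rightarrow> 'v \<Rightarrow> 'h \<Rightarrow> 'v" where
  "unit_in_comod H A u = (\<lambda>x\<in>carrier (munit H).
    tensor_lift A H A (\<lambda>u0 u1. scale A (counit H (mult H x u1)) u0) (coact A u))"

definition mult_of_comod ::
    "('k::field, 'h) bialg \<Rightarrow> ('k, 'h, 'v) comod \<Rightarrow> (('k, 'v, 'v) tensor \<Rightarrow> 'v) \<Rightarrow> 'v \<Rightarrow> 'v \<Rightarrow> 'v" where
  "mult_of_comod H A m = (\<lambda>a\<in>carrier A. \<lambda>b\<in>carrier A. m (counit_proj H (tens H A A) (a \<otimes>\<^bsub>A,A\<^esub> b)))"

context weak_bialg
begin

section \<open>Multiplications on the full tensor square and their restrictions\<close>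

context
  fixes A :: "('k, 'h, 'v) comod" and \<mu> m :: "('k, 'v, 'v) tensor \<Rightarrow> 'v"
  assumes Acom: "comodule H A" and \<mu>: "colinear H (tens H A A) A \<mu>"
    and m: "\<And>t. t \<in> carrier (mtensor H A A) \<Longrightarrow> m t = \<mu> t"
begin

private lemma A: "precomodule H A"
  using Acom by (rule comoduleD)

lemmas AA_precomodules = A precomodule_mtensor[OF A A] precomodule_tens[OF A A]

lemma lin_mu: "lin (A \<otimes> A) A \<mu>"
  using colinear_lin[OF \<mu>] by simp

text \<open>Every vector of A is fixed by the projection of A, so a colinear \<mu> cannot tell a
  tensor from its projection. Hence \<mu> and its restriction m determine each other; one direction
  of the isomorphism starts from \<mu>, the other from m, with m \<circ> cp as \<mu>.\<close>

lemma mu_cp: "t \<in> carrier (A \<otimes> A) \<Longrightarrow> \<mu> (cp A A t) = \<mu> t"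
  using colinear_counit_proj_commute[OF AA_precomodules(3) A \<mu>, of t] lin_mem[OF lin_mu]
  by (simp add: comodule_counit_proj[OF Acom])

lemma colinear_m: "colinear H (mtensor H A A) A m"
  by (rule colinear_cong[OF AA_precomodules(2) colinear_comp[OF AA_precomodules(2,3,1)
     colinear_mtensor_inclusion(2)[OF A A] \<mu>]]) (simp add: m)

lemma mtensor_map_m:
  assumes "t \<in> carrier (mtensor H (mtensor H A A) A)"
  shows "mtensor_map H (mtensor H A A) A A A m id t =
    tensor_map (A \<otimes> A) A A A \<mu> id (tensor_map (mtensor H A A) A (A \<otimes> A) A id id t)"
proof -
  note [simp] = vs AA_precomodules lin_mu lin_mtensor[OF A A] mtensor_subset[OF AA_precomodules(2,1) assms]
  have "mtensor_map H (mtensor H A A) A A A m id t = tensor_map (mtensor H A A) A A A m id t"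
    by (rule colinear_mtensor_map(3)[OF AA_precomodules(2,1,1,1) colinear_m colinear_ident(1)[OF A] assms])
  also have "\<dots> = tensor_map (mtensor H A A) A A A (\<lambda>x. \<mu> (id x)) (\<lambda>x. id (id x)) t"
    by (rule tensor_map_cong) (simp_all add: m)
  also have "\<dots> = tensor_map (A \<otimes> A) A A A \<mu> id (tensor_map (mtensor H A A) A (A \<otimes> A) A id id t)"
    by (rule tensor_map_comp[symmetric]) simp_all
  finally show ?thesis .
qed

lemma mtensor_map_m':
  assumes "t \<in> carrier (mtensor H A (mtensor H A A))"
  shows "mtensor_map H A (mtensor H A A) A A id m t =
    tensor_map A (A \<otimes> A) A A id \<mu> (tensor_map A (mtensor H A A) A (A \<otimes> A) id id t)"
proof -
  note [simp] = vs AA_precomodules lin_mu lin_mtensor[OF A A] mtensor_subset[OF AA_precomodules(1,2) assms]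
  have "mtensor_map H A (mtensor H A A) A A id m t = tensor_map A (mtensor H A A) A A id m t"
    by (rule colinear_mtensor_map(3)[OF AA_precomodules(1,2,1,1) colinear_ident(1)[OF A] colinear_m assms])
  also have "\<dots> = tensor_map A (mtensor H A A) A A (\<lambda>x. id (id x)) (\<lambda>x. \<mu> (id x)) t"
    by (rule tensor_map_cong) (simp_all add: m)
  also have "\<dots> = tensor_map A (A \<otimes> A) A A id \<mu> (tensor_map A (mtensor H A A) A (A \<otimes> A) id id t)"
    by (rule tensor_map_comp[symmetric]) simp_all
  finally show ?thesis .
qed

lemma colinear_map_mu:
  shows "colinear H (tens H (tens H A A) A) (tens H A A) (tensor_map (A \<otimes> A) A A A \<mu> id)"
    and "colinear H (tens H A (tens H A A)) (tens H A A) (tensor_map A (A \<otimes> A) A A id \<mu>)"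
  using colinear_tensor_map[OF AA_precomodules(3,1,1,1) \<mu> colinear_ident(1)[OF A]]
    colinear_tensor_map[OF AA_precomodules(1,3,1,1) colinear_ident(1)[OF A] \<mu>] by simp_all

lemma map_mu_cp:
  shows "s \<in> carrier (A \<otimes> A \<otimes> A) \<Longrightarrow> tensor_map (A \<otimes> A) A A A \<mu> id (cp (tens H A A) A s) =
      cp A A (tensor_map (A \<otimes> A) A A A \<mu> id s)"
    and "t \<in> carrier (A \<otimes> (A \<otimes> A)) \<Longrightarrow> tensor_map A (A \<otimes> A) A A id \<mu> (cp A (tens H A A) t) =
      cp A A (tensor_map A (A \<otimes> A) A A id \<mu> t)"
  using colinear_counit_proj_commute[OF precomodule_tens[OF AA_precomodules(3,1)] AA_precomodules(3) colinear_map_mu(1), of s]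
    colinear_counit_proj_commute[OF precomodule_tens[OF AA_precomodules(1,3)] AA_precomodules(3) colinear_map_mu(2), of t]
  by simp_all

lemma lin_map_mu:
  shows "lin (A \<otimes> A \<otimes> A) (A \<otimes> A) (tensor_map (A \<otimes> A) A A A \<mu> id)"
    and "lin (A \<otimes> (A \<otimes> A)) (A \<otimes> A) (tensor_map A (A \<otimes> A) A A id \<mu>)"
  using colinear_map_mu[THEN colinear_lin] by simp_all

text \<open>On the restricted triple product the two conditions agree through the injection. A
  general s is replaced by its projection, which comes from the restricted product; both composites
  end in an outer \<mu>, which absorbs the projection.\<close>

lemma mtensor_mult_assoc_iff:
  "(\<forall>t\<in>carrier (mtensor H (mtensor H A A) A).
      m (mtensor_map H (mtensor H A A) A A A m id t) =
      m (mtensor_map H A (mtensor H A A) A A id m (massoc H A A A t))) \<longleftrightarrow>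
   (\<forall>s\<in>carrier (A \<otimes> A \<otimes> A). \<mu> (tensor_map (A \<otimes> A) A A A \<mu> id s) = \<mu> (tensor_map A (A \<otimes> A) A A id \<mu> (assoc A A A s)))"
  (is "?l \<longleftrightarrow> ?r")
proof -
  let ?i = "tensor_map (mtensor H A A) A (A \<otimes> A) A id id"
  let ?E = "\<lambda>s. \<mu> (tensor_map (A \<otimes> A) A A A \<mu> id s) = \<mu> (tensor_map A (A \<otimes> A) A A id \<mu> (assoc A A A s))"
  note [simp] = AA_precomodules vs lin_map_mu lin_map_mu[THEN lin_mem] lin_mtensor[OF A A] lin_assoc
  have eq: "(m (mtensor_map H (mtensor H A A) A A A m id t) =
      m (mtensor_map H A (mtensor H A A) A A id m (massoc H A A A t))) \<longleftrightarrow> ?E (?i t)"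
    if t: "t \<in> carrier (mtensor H (mtensor H A A) A)" for t
  proof -
    note a = massoc[OF A A A t]
    have "mtensor_map H (mtensor H A A) A A A m id t \<in> carrier (mtensor H A A)"
      "mtensor_map H A (mtensor H A A) A A id m (massoc H A A A t) \<in> carrier (mtensor H A A)"
      using colinear_mtensor_map(2,3)[OF AA_precomodules(2,1,1,1) colinear_m colinear_ident(1)[OF A] t]
        colinear_mtensor_map(2,3)[OF AA_precomodules(1,2,1,1) colinear_ident(1)[OF A] colinear_m a(1)] by simp_all
    then show ?thesis
      using mtensor_map_m[OF t] mtensor_map_m'[OF a(1)] a(2) by (simp add: m)
  qed
  have "?E s" if l: ?l and s: "s \<in> carrier (A \<otimes> A \<otimes> A)" for s
  proof -
    \<comment> \<open>A preimage, in the restricted triple product, of the projection of s: first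
      the leading two factors are projected, then the whole.\<close>
    let ?t = "cp (mtensor H A A) A (tensor_map (A \<otimes> A) A (mtensor H A A) A (cp A A) id s)"
    have t0: "tensor_map (A \<otimes> A) A (mtensor H A A) A (cp A A) id s \<in> carrier (mtensor H A A \<otimes> A)"
      using s by simp
    then have "?t \<in> carrier (mtensor H (mtensor H A A) A)"
      by (simp add: cp_mem_mtensor)
    then have "?E (?i ?t)"
      using l eq by blast
    moreover have "?i ?t = cp (tens H A A) A s"
    proof -
      have "?i ?t = cp (tens H A A) A (?i (tensor_map (A \<otimes> A) A (mtensor H A A) A (cp A A) id s))"
        using colinear_counit_proj_commute[OF precomodule_tens[OF AA_precomodules(2,1)] precomodule_tens[OF AA_precomodules(3,1)]
          colinear_incl(1)[OF A A A]] t0 by simp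
      also have "\<dots> = cp (tens H A A) A (tensor_map (A \<otimes> A) A (A \<otimes> A) A (cp A A) id s)"
        using s by (simp add: mtensor_retract(2)[OF A A])
      also have "\<dots> = tensor_map (A \<otimes> A) A (A \<otimes> A) A (cp A A) id (cp (tens H A A) A s)"
        using colinear_counit_proj_commute[OF precomodule_tens[OF AA_precomodules(3,1)] precomodule_tens[OF AA_precomodules(3,1)]
          colinear_tensor_map[OF AA_precomodules(3,1,3,1) colinear_counit_proj[OF AA_precomodules(3)] colinear_ident(1)[OF A]], of s] s
        by simp
      also have "\<dots> = cp (tens H A A) A s"
        using counit_proj_absorb(2)[OF AA_precomodules(3,1), of s] s by simp
      finally show ?thesis .
    qed
    moreover have "assoc A A A (cp (tens H A A) A s) = cp A (tens H A A) (assoc A A A s)"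
      using colinear_counit_proj_commute[OF precomodule_tens[OF AA_precomodules(3,1)] precomodule_tens[OF AA_precomodules(1,3)]
          colinear_assoc(1)[OF A A A], of s] s by simp
    ultimately show ?thesis
      using s by (simp add: map_mu_cp mu_cp)
  qed
  moreover have "?l" if r: ?r
  proof
    fix t assume t: "t \<in> carrier (mtensor H (mtensor H A A) A)"
    have "?i t \<in> carrier (A \<otimes> A \<otimes> A)"
      using mtensor_subset[OF AA_precomodules(2,1) t] by simp
    then show "m (mtensor_map H (mtensor H A A) A A A m id t) =
      m (mtensor_map H A (mtensor H A A) A A id m (massoc H A A A t))"
      using r eq[OF t] by simp
  qed
  ultimately show ?thesis by blast
qed

text \<open>On fixed tensors the injections identify both versions. The composites take values in A
  \<otimes> A without an outer \<mu>, so the passage to arbitrary tensors cannot absorb a projection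
  at the end and relies on \<open>counit_proj_triple\<close> and its mirror image.\<close>

lemma mtensor_frobenius_iff:
  assumes \<Delta>: "colinear H A (mtensor H A A) \<Delta>"
  shows "(\<forall>t\<in>carrier (mtensor H A A).
      mtensor_map H (mtensor H A A) A A A m id
        (massoc_inv H A A A (mtensor_map H A A A (mtensor H A A) id \<Delta> t)) = \<Delta> (m t) \<and>
      \<Delta> (m t) =
        mtensor_map H A (mtensor H A A) A A id m
          (massoc H A A A (mtensor_map H A A (mtensor H A A) A \<Delta> id t))) \<longleftrightarrow>
    (\<forall>t\<in>carrier (A \<otimes> A).
        tensor_map (A \<otimes> A) A A A \<mu> id (assoc_inv A A A (tensor_map A A A (A \<otimes> A) id \<Delta> t)) = \<Delta> (\<mu> t) \<and>
        \<Delta> (\<mu> t) = tensor_map A (A \<otimes> A) A A id \<mu> (assoc A A A (tensor_map A A (A \<otimes> A) A \<Delta> id t)))"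
    (is "(\<forall>t\<in>_. ?P t \<and> ?Q t) \<longleftrightarrow> (\<forall>t\<in>_. ?E t \<and> ?F t)")
proof -
  have \<Delta>': "colinear H A (tens H A A) \<Delta>"
    by (rule colinear_comp[OF AA_precomodules \<Delta> colinear_mtensor_inclusion(2)[OF A A]])
  have l\<Delta>: "lin A (A \<otimes> A) \<Delta>" "lin A (mtensor H A A) \<Delta>"
    using colinear_lin[OF \<Delta>'] colinear_lin[OF \<Delta>] by simp_all
  note [simp] = AA_precomodules vs l\<Delta> lin_map_mu lin_map_mu[THEN lin_mem] lin_mtensor[OF A A] lin_assoc lin_mu
    lin_counit_proj_tens
  have P: "?P t \<longleftrightarrow> ?E t" and Q: "?Q t \<longleftrightarrow> ?F t" if t: "t \<in> carrier (mtensor H A A)" for t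
  proof -
    note t' [simp] = mtensor_subset[OF A A t]
    note r = colinear_mtensor_map(2,3)[OF AA_precomodules(1,1,1,2) colinear_ident(1)[OF A] \<Delta> t]
    note l = colinear_mtensor_map(2,3)[OF AA_precomodules(1,1,2,1) \<Delta> colinear_ident(1)[OF A] t]
    have ir: "tensor_map A (mtensor H A A) A (A \<otimes> A) id id (tensor_map A A A (mtensor H A A) id \<Delta> t) =
        tensor_map A A A (A \<otimes> A) id \<Delta> t"
      by (subst tensor_map_comp) (simp_all add: id_def)
    have il: "tensor_map (mtensor H A A) A (A \<otimes> A) A id id (tensor_map A A (mtensor H A A) A \<Delta> id t) =
        tensor_map A A (A \<otimes> A) A \<Delta> id t"
      by (subst tensor_map_comp) (simp_all add: id_def)
    show "?P t \<longleftrightarrow> ?E t"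
      using r massoc_inv[OF A A A r(1)] mtensor_map_m[OF massoc_inv(1)[OF A A A r(1)]] ir by (simp add: m t)
    show "?Q t \<longleftrightarrow> ?F t"
      using l massoc[OF A A A l(1)] mtensor_map_m'[OF massoc(1)[OF A A A l(1)]] il by (simp add: m t)
  qed
  have cp\<Delta>: "cp A A (\<Delta> a) = \<Delta> a" if "a \<in> carrier A" for a
    using mtensor_fixed[OF A A lin_mem[OF l\<Delta>(2) that]] .
  \<comment> \<open>With \<open>?v\<close> the tensor t after id \<otimes> \<Delta>, projecting t
    projects \<open>?v\<close> as a triple product. The triple projection splits into two adjacent
    ones; the values of \<Delta> are fixed by the one, and \<mu> absorbs the other.\<close>
  have E: "?E t" if c: "?E (cp A A t)" and t [simp]: "t \<in> carrier (A \<otimes> A)" for t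
  proof -
    let ?v = "tensor_map A A A (A \<otimes> A) id \<Delta> t"
    have v [simp]: "?v \<in> carrier (A \<otimes> (A \<otimes> A))" by simp
    have v1: "tensor_map A (A \<otimes> A) A (A \<otimes> A) id (cp A A) ?v = ?v"
      by (subst tensor_map_comp) (simp_all, rule tensor_map_cong, simp_all add: cp\<Delta>)
    have "tensor_map A A A (A \<otimes> A) id \<Delta> (cp A A t) = cp A (tens H A A) ?v"
      using colinear_counit_proj_commute[OF AA_precomodules(3) precomodule_tens[OF AA_precomodules(1,3)]
        colinear_tensor_map[OF AA_precomodules(1,1,1,3) colinear_ident(1)[OF A] \<Delta>'], of t] by simp
    then have "assoc_inv A A A (tensor_map A A A (A \<otimes> A) id \<Delta> (cp A A t)) = cp (tens H A A) A (assoc_inv A A A ?v)"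
      (is "?a = _")
      using colinear_counit_proj_commute[OF precomodule_tens[OF AA_precomodules(1,3)] precomodule_tens[OF AA_precomodules(3,1)]
          colinear_assoc(2)[OF A A A], of ?v] by simp
    also have "\<dots> = tensor_map (A \<otimes> A) A (A \<otimes> A) A (cp A A) id (assoc_inv A A A ?v)"
      using counit_proj_triple[OF A A A v] v1 by simp
    finally have e: "?a = \<dots>" .
    have "tensor_map (A \<otimes> A) A A A \<mu> id ?a = tensor_map (A \<otimes> A) A A A \<mu> id (assoc_inv A A A ?v)"
      unfolding e by (subst tensor_map_comp) (simp_all, rule tensor_map_cong, simp_all add: mu_cp)
    then show ?thesis
      using c unfolding mu_cp[OF t] by argo
  qed
  have F: "?F t" if c: "?F (cp A A t)" and t [simp]: "t \<in> carrier (A \<otimes> A)" for t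
  proof -
    let ?v = "tensor_map A A (A \<otimes> A) A \<Delta> id t"
    have v [simp]: "?v \<in> carrier ((A \<otimes> A) \<otimes> A)" by simp
    have v1: "tensor_map (A \<otimes> A) A (A \<otimes> A) A (cp A A) id ?v = ?v"
      by (subst tensor_map_comp) (simp_all, rule tensor_map_cong, simp_all add: cp\<Delta>)
    have "tensor_map A A (A \<otimes> A) A \<Delta> id (cp A A t) = cp (tens H A A) A ?v"
      using colinear_counit_proj_commute[OF AA_precomodules(3) precomodule_tens[OF AA_precomodules(3,1)]
        colinear_tensor_map[OF AA_precomodules(1,1,3,1) \<Delta>' colinear_ident(1)[OF A]], of t] by simp
    then have "assoc A A A (tensor_map A A (A \<otimes> A) A \<Delta> id (cp A A t)) = cp A (tens H A A) (assoc A A A ?v)"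
      (is "?a = _")
      using colinear_counit_proj_commute[OF precomodule_tens[OF AA_precomodules(3,1)] precomodule_tens[OF AA_precomodules(1,3)]
          colinear_assoc(1)[OF A A A], of ?v] by simp
    also have "\<dots> = tensor_map A (A \<otimes> A) A (A \<otimes> A) id (cp A A) (assoc A A A ?v)"
      using counit_proj_triple'[OF A A A v] v1 by simp
    finally have e: "?a = \<dots>" .
    have "tensor_map A (A \<otimes> A) A A id \<mu> ?a = tensor_map A (A \<otimes> A) A A id \<mu> (assoc A A A ?v)"
      unfolding e by (subst tensor_map_comp) (simp_all, rule tensor_map_cong, simp_all add: mu_cp)
    then show ?thesis
      using c unfolding mu_cp[OF t] by argo
  qed
  show ?thesis
    using P Q E F cp_mem_mtensor[OF A A] mtensor_subset[OF A A] by metis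
qed

end


section \<open>The target subalgebra and the unit isomorphisms\<close>

lemma eps_t_image: "eps_t H ` carrier H = {x \<in> carrier H. eps_t H x = x}"
  using eps_t_idem eps_mem(2) by force

lemma carrier_H_t: "carrier (H_t H) = {x \<in> carrier H. eps_t H x = x}"
  by (simp add: H_t_def eps_t_image)

lemma is_vspace_H_t [vs]: "is_vspace (H_t H)"
  unfolding H_t_def eps_t_image by (rule is_vspace_fixed_points) (simp_all add: vs)

lemma lin_H_t: "lin (H_t H) H id" "lin H (H_t H) (eps_t H)"
  unfolding H_t_def eps_t_image
  by (auto intro!: lin_from_restrict lin_into_restrict simp: vs eps_t_idem)

text \<open>\<open>eps_t\<close> is the identity on H_t, so it may be inserted on a leg that comes
  from H_t. In this form the condition on the coaction of the unit enters the calculations.\<close>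

lemma lift_coact_eps_t:
  assumes T: "precomodule H T" and W: "is_vspace W" and B: "bilin T H W B" 
    and u: "\<rho> \<in> tensor_map T (H_t H) T H id id ` carrier (T \<otimes> H_t H)"
  shows "tensor_lift T H W (\<lambda>u0 u1. B u0 (eps_t H u1)) \<rho> = tensor_lift T H W B \<rho>"
proof -
  obtain s where s: "s \<in> carrier (T \<otimes> H_t H)" "\<rho> = tensor_map T (H_t H) T H id id s"
    using u by blast
  have l: "b \<in> carrier H \<Longrightarrow> lin T W (\<lambda>a. B a b)" "a \<in> carrier T \<Longrightarrow> lin H W (\<lambda>b. B a b)" for a b
    using B by (simp_all add: bilin_def)
  note [simp] = vs T W s lin_H_t l l[THEN lin_comp[rotated]]
  show ?thesis
    by (simp add: lift_tensor_map, rule tensor_lift_cong) (simp_all add: carrier_H_t)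
qed

text \<open>The double sum is the comultiplication of x y with \<open>counit H\<close> on both legs,
  so a single counit law finishes it.\<close>

lemma counit_mult_comult:
  assumes V: "is_vspace W" and x: "x \<in> carrier H" and y: "y \<in> carrier H" and w: "w \<in> carrier W"
  shows "hsum W x (\<lambda>p q. hsum W y (\<lambda>c d. scale W (counit H (mult H p c) * counit H (mult H q d)) w)) =
    scale W (counit H (mult H x y)) w"
proof -
  note [simp] = vs assms
  have "hsum W x (\<lambda>p q. hsum W y (\<lambda>c d. scale W (counit H (mult H p c) * counit H (mult H q d)) w)) =
    hsum W (mult H x y) (\<lambda>h k. scale W (counit H h) (scale W (counit H k) w))"
    by (subst comult_mult) (simp_all add: scale_scale)
  also have "\<dots> = scale W (counit H (mult H x y)) w"
    by (rule comult_counit(1)) simp_all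
  finally show ?thesis .
qed

context
  fixes A :: "('k, 'h, 'v) comod"
  assumes Ac: "comodule H A"
begin

text \<open>The bilinear maps behind the unit isomorphisms, taken on all of H so that sums over
  \<open>comult H\<close> can be evaluated with them.\<close>

definition "lact x a = cosum A A a (\<lambda>a0 a1. scale A (counit H (mult H x a1)) a0)"
definition "ract a x = cosum A A a (\<lambda>a0 a1. scale A (counit H (mult H a1 x)) a0)"

lemma bilin_act: "bilin H A A lact" "bilin A H A ract"
  unfolding lact_def[abs_def] ract_def[abs_def] using Ac by (simp_all add: vs)

lemma bilin_act': "bilin (munit H) A A lact" "bilin A (munit H) A ract"
proof -
  have *: "lin (munit H) A f" if "lin H A f" for f :: "'h \<Rightarrow> 'v"
    using lin_comp[OF lin_munit(2) that] .
  show "bilin (munit H) A A lact" "bilin A (munit H) A ract"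
    using bilin_act by (simp_all add: bilin_def munit_mem *)
qed

lemma lunit_eq: "lunit H A = restrict (tensor_lift (munit H) A A lact) (carrier (mtensor H (munit H) A))"
  and runit_eq: "runit H A = restrict (tensor_lift A (munit H) A ract) (carrier (mtensor H A (munit H)))"
  by (simp_all add: lunit_def runit_def lact_def[abs_def] ract_def[abs_def])

text \<open>On the left, the projection contributes \<open>\<epsilon>(x\<^sub>2 a\<^sub>2)\<close>
  and the map itself \<open>\<epsilon>(x\<^sub>1 a\<^sub>1)\<close>; after coassociativity
  \<open>counit_mult_comult\<close> collapses the two, and likewise on the right. This evaluates the
  unit isomorphisms at projected pure tensors.\<close>

lemma act_cp:
  assumes x: "x \<in> carrier (munit H)" and a: "a \<in> carrier A"
  shows "tensor_lift (munit H) A A lact (cp (munit H) A (x \<otimes>\<^bsub>munit H,A\<^esub> a)) = lact x a"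
    and "tensor_lift A (munit H) A ract (cp A (munit H) (a \<otimes>\<^bsub>A,munit H\<^esub> x)) = ract a x"
proof -
  have bl: "a \<in> carrier A \<Longrightarrow> lin H A (\<lambda>x. lact x a)" "x \<in> carrier H \<Longrightarrow> lin A A (lact x)"
    "a \<in> carrier A \<Longrightarrow> lin H A (\<lambda>x. ract a x)" "x \<in> carrier H \<Longrightarrow> lin A A (\<lambda>a. ract a x)" for a x
    using bilin_act by (simp_all add: bilin_def)
  note [simp] = vs comoduleD[OF Ac] x a munit_mem lin_munit bilin_act bilin_act' scale_scale bl bl[THEN lin_comp[rotated]] lin_mem[OF bl(1)] lin_mem[OF bl(3)]
  have bl': "a \<in> carrier A \<Longrightarrow> lin (munit H) A (\<lambda>x. lact x a)" "x \<in> carrier (munit H) \<Longrightarrow> lin A A (lact x)"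
    "a \<in> carrier A \<Longrightarrow> lin (munit H) A (\<lambda>x. ract a x)" "x \<in> carrier (munit H) \<Longrightarrow> lin A A (\<lambda>a. ract a x)" for a x
    using bilin_act' by (simp_all add: bilin_def)
  note [simp] = bl' lin_mem[OF bl'(1)] lin_mem[OF bl'(3)]
  have "tensor_lift (munit H) A A lact (cp (munit H) A (x \<otimes>\<^bsub>munit H,A\<^esub> a)) =
    cosum (munit H) A x (\<lambda>p q. cosum A A a (\<lambda>a0 a1. scale A (counit H (mult H q a1)) (lact p a0)))"
    by (simp add: counit_proj_tens_pure push lin_scale_arg[OF lin_tensor_lift] lift_pure)
  also have "\<dots> = hsum A x (\<lambda>p q. cosum A A a (\<lambda>a0 a1. scale A (counit H (mult H q a1)) (lact p a0)))"
    by (rule lift_coact_munit) simp_all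
  also have "\<dots> = hsum A x (\<lambda>p q. cosum A A a (\<lambda>a0 a1. cosum A A a0 (\<lambda>b c.
      scale A (counit H (mult H p c) * counit H (mult H q a1)) b)))"
    unfolding lact_def by (simp add: push mult.commute)
  also have "\<dots> = hsum A x (\<lambda>p q. cosum A A a (\<lambda>a0 a1. hsum A a1 (\<lambda>c d.
      scale A (counit H (mult H p c) * counit H (mult H q d)) a0)))"
    by (intro tensor_lift_cong refl coact_coassoc) simp_all
  also have "\<dots> = cosum A A a (\<lambda>a0 a1. hsum A x (\<lambda>p q. hsum A a1 (\<lambda>c d.
      scale A (counit H (mult H p c) * counit H (mult H q d)) a0)))"
    by (rule lift_swap) simp_all
  also have "\<dots> = lact x a"
    unfolding lact_def by (simp add: counit_mult_comult)
  finally show "tensor_lift (munit H) A A lact (cp (munit H) A (x \<otimes>\<^bsub>munit H,A\<^esub> a)) = lact x a" .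
  have "tensor_lift A (munit H) A ract (cp A (munit H) (a \<otimes>\<^bsub>A,munit H\<^esub> x)) =
    cosum A A a (\<lambda>a0 a1. cosum (munit H) A x (\<lambda>p q. scale A (counit H (mult H a1 q)) (ract a0 p)))"
    by (simp add: counit_proj_tens_pure push lin_scale_arg[OF lin_tensor_lift] lift_pure)
  also have "\<dots> = cosum A A a (\<lambda>a0 a1. hsum A x (\<lambda>p q. scale A (counit H (mult H a1 q)) (ract a0 p)))"
    by (intro tensor_lift_cong[OF refl refl refl refl] lift_coact_munit) simp_all
  also have "\<dots> = cosum A A a (\<lambda>a0 a1. hsum A x (\<lambda>p q. cosum A A a0 (\<lambda>b c.
      scale A (counit H (mult H c p) * counit H (mult H a1 q)) b)))"
    unfolding ract_def by (simp add: push mult.commute)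
  also have "\<dots> = cosum A A a (\<lambda>a0 a1. cosum A A a0 (\<lambda>b c. hsum A x (\<lambda>p q. 
      scale A (counit H (mult H c p) * counit H (mult H a1 q)) b)))"
    by (intro tensor_lift_cong[OF refl refl refl refl] lift_swap) simp_all
  also have "\<dots> = cosum A A a (\<lambda>a0 a1. hsum A a1 (\<lambda>c d. hsum A x (\<lambda>p q. 
      scale A (counit H (mult H c p) * counit H (mult H d q)) a0)))"
    by (rule coact_coassoc) simp_all
  also have "\<dots> = ract a x"
    unfolding ract_def by (simp add: counit_mult_comult)
  finally show "tensor_lift A (munit H) A ract (cp A (munit H) (a \<otimes>\<^bsub>A,munit H\<^esub> x)) = ract a x" .
qed

lemma act_one: "a \<in> carrier A \<Longrightarrow> lact (one H) a = a" "a \<in> carrier A \<Longrightarrow> ract a (one H) = a"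
  using comodule_counit_proj[OF Ac] by (simp_all add: lact_def ract_def counit_proj_def mult_laws)

end

section \<open>From comodule algebras to algebras in the category of comodules\<close>

context
  fixes A :: "('k, 'h, 'v) comod" and mul u
  assumes ca: "comodule_algebra H A mul u"
begin

lemma ca_comodule: "comodule H A"
  and ca_algebra: "algebra A mul u"
  using ca by (simp_all add: comodule_algebra_def)

lemmas ca_pre = comoduleD[OF ca_comodule]

lemma mul_closed: "a \<in> carrier A \<Longrightarrow> b \<in> carrier A \<Longrightarrow> mul a b \<in> carrier A"
  and unit_closed: "u \<in> carrier A"
  using ca_algebra by (auto simp: algebra_def linear_maps_iff lin_def)

lemma mul_laws:
  shows "a \<in> carrier A \<Longrightarrow> b \<in> carrier A \<Longrightarrow> c \<in> carrier A \<Longrightarrow> mul (mul a b) c = mul a (mul b c)"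
    and "a \<in> carrier A \<Longrightarrow> mul u a = a" "a \<in> carrier A \<Longrightarrow> mul a u = a"
  using ca_algebra by (auto simp: algebra_def)

lemma bilin_mul: "bilin A A A mul"
proof (rule bilinI)
  fix b assume b: "b \<in> carrier A"
  have "lin A A (\<lambda>x\<in>carrier A. mul x b)"
    using b ca_algebra by (auto simp: algebra_def linear_maps_iff)
  then show "lin A A (\<lambda>x. mul x b)"
    by (rule iffD1[OF lin_cong, rotated 2]) (simp_all add: ca_pre vs)
  show "lin A A (mul b)"
    using b ca_algebra by (auto simp: algebra_def linear_maps_iff)
qed

abbreviation (input) "mu \<equiv> tensor_lift A A A mul"

lemma lin_mul_arg:
  "b \<in> carrier A \<Longrightarrow> lin V A g \<Longrightarrow> lin V A (\<lambda>x. mul (g x) b)"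
  "b \<in> carrier A \<Longrightarrow> lin V A g \<Longrightarrow> lin V A (\<lambda>x. mul b (g x))"
  using bilin_mul by (auto simp: bilin_def intro: lin_comp[of V A g A "\<lambda>x. mul x b"] lin_comp[of V A g A "mul b"])

lemma lin_mul: "lin (A \<otimes> A) A mu"
  using ca_pre bilin_mul by (intro lin_tensor_lift) (simp_all add: vs)

lemma mu_pure: "a \<in> carrier A \<Longrightarrow> b \<in> carrier A \<Longrightarrow> mu (a \<otimes>\<^bsub>A,A\<^esub> b) = mul a b"
  using ca_pre bilin_mul by (intro lift_pure) (simp_all add: vs)

lemma coact_mul:
  assumes "a \<in> carrier A" "b \<in> carrier A"
  shows "coact A (mul a b) = cosum A (A \<otimes> H) a (\<lambda>a0 a1. cosum A (A \<otimes> H) b (\<lambda>b0 b1. mul a0 b0 \<otimes>\<^bsub>A,H\<^esub> mult H a1 b1))"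
  using ca assms by (simp add: comodule_algebra_def tensor_mult_def)

lemma lift_coact_mul:
  assumes "a \<in> carrier A" "b \<in> carrier A" "is_vspace W" "bilin A H W B"
  shows "cosum A W (mul a b) B = cosum A W a (\<lambda>a0 a1. cosum A W b (\<lambda>b0 b1. B (mul a0 b0) (mult H a1 b1)))"
  using assms ca_pre by (simp add: coact_mul push lift_pure vs mul_closed lin_mul_arg)

lemma colinear_mul: "colinear H (tens H A A) A mu"
proof -
  note [simp] = vs ca_pre lin_mul lin_comp[OF _ lin_mul] lin_mem[OF lin_mul] mul_closed lin_tensor_map
  have "coact A (mu t) = tensor_map (A \<otimes> A) H A H mu id (diag_coact H A A t)" if "t \<in> carrier (A \<otimes> A)" for t
  proof (rule lin_tensor_eqI[OF _ _ _ _ is_vspace_tensor[of A H] _ that])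
    fix a b assume [simp]: "a \<in> carrier A" "b \<in> carrier A"
    show "coact A (mu (a \<otimes>\<^bsub>A,A\<^esub> b)) = tensor_map (A \<otimes> A) H A H mu id (diag_coact H A A (a \<otimes>\<^bsub>A,A\<^esub> b))"
      unfolding tensor_map_def by (subst lift_diag_coact) (simp_all add: mu_pure coact_mul)
  qed (simp_all)
  then show ?thesis by (simp add: colinear_def)
qed

end


context
  fixes A :: "('k, 'h, 'v) comod" and mul u
  assumes ca: "comodule_algebra H A mul u"
begin

text \<open>The formula of \<open>unit_in_comod\<close> on all of H, so that it may be applied to
  the legs of \<open>\<Delta>(1)\<close>.\<close>

definition "uval x = cosum A A u (\<lambda>u0 u1. scale A (counit H (mult H x u1)) u0)"

lemma lin_uval: "lin H A uval"
  unfolding uval_def[abs_def] using ca_pre[OF ca] unit_closed[OF ca] by (simp add: vs)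

lemma uval_one: "uval (one H) = u"
  using comodule_counit_proj[OF ca_comodule[OF ca] unit_closed[OF ca]]
  by (simp add: uval_def counit_proj_def mult_laws)

lemma unit_image: "coact A u \<in> tensor_map A (H_t H) A H id id ` carrier (A \<otimes> H_t H)"
  using ca by (simp add: comodule_algebra_def)

text \<open>The coaction of the unit takes values in the target subalgebra, on which the comultiplication
  is multiplication of \<open>\<Delta>(1)\<close> from either side; this gives two expressions for the coaction.\<close>

lemma lift_coact_uval:
  assumes W: "is_vspace W" and B: "bilin A H W B" and x: "x \<in> carrier (munit H)"
  shows "cosum A W (uval x) B = cosum A W u (\<lambda>u0 u1. B u0 (mult H x u1))"
    and "cosum A W (uval x) B = cosum A W u (\<lambda>u0 u1. B u0 (mult H u1 x))"
proof -
  have l: "b \<in> carrier H \<Longrightarrow> lin A W (\<lambda>a. B a b)" "a \<in> carrier A \<Longrightarrow> lin H W (\<lambda>b. B a b)" for a b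
    using B by (simp_all add: bilin_def)
  note [simp] = vs ca_pre[OF ca] unit_closed[OF ca] W munit_mem[OF x] l l[THEN lin_comp[rotated]] lin_mem[OF l(1)]
    lin_scale_arg[OF l(2)]
  have pushB: "B a (tensor_lift H H H f t) = tensor_lift H H W (\<lambda>p q. B a (f p q)) t"
    if "a \<in> carrier A" "bilin H H H f" "t \<in> carrier (H \<otimes> H)" for a f t
    using that by (intro lift_push[where f = "B a"]; simp)
  have "cosum A W (uval x) B = cosum A W u (\<lambda>u0 u1. cosum A W u0 (\<lambda>a b. scale W (counit H (mult H x u1)) (B a b)))"
    unfolding uval_def by (simp add: push lin_scale_arg[OF lin_coact] lin_scale_arg[OF lin_tensor_lift])
  also have "\<dots> = cosum A W u (\<lambda>u0 u1. hsum W u1 (\<lambda>b c. scale W (counit H (mult H x c)) (B u0 b)))"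
    by (rule coact_coassoc) simp_all
  also have "\<dots> = cosum A W u (\<lambda>u0 u1. hsum W (eps_t H u1) (\<lambda>b c. scale W (counit H (mult H x c)) (B u0 b)))"
    by (rule lift_coact_eps_t[OF _ _ _ unit_image, symmetric]) simp_all
  finally have 0: "cosum A W (uval x) B = \<dots>" .
  have e: "eps_s H x = x" by (rule munit_fixed[OF x])
  have k: "hsum W (one H) (\<lambda>b c. scale W (counit H (mult H x c)) (B a (mult H b h))) = B a (mult H x h)"
    "hsum W (one H) (\<lambda>b c. scale W (counit H (mult H x c)) (B a (mult H h b))) = B a (mult H h x)"
    if [simp]: "a \<in> carrier A" "h \<in> carrier H" for a h
  proof -
    have "B a (mult H (eps_s H x) h) = hsum W (one H) (\<lambda>b c. scale W (counit H (mult H x c)) (B a (mult H b h)))"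
      "B a (mult H h (eps_s H x)) = hsum W (one H) (\<lambda>b c. scale W (counit H (mult H x c)) (B a (mult H h b)))"
      unfolding eps_s_def by (simp_all add: push pushB lin_scale_arg[OF lin_mult(1)[OF _ _ lin_ident(1)]]
        lin_scale_arg[OF lin_mult(2)[OF _ _ lin_ident(1)]])
    then show "hsum W (one H) (\<lambda>b c. scale W (counit H (mult H x c)) (B a (mult H b h))) = B a (mult H x h)"
      "hsum W (one H) (\<lambda>b c. scale W (counit H (mult H x c)) (B a (mult H h b))) = B a (mult H h x)"
      by (simp_all only: e)
  qed
  note 0
  also have "cosum A W u (\<lambda>u0 u1. hsum W (eps_t H u1) (\<lambda>b c. scale W (counit H (mult H x c)) (B u0 b))) =
    cosum A W u (\<lambda>u0 u1. hsum W (one H) (\<lambda>b c. scale W (counit H (mult H x c)) (B u0 (mult H b (eps_t H u1)))))"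
    by (intro tensor_lift_cong[OF refl refl refl refl] comult_eps_t(2)) simp_all
  also have "\<dots> = cosum A W u (\<lambda>u0 u1. B u0 (mult H x (eps_t H u1)))"
    by (simp add: k)
  also have "\<dots> = cosum A W u (\<lambda>u0 u1. B u0 (mult H x u1))"
    by (rule lift_coact_eps_t[OF _ _ _ unit_image, where B = "\<lambda>u0 u1. B u0 (mult H x u1)"]) simp_all
  finally show "cosum A W (uval x) B = \<dots>" .
  note 0
  also have "cosum A W u (\<lambda>u0 u1. hsum W (eps_t H u1) (\<lambda>b c. scale W (counit H (mult H x c)) (B u0 b))) =
    cosum A W u (\<lambda>u0 u1. hsum W (one H) (\<lambda>b c. scale W (counit H (mult H x c)) (B u0 (mult H (eps_t H u1) b))))"
    by (intro tensor_lift_cong[OF refl refl refl refl] comult_eps_t(1)) simp_all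
  also have "\<dots> = cosum A W u (\<lambda>u0 u1. B u0 (mult H (eps_t H u1) x))"
    by (simp add: k)
  also have "\<dots> = cosum A W u (\<lambda>u0 u1. B u0 (mult H u1 x))"
    by (rule lift_coact_eps_t[OF _ _ _ unit_image, where B = "\<lambda>u0 u1. B u0 (mult H u1 x)"]) simp_all
  finally show "cosum A W (uval x) B = \<dots>" .
qed

text \<open>For x in H_s, the right side is \<open>uval 1\<^sub>1 \<otimes> 1\<^sub>2 x\<close>.
  Expanding \<open>uval\<close> assembles \<open>eps_t\<close> on the second leg of the coaction of
  u, where it acts trivially, and what is left is the second expression of
  \<open>lift_coact_uval\<close>.\<close>

lemma colinear_uval: "colinear H (munit H) A uval"
proof -
  have l: "lin (munit H) A uval"
    using lin_comp[OF lin_munit(2) lin_uval] .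
  have "coact A (uval x) = tensor_map (munit H) H A H uval id (coact (munit H) x)" if x: "x \<in> carrier (munit H)" for x
  proof -
    note [simp] = vs ca_pre[OF ca] unit_closed[OF ca] munit_mem[OF x] lin_uval lin_comp[OF _ lin_uval] lin_mem[OF lin_uval] mult_laws(1)
      lin_scale_arg[OF lin_mult(1)[OF _ _ lin_ident(1)]]
    have e: "eps_s H x = x" by (rule munit_fixed[OF x])
    have "tensor_map (munit H) H A H uval id (coact (munit H) x) = hsum (A \<otimes> H) (eps_s H x) (\<lambda>p q. uval p \<otimes>\<^bsub>A,H\<^esub> q)"
      unfolding tensor_map_def using x by (simp add: lift_coact_munit e)
    also have "\<dots> = hsum (A \<otimes> H) (one H) (\<lambda>p q. uval p \<otimes>\<^bsub>A,H\<^esub> mult H q x)"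
      by (subst comult_eps_s(1)) (simp_all add: e)
    also have "\<dots> = hsum (A \<otimes> H) (one H) (\<lambda>p q. cosum A (A \<otimes> H) u (\<lambda>u0 u1.
        scale (A \<otimes> H) (counit H (mult H p u1)) (u0 \<otimes>\<^bsub>A,H\<^esub> mult H q x)))"
      unfolding uval_def by (simp add: push scale_tensor_elt)
    also have "\<dots> = cosum A (A \<otimes> H) u (\<lambda>u0 u1. hsum (A \<otimes> H) (one H) (\<lambda>p q.
        scale (A \<otimes> H) (counit H (mult H p u1)) (u0 \<otimes>\<^bsub>A,H\<^esub> mult H q x)))"
      by (rule lift_swap) simp_all
    also have "\<dots> = cosum A (A \<otimes> H) u (\<lambda>u0 u1. u0 \<otimes>\<^bsub>A,H\<^esub> mult H (eps_t H u1) x)"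
      unfolding eps_t_def by (simp add: push scale_tensor_elt)
    also have "\<dots> = cosum A (A \<otimes> H) u (\<lambda>u0 u1. u0 \<otimes>\<^bsub>A,H\<^esub> mult H u1 x)"
      by (rule lift_coact_eps_t[OF _ _ _ unit_image, where B = "\<lambda>u0 u1. u0 \<otimes>\<^bsub>A,H\<^esub> mult H u1 x"]) simp_all
    also have "\<dots> = cosum A (A \<otimes> H) (uval x) (\<lambda>u0 u1. u0 \<otimes>\<^bsub>A,H\<^esub> u1)"
      using x by (intro lift_coact_uval(2)[symmetric]) simp_all
    also have "\<dots> = coact A (uval x)"
      by (simp add: lift_tensor_elt)
    finally show ?thesis ..
  qed
  with l show ?thesis by (simp add: colinear_def)
qed

text \<open>These are the unit conditions on pure tensors. Inserting the coaction of
  \<open>uval x\<close> in the form with x on the outer side of \<open>u\<^sub>1\<close> leaves the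
  coactions of u and a in the pattern of the coaction of their product, which is the coaction of
  a.\<close>

lemma mul_uval:
  assumes x: "x \<in> carrier (munit H)" and a: "a \<in> carrier A"
  shows "mul (uval x) a = lact A x a" and "mul a (uval x) = ract A a x"
proof -
  note mem [simp] = vs ca_pre[OF ca] unit_closed[OF ca] munit_mem[OF x] a lin_uval lin_mem[OF lin_uval]
    mul_closed[OF ca] lin_mul_arg[OF ca] mult_laws(1)
  let ?mu = "tensor_lift A A A mul"
  \<comment> \<open>A product equals its own projection, so the counit of H can be introduced into
    it and brings the coactions of both factors into play.\<close>
  have pure: "mul a b = cosum A A a (\<lambda>a0 a1. cosum A A b (\<lambda>b0 b1. scale A (counit H (mult H a1 b1)) (mul a0 b0)))"
    if [simp]: "a \<in> carrier A" "b \<in> carrier A" for a b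
  proof -
    have "mul a b = counit_proj H A (mul a b)"
      using comodule_counit_proj[OF ca_comodule[OF ca]] by simp
    also have "\<dots> = cosum A A a (\<lambda>a0 a1. cosum A A b (\<lambda>b0 b1. scale A (counit H (mult H a1 b1)) (mul a0 b0)))"
      unfolding counit_proj_def by (rule lift_coact_mul[OF ca]) simp_all
    finally show ?thesis .
  qed
  have "mul (uval x) a = cosum A A (uval x) (\<lambda>a0 a1. cosum A A a (\<lambda>b0 b1. scale A (counit H (mult H a1 b1)) (mul a0 b0)))"
    by (rule pure) simp_all
  also have "\<dots> = cosum A A u (\<lambda>a0 a1. cosum A A a (\<lambda>b0 b1. scale A (counit H (mult H (mult H x a1) b1)) (mul a0 b0)))"
    using x by (intro lift_coact_uval(1)) simp_all
  also have "\<dots> = cosum A A (mul u a) (\<lambda>a0 a1. scale A (counit H (mult H x a1)) a0)"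
    by (subst lift_coact_mul[OF ca]) simp_all
  finally show "mul (uval x) a = lact A x a"
    by (simp add: mul_laws[OF ca] lact_def[OF ca_comodule[OF ca]])
  have "mul a (uval x) = cosum A A a (\<lambda>a0 a1. cosum A A (uval x) (\<lambda>b0 b1. scale A (counit H (mult H a1 b1)) (mul a0 b0)))"
    by (rule pure) simp_all
  also have "\<dots> = cosum A A a (\<lambda>a0 a1. cosum A A u (\<lambda>b0 b1. scale A (counit H (mult H a1 (mult H b1 x))) (mul a0 b0)))"
    using x by (intro tensor_lift_cong[OF refl refl refl refl] lift_coact_uval(2)) simp_all
  also have "\<dots> = cosum A A (mul a u) (\<lambda>a0 a1. scale A (counit H (mult H a1 x)) a0)"
    by (subst lift_coact_mul[OF ca]) simp_all
  finally show "mul a (uval x) = ract A a x"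
    by (simp add: mul_laws[OF ca] ract_def[OF ca_comodule[OF ca]])
qed

lemma unit_in_comod_eq: "unit_in_comod H A u = restrict uval (carrier (munit H))"
  by (rule ext) (simp add: unit_in_comod_def uval_def restrict_def)

text \<open>The unit conditions are linear in the tensor, so \<open>mul_uval\<close> settles them on
  pure tensors of the full product, and restriction to the fixed ones follows.\<close>

lemma algebra_in_comod_if: "algebra_in_comod H A (mult_in_comod H A mul) (unit_in_comod H A u)"
proof -
  note Ac = ca_comodule[OF ca] and P = ca_pre[OF ca] and mu = colinear_mul[OF ca]
  let ?m = "mult_in_comod H A mul" and ?u = "unit_in_comod H A u" and ?mu = "tensor_lift A A A mul"
  have m: "?m t = ?mu t" if "t \<in> carrier (mtensor H A A)" for t
    using that by (simp add: mult_in_comod_def)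
  have u: "?u x = uval x" if "x \<in> carrier (munit H)" for x
    using that by (simp add: unit_in_comod_eq)
  have mhom: "?m \<in> comodule_homs H (mtensor H A A) A"
    unfolding comodule_homs_iff
    by (rule conjI[OF colinear_m[OF Ac mu m]]) (simp_all add: mult_in_comod_def)
  have ucol: "colinear H (munit H) A ?u"
    by (rule colinear_cong[OF precomodule_munit colinear_uval]) (simp add: u)
  then have uhom: "?u \<in> comodule_homs H (munit H) A"
    by (simp add: comodule_homs_iff unit_in_comod_eq)
  note [simp] = vs P lin_mul[OF ca] lin_mem[OF lin_mul[OF ca]] lin_comp[OF _ lin_mul[OF ca]] mul_closed[OF ca] lin_mul_arg[OF ca]
    colinear_lin[OF ucol] lin_mem[OF colinear_lin[OF ucol]] lin_tensor_map
  have "?mu (tensor_map (A \<otimes> A) A A A ?mu id s) = ?mu (tensor_map A (A \<otimes> A) A A id ?mu (assoc A A A s))"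
    if "s \<in> carrier (A \<otimes> A \<otimes> A)" for s
    by (rule lin_tensor3_eqI[OF _ _ _ _ _ _ _ that, of A])
      (simp_all add: tensor_map_pure assoc_pure mu_pure[OF ca] mul_laws[OF ca])
  then have assoc: "\<forall>t\<in>carrier (mtensor H (mtensor H A A) A).
      ?m (mtensor_map H (mtensor H A A) A A A ?m id t) =
      ?m (mtensor_map H A (mtensor H A A) A A id ?m (massoc H A A A t))"
    using mtensor_mult_assoc_iff[OF Ac mu m] by blast
  have "?m (mtensor_map H (munit H) A A A ?u id t) = lunit H A t" if t: "t \<in> carrier (mtensor H (munit H) A)" for t
  proof -
    note c = colinear_mtensor_map(2,3)[OF precomodule_munit P P P ucol colinear_ident(1)[OF P] t]
    have "?mu (tensor_map (munit H) A A A ?u id t) = tensor_lift (munit H) A A (lact A) t"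
    proof (rule lift_eqI[where f = "\<lambda>t. ?mu (tensor_map (munit H) A A A ?u id t)"])
      show "bilin (munit H) A A (lact A)"
        by (rule bilin_act'(1)[OF Ac])
    qed (use mtensor_subset[OF precomodule_munit P t] in
      \<open>simp_all add: tensor_map_pure mu_pure[OF ca] u mul_uval lin_mem[OF lin_uval] munit_mem\<close>)
    then show ?thesis
      using c t by (simp add: m lunit_eq[OF Ac])
  qed
  moreover have "?m (mtensor_map H A (munit H) A A id ?u t) = runit H A t" if t: "t \<in> carrier (mtensor H A (munit H))" for t
  proof -
    note c = colinear_mtensor_map(2,3)[OF P precomodule_munit P P colinear_ident(1)[OF P] ucol t]
    have "?mu (tensor_map A (munit H) A A id ?u t) = tensor_lift A (munit H) A (ract A) t"
    proof (rule lift_eqI[where f = "\<lambda>t. ?mu (tensor_map A (munit H) A A id ?u t)"])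
      show "bilin A (munit H) A (ract A)"
        by (rule bilin_act'(2)[OF Ac])
    qed (use mtensor_subset[OF P precomodule_munit t] in
      \<open>simp_all add: tensor_map_pure mu_pure[OF ca] u mul_uval lin_mem[OF lin_uval] munit_mem\<close>)
    then show ?thesis
      using c t by (simp add: m runit_eq[OF Ac])
  qed
  ultimately show ?thesis
    using Ac mhom uhom assoc by (simp add: algebra_in_comod_def)
qed

lemma mult_of_mult_in_comod: "mult_of_comod H A (mult_in_comod H A mul) = mul"
proof -
  note P = ca_pre[OF ca]
  have ext: "mul \<in> extensional (carrier A)" "a \<in> carrier A \<Longrightarrow> mul a \<in> extensional (carrier A)" for a
    using ca_algebra[OF ca] by (auto simp: algebra_def linear_maps_iff PiE_def)
  have "mult_of_comod H A (mult_in_comod H A mul) a b = mul a b" if "a \<in> carrier A" "b \<in> carrier A" for a b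
    using that cp_mem_mtensor[OF P P, of "a \<otimes>\<^bsub>A,A\<^esub> b"] mu_cp[OF ca_comodule[OF ca] colinear_mul[OF ca], of "tensor_lift A A A mul" "a \<otimes>\<^bsub>A,A\<^esub> b"]
    by (simp add: mult_of_comod_def mult_in_comod_def vs P mu_pure[OF ca])
  then have "mult_of_comod H A (mult_in_comod H A mul) a = mul a" if "a \<in> carrier A" for a
    using that by (intro extensionalityI[OF _ ext(2)[OF that]]) (simp_all add: mult_of_comod_def)
  then show ?thesis
    by (intro extensionalityI[OF _ ext(1)]) (simp_all add: mult_of_comod_def)
qed

lemma unit_of_unit_in_comod: "unit_in_comod H A u (one H) = u"
  by (simp add: unit_in_comod_eq one_munit uval_one)

end


section \<open>From algebras in the category of comodules to comodule algebras\<close>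

context
  fixes A :: "('k, 'h, 'v) comod" and m \<upsilon>
  assumes al: "algebra_in_comod H A m \<upsilon>"
begin

lemma al_comodule: "comodule H A"
  and al_mult: "colinear H (mtensor H A A) A m" "m \<in> extensional (carrier (mtensor H A A))"
  and al_unit: "colinear H (munit H) A \<upsilon>" "\<upsilon> \<in> extensional (carrier (munit H))"
  using al by (simp_all add: algebra_in_comod_def comodule_homs_iff)

lemma al_unit_laws:
  "t \<in> carrier (mtensor H (munit H) A) \<Longrightarrow> m (mtensor_map H (munit H) A A A \<upsilon> id t) = lunit H A t"
  "t' \<in> carrier (mtensor H A (munit H)) \<Longrightarrow> m (mtensor_map H A (munit H) A A id \<upsilon> t') = runit H A t'"
  using al by (simp_all add: algebra_in_comod_def)

lemmas al_pre = comoduleD[OF al_comodule]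

lemma colinear_mult_cp: "colinear H (tens H A A) A (\<lambda>t. m (cp A A t))"
  by (rule colinear_comp[OF precomodule_tens[OF al_pre al_pre] precomodule_mtensor[OF al_pre al_pre] al_pre
    colinear_mtensor_proj[OF al_pre al_pre] al_mult(1)])

lemma m_eq: "t \<in> carrier (mtensor H A A) \<Longrightarrow> m t = m (cp A A t)"
  by (simp add: mtensor_fixed[OF al_pre al_pre])

lemma lin_mult_cp: "lin (A \<otimes> A) A (\<lambda>t. m (cp A A t))"
  using colinear_lin[OF colinear_mult_cp] by simp

lemma mult_of_comod_eq: "a \<in> carrier A \<Longrightarrow> b \<in> carrier A \<Longrightarrow> mult_of_comod H A m a b = m (cp A A (a \<otimes>\<^bsub>A,A\<^esub> b))"
  by (simp add: mult_of_comod_def)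

lemma bilin_mult_of_comod: "bilin A A A (mult_of_comod H A m)"
proof (rule bilinI)
  note [simp] = vs al_pre
  fix a assume a: "a \<in> carrier A"
  have l: "lin A A (\<lambda>b. m (cp A A (b \<otimes>\<^bsub>A,A\<^esub> a)))" "lin A A (\<lambda>b. m (cp A A (a \<otimes>\<^bsub>A,A\<^esub> b)))"
    using a by (intro lin_comp[OF _ lin_mult_cp]; simp)+
  show "lin A A (\<lambda>b. mult_of_comod H A m b a)"
    by (rule iffD1[OF lin_cong l(1)]) (simp_all add: a mult_of_comod_eq)
  show "lin A A (mult_of_comod H A m a)"
    by (rule iffD1[OF lin_cong l(2)]) (simp_all add: a mult_of_comod_eq)
qed

lemma lift_mult_of_comod: "t \<in> carrier (A \<otimes> A) \<Longrightarrow> tensor_lift A A A (mult_of_comod H A m) t = m (cp A A t)"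
  using al_pre bilin_mult_of_comod by (intro lift_eqI[symmetric] lin_mult_cp) (simp_all add: vs mult_of_comod_eq)

lemma mult_in_mult_of_comod: "mult_in_comod H A (mult_of_comod H A m) = m"
  by (rule extensionalityI[OF _ al_mult(2)])
    (simp_all add: mult_in_comod_def lift_mult_of_comod mtensor_subset[OF al_pre al_pre] m_eq[symmetric])

text \<open>\<upsilon> \<otimes> id commutes with the projections, so the product is m applied to
  the image of the projection of 1 \<otimes> a. The unit condition makes this a value of
  \<open>lunit\<close>, which \<open>act_cp\<close> evaluates to the action of 1. The other side is
  symmetric.\<close>

lemma mult_of_comod_unit:
  assumes a: "a \<in> carrier A"
  shows "mult_of_comod H A m (\<upsilon> (one H)) a = a" "mult_of_comod H A m a (\<upsilon> (one H)) = a"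
proof -
  note [simp] = vs al_pre a colinear_lin[OF al_unit(1)] lin_mem[OF colinear_lin[OF al_unit(1)]]
  note i = colinear_ident(1)[OF al_pre]
  let ?w = "cp (munit H) A (one H \<otimes>\<^bsub>munit H,A\<^esub> a)" and ?w' = "cp A (munit H) (a \<otimes>\<^bsub>A,munit H\<^esub> one H)"
  have w: "?w \<in> carrier (mtensor H (munit H) A)" "?w' \<in> carrier (mtensor H A (munit H))"
    by (simp_all add: cp_mem_mtensor)
  have "mult_of_comod H A m (\<upsilon> (one H)) a = m (tensor_map (munit H) A A A \<upsilon> id ?w)"
    using colinear_counit_proj_commute[OF precomodule_tens[OF precomodule_munit al_pre] precomodule_tens[OF al_pre al_pre]
      colinear_tensor_map[OF precomodule_munit al_pre al_pre al_pre al_unit(1) i], of "one H \<otimes>\<^bsub>munit H,A\<^esub> a"]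
    by (simp add: mult_of_comod_eq tensor_map_pure)
  also have "\<dots> = lunit H A ?w"
    using al_unit_laws(1)[OF w(1)] colinear_mtensor_map(3)[OF precomodule_munit al_pre al_pre al_pre al_unit(1) i w(1)]
    by simp
  also have "\<dots> = a"
    using w by (simp add: lunit_eq[OF al_comodule] act_cp[OF al_comodule] act_one[OF al_comodule])
  finally show "mult_of_comod H A m (\<upsilon> (one H)) a = a" .
  have "mult_of_comod H A m a (\<upsilon> (one H)) = m (tensor_map A (munit H) A A id \<upsilon> ?w')"
    using colinear_counit_proj_commute[OF precomodule_tens[OF al_pre precomodule_munit] precomodule_tens[OF al_pre al_pre]
      colinear_tensor_map[OF al_pre precomodule_munit al_pre al_pre i al_unit(1)], of "a \<otimes>\<^bsub>A,munit H\<^esub> one H"]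
    by (simp add: mult_of_comod_eq tensor_map_pure)
  also have "\<dots> = runit H A ?w'"
    using al_unit_laws(2)[OF w(2)] colinear_mtensor_map(3)[OF al_pre precomodule_munit al_pre al_pre i al_unit(1) w(2)]
    by simp
  also have "\<dots> = a"
    using w by (simp add: runit_eq[OF al_comodule] act_cp[OF al_comodule] act_one[OF al_comodule])
  finally show "mult_of_comod H A m a (\<upsilon> (one H)) = a" .
qed

text \<open>\<upsilon> is meaningful on H_s only; \<open>eps_s\<close> extends it linearly to H, so
  that it may stand in sums over \<open>comult H\<close>.\<close>

lemma lin_upsilon: "lin H A (\<lambda>x. \<upsilon> (eps_s H x))"
  by (rule lin_comp[OF lin_munit(3) colinear_lin[OF al_unit(1)]])

lemma coact_upsilon_one:
  "coact A (\<upsilon> (one H)) = hsum (A \<otimes> H) (one H) (\<lambda>p q. \<upsilon> (eps_s H p) \<otimes>\<^bsub>A,H\<^esub> q)"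
proof -
  note [simp] = vs al_pre lin_upsilon lin_mem[OF lin_upsilon] lin_comp[OF _ lin_upsilon]
  have "coact A (\<upsilon> (one H)) = tensor_lift (munit H) H (A \<otimes> H) (\<lambda>p q. \<upsilon> (eps_s H p) \<otimes>\<^bsub>A,H\<^esub> q) (coact (munit H) (one H))"
    by (simp add: colinear_coact[OF al_unit(1)] tensor_map_def munit_fixed)
  also have "\<dots> = hsum (A \<otimes> H) (one H) (\<lambda>p q. \<upsilon> (eps_s H p) \<otimes>\<^bsub>A,H\<^esub> q)"
    by (rule lift_coact_munit) simp_all
  finally show ?thesis .
qed

text \<open>The coaction of the unit vector is
  \<open>\<upsilon>(1\<^sub>1) \<otimes> 1\<^sub>2\<close>, and weighting it with
  \<open>\<epsilon>(x 1\<^sub>2)\<close> rebuilds the formula of \<open>eps_s\<close> at x inside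
  \<upsilon>.\<close>

lemma unit_in_comod_upsilon: "unit_in_comod H A (\<upsilon> (one H)) = \<upsilon>"
proof (rule extensionalityI[OF _ al_unit(2)])
  show "unit_in_comod H A (\<upsilon> (one H)) x = \<upsilon> x" if x: "x \<in> carrier (munit H)" for x
  proof -
    note [simp] = vs al_pre lin_upsilon lin_mem[OF lin_upsilon] lin_comp[OF _ lin_upsilon] munit_mem[OF x]
    have "unit_in_comod H A (\<upsilon> (one H)) x = hsum A (one H) (\<lambda>p q. scale A (counit H (mult H x q)) (\<upsilon> (eps_s H p)))"
      using x by (simp add: unit_in_comod_def coact_upsilon_one push lift_pure)
    also have "\<dots> = \<upsilon> (eps_s H (eps_s H x))"
      unfolding eps_s_def[of H x] by (subst lift_push[where f = "\<lambda>x. \<upsilon> (eps_s H x)"])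
        (simp_all add: lin_scale_arg[OF lin_upsilon])
    finally show ?thesis
      using munit_fixed[OF x] by simp
  qed
qed (simp add: unit_in_comod_def)

lemma comodule_algebra_if: "comodule_algebra H A (mult_of_comod H A m) (\<upsilon> (one H))"
proof -
  note P = al_pre
  note [simp] = vs P lin_upsilon lin_mem[OF lin_upsilon] lin_comp[OF _ lin_upsilon] lin_H_t lin_comp[OF _ lin_H_t(2)]
    lin_mem[OF lin_H_t(2)]
  let ?mul = "mult_of_comod H A m" and ?\<mu> = "\<lambda>t. m (cp A A t)"
  have closed: "?mul a b \<in> carrier A" if "a \<in> carrier A" "b \<in> carrier A" for a b
    using bilin_mem[OF bilin_mult_of_comod that] .
  have l: "lin A A (?mul a)" "lin A A (\<lambda>b. ?mul b a)" if "a \<in> carrier A" for a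
    using bilin_mult_of_comod that by (simp_all add: bilin_def)
  have l': "lin A A (\<lambda>b\<in>carrier A. ?mul b a)" if "a \<in> carrier A" for a
    by (rule iffD1[OF lin_cong l(2)[OF that]]) simp_all
  have e: "?mul a \<in> extensional (carrier A)" if "a \<in> carrier A" for a
    using that by (simp add: mult_of_comod_def)
  have E: "?mul \<in> carrier A \<rightarrow>\<^sub>E carrier A \<rightarrow>\<^sub>E carrier A"
    using closed by (auto simp: PiE_def e) (simp add: mult_of_comod_def)
  have u: "\<upsilon> (one H) \<in> carrier A"
    using lin_mem[OF colinear_lin[OF al_unit(1)] one_munit] .
  have "\<forall>s\<in>carrier (A \<otimes> A \<otimes> A). ?\<mu> (tensor_map (A \<otimes> A) A A A ?\<mu> id s) = ?\<mu> (tensor_map A (A \<otimes> A) A A id ?\<mu> (assoc A A A s))"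
    using al mtensor_mult_assoc_iff[OF al_comodule colinear_mult_cp m_eq] by (simp add: algebra_in_comod_def)
  then have "?\<mu> (tensor_map (A \<otimes> A) A A A ?\<mu> id ((a \<otimes>\<^bsub>A,A\<^esub> b) \<otimes>\<^bsub>A \<otimes> A,A\<^esub> c)) =
      ?\<mu> (tensor_map A (A \<otimes> A) A A id ?\<mu> (assoc A A A ((a \<otimes>\<^bsub>A,A\<^esub> b) \<otimes>\<^bsub>A \<otimes> A,A\<^esub> c)))"
    if "a \<in> carrier A" "b \<in> carrier A" "c \<in> carrier A" for a b c
    using that by simp
  then have "?mul (?mul a b) c = ?mul a (?mul b c)"
    if "a \<in> carrier A" "b \<in> carrier A" "c \<in> carrier A" for a b c
    using that by (simp add: tensor_map_pure assoc_pure lin_mult_cp closed mult_of_comod_eq[symmetric])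
  then have alg: "algebra A ?mul (\<upsilon> (one H))"
    using E l l' e u mult_of_comod_unit by (simp add: algebra_def linear_maps_iff)
  have mul: "coact A (?mul a b) = tensor_mult A ?mul H (mult H) (coact A a) (coact A b)"
    if [simp]: "a \<in> carrier A" "b \<in> carrier A" for a b
  proof -
    have "coact A (?mul a b) = tensor_map (A \<otimes> A) H A H ?\<mu> id (diag_coact H A A (a \<otimes>\<^bsub>A,A\<^esub> b))"
      using colinear_coact[OF colinear_mult_cp, of "a \<otimes>\<^bsub>A,A\<^esub> b"] by (simp add: mult_of_comod_eq)
    also have "\<dots> = tensor_mult A ?mul H (mult H) (coact A a) (coact A b)"
      unfolding tensor_map_def tensor_mult_def using lin_mem[OF lin_mult_cp]
      by (subst lift_diag_coact) (simp_all add: lin_comp[OF _ lin_mult_cp] lin_mult_cp mult_of_comod_eq)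
    finally show ?thesis .
  qed
  \<comment> \<open>The witness in A \<otimes> H_t: \<open>eps_t\<close> on the second leg of
    \<open>\<Delta>(1)\<close> lands in H_t and, by \<open>lift_one_eps_t\<close>, does not alter
    the sum.\<close>
  let ?s = "hsum (A \<otimes> H_t H) (one H) (\<lambda>p q. \<upsilon> (eps_s H p) \<otimes>\<^bsub>A,H_t H\<^esub> eps_t H q)"
  have "tensor_map A (H_t H) A H id id ?s = hsum (A \<otimes> H) (one H) (\<lambda>p q. \<upsilon> (eps_s H p) \<otimes>\<^bsub>A,H\<^esub> eps_t H q)"
    by (simp add: push tensor_map_pure)
  also have "\<dots> = coact A (\<upsilon> (one H))"
    unfolding coact_upsilon_one by (rule lift_one_eps_t[OF _ _ one_mem]) simp_all
  finally have "coact A (\<upsilon> (one H)) = tensor_map A (H_t H) A H id id ?s" ..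
  moreover have "?s \<in> carrier (A \<otimes> H_t H)"
    by simp
  ultimately have "coact A (\<upsilon> (one H)) \<in> tensor_map A (H_t H) A H id id ` carrier (A \<otimes> H_t H)"
    by (rule image_eqI)
  then show ?thesis
    using alg mul al_comodule by (simp add: comodule_algebra_def)
qed

end


text \<open>Compatibility on fixed tensors spreads to all tensors because a colinear map commutes
  with the projections and both multiplications absorb them. For the units, u is the value at 1;
  conversely the value at x is computed from the coaction of u, which f respects.\<close>

lemma algebra_hom_iff:
  assumes ca: "comodule_algebra H A mul u" and ca': "comodule_algebra H A' mul' u'"
    and f: "f \<in> comodule_homs H A A'"
  shows "algebra_hom A mul u A' mul' u' f \<longleftrightarrow>
    (\<forall>t\<in>carrier (mtensor H A A). f (mult_in_comod H A mul t) =
        mult_in_comod H A' mul' (mtensor_map H A A A' A' f f t)) \<and>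
    (\<forall>x\<in>carrier (munit H). f (unit_in_comod H A u x) = unit_in_comod H A' u' x)"
proof -
  note P = ca_pre[OF ca] and P' = ca_pre[OF ca']
  have f': "colinear H A A' f" using f by (simp add: comodule_homs_iff)
  note lf = colinear_lin[OF f']
  note [simp] = vs P P' lf lin_mem[OF lf] lin_comp[OF _ lf] lin_mul[OF ca] lin_mul[OF ca'] lin_comp[OF _ lin_mul[OF ca]]
    lin_comp[OF _ lin_mul[OF ca']] mul_closed[OF ca] mul_closed[OF ca'] unit_closed[OF ca] unit_closed[OF ca'] lin_tensor_map
  let ?mu = "tensor_lift A A A mul" and ?mu' = "tensor_lift A' A' A' mul'"
  have lhs: "(\<forall>a\<in>carrier A. \<forall>b\<in>carrier A. f (mul a b) = mul' (f a) (f b)) \<longleftrightarrow>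
    (\<forall>t\<in>carrier (A \<otimes> A). f (?mu t) = ?mu' (tensor_map A A A' A' f f t))"
  proof
    assume l: "\<forall>a\<in>carrier A. \<forall>b\<in>carrier A. f (mul a b) = mul' (f a) (f b)"
    have "f (?mu t) = ?mu' (tensor_map A A A' A' f f t)" if "t \<in> carrier (A \<otimes> A)" for t
      by (rule lin_tensor_eqI[OF _ _ _ _ _ _ that, of A']) (simp_all add: tensor_map_pure mu_pure[OF ca] mu_pure[OF ca'] l)
    then show "\<forall>t\<in>carrier (A \<otimes> A). f (?mu t) = ?mu' (tensor_map A A A' A' f f t)" ..
  next
    assume r: "\<forall>t\<in>carrier (A \<otimes> A). f (?mu t) = ?mu' (tensor_map A A A' A' f f t)"
    have "f (mul a b) = mul' (f a) (f b)" if [simp]: "a \<in> carrier A" "b \<in> carrier A" for a b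
      using r[rule_format, of "a \<otimes>\<^bsub>A,A\<^esub> b"] by (simp add: tensor_map_pure mu_pure[OF ca] mu_pure[OF ca'])
    then show "\<forall>a\<in>carrier A. \<forall>b\<in>carrier A. f (mul a b) = mul' (f a) (f b)" by blast
  qed
  have rhs: "f (mult_in_comod H A mul t) = mult_in_comod H A' mul' (mtensor_map H A A A' A' f f t) \<longleftrightarrow>
      f (?mu t) = ?mu' (tensor_map A A A' A' f f t)" if t: "t \<in> carrier (mtensor H A A)" for t
    using t colinear_mtensor_map(2,3)[OF P P P' P' f' f' t] by (simp add: mult_in_comod_def)
  \<comment> \<open>Neither side of the equation changes when t is replaced by its projection, which
    is a fixed tensor.\<close>
  have cp: "f (?mu t) = ?mu' (tensor_map A A A' A' f f t) \<longleftrightarrow>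
      f (?mu (cp A A t)) = ?mu' (tensor_map A A A' A' f f (cp A A t))" if t: "t \<in> carrier (A \<otimes> A)" for t
  proof -
    have "tensor_map A A A' A' f f (cp A A t) = cp A' A' (tensor_map A A A' A' f f t)"
      using colinear_counit_proj_commute[OF precomodule_tens[OF P P] precomodule_tens[OF P' P'] colinear_tensor_map[OF P P P' P' f' f'], of t] t
      by simp
    moreover have "?mu' (cp A' A' (tensor_map A A A' A' f f t)) = ?mu' (tensor_map A A A' A' f f t)"
      by (rule mu_cp[OF ca_comodule[OF ca'] colinear_mul[OF ca'] refl]) (simp add: t)
    moreover have "?mu (cp A A t) = ?mu t"
      by (rule mu_cp[OF ca_comodule[OF ca] colinear_mul[OF ca] refl t])
    ultimately show ?thesis by simp
  qed
  have "(\<forall>t\<in>carrier (mtensor H A A). f (?mu t) = ?mu' (tensor_map A A A' A' f f t)) \<longleftrightarrow>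
    (\<forall>t\<in>carrier (A \<otimes> A). f (?mu t) = ?mu' (tensor_map A A A' A' f f t))"
    using cp cp_mem_mtensor[OF P P] mtensor_subset[OF P P] by blast
  then have mult: "(\<forall>t\<in>carrier (mtensor H A A). f (mult_in_comod H A mul t) = mult_in_comod H A' mul' (mtensor_map H A A A' A' f f t)) \<longleftrightarrow>
    (\<forall>a\<in>carrier A. \<forall>b\<in>carrier A. f (mul a b) = mul' (f a) (f b))"
    using lhs rhs by simp
  have unit: "(\<forall>x\<in>carrier (munit H). f (unit_in_comod H A u x) = unit_in_comod H A' u' x) \<longleftrightarrow> f u = u'"
  proof
    assume "\<forall>x\<in>carrier (munit H). f (unit_in_comod H A u x) = unit_in_comod H A' u' x"
    then show "f u = u'"
      using unit_of_unit_in_comod[OF ca] unit_of_unit_in_comod[OF ca'] one_munit by metis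
  next
    assume u: "f u = u'"
    have "f (unit_in_comod H A u x) = unit_in_comod H A' u' x" if x: "x \<in> carrier (munit H)" for x
    proof -
      note [simp] = munit_mem[OF x]
      have "f (unit_in_comod H A u x) = cosum A A' u (\<lambda>u0 u1. f (scale A (counit H (mult H x u1)) u0))"
        using x by (simp add: unit_in_comod_def lift_push[where f = f and W' = A'])
      also have "\<dots> = cosum A A' u (\<lambda>u0 u1. scale A' (counit H (mult H x u1)) (f u0))"
        by (simp add: lin_scale_arg[OF lf])
      also have "\<dots> = cosum A' A' (f u) (\<lambda>u0 u1. scale A' (counit H (mult H x u1)) u0)"
        by (rule lift_coact_colinear[OF P P' _ _ f', symmetric]) simp_all
      finally show ?thesis
        using x by (simp add: unit_in_comod_def u)
    qed
    then show "\<forall>x\<in>carrier (munit H). f (unit_in_comod H A u x) = unit_in_comod H A' u' x" ..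
  qed
  show ?thesis
    unfolding mult unit using comodule_homs_linear_maps[OF f] by (auto simp: algebra_hom_def)
qed

lemma algebra_hom_compose:
  assumes A: "comodule_algebra H A mul u"
    and f: "f \<in> comodule_homs H A A'" "algebra_hom A mul u A' mul' u' f" and g: "algebra_hom A' mul' u' A'' mul'' u'' g"
    and gf: "compose (carrier A) g f \<in> comodule_homs H A A''"
  shows "algebra_hom A mul u A'' mul'' u'' (compose (carrier A) g f)"
  using assms comodule_homs_mem[OF f(1)] mul_closed[OF A] unit_closed[OF A] comodule_homs_linear_maps[OF gf]
  by (simp add: algebra_hom_def compose_eq)

lemma algebra_hom_ident:
  assumes "comodule_algebra H A mul u"
  shows "algebra_hom A mul u A mul u (\<lambda>x\<in>carrier A. x)"
  using comodule_homs_linear_maps[OF comodule_homs_ident[OF ca_pre[OF assms]]] unit_closed[OF assms] mul_closed[OF assms]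
  by (simp add: algebra_hom_def)

section \<open>Comodule Frobenius algebras\<close>

lemma category_ComodFrob: "category (ComodFrob H :: (('k, 'h, 'v) frob_obj, 'v \<Rightarrow> 'v) cat)"
proof -
  have *: "comodule_algebra H A mul u" "comodule_coalgebra H A \<Delta> \<epsilon>" "precomodule H A" "is_vspace A"
    "\<And>a. a \<in> carrier A \<Longrightarrow> \<Delta> a \<in> carrier (A \<otimes> A)"
    if "comodule_frobenius H A mul u \<Delta> \<epsilon>" for A :: "('k, 'h, 'v) comod" and mul u \<Delta> \<epsilon>
  proof -
    show c: "comodule_algebra H A mul u" "comodule_coalgebra H A \<Delta> \<epsilon>"
      using that by (simp_all add: comodule_frobenius_def)
    show "precomodule H A" "is_vspace A" "\<And>a. a \<in> carrier A \<Longrightarrow> \<Delta> a \<in> carrier (A \<otimes> A)"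
      using precomodule_C[OF c(2)] comult_C_mem[OF c(2)] by (simp_all add: vs)
  qed
  show ?thesis
    unfolding category_def ComodFrob_def
    by (auto simp: *(3-5) comodule_homs_ident coalgebra_hom_ident comodule_homs_compose[OF *(3) *(3) *(3)]
        compose_restrict_ident compose_assoc_homs
        intro: coalgebra_hom_compose[OF *(4) *(4) *(4) *(5)] algebra_hom_ident[OF *(1)]
          algebra_hom_compose[OF *(1)])
qed

lemma frobenius_in_comod_if:
  assumes fr: "comodule_frobenius H A mul u \<Delta> \<epsilon>"
  shows "frobenius_in_comod H A (mult_in_comod H A mul) (unit_in_comod H A u) \<Delta> (counit_in_comod H A \<epsilon>)"
proof -
  have ca: "comodule_algebra H A mul u" and cc: "comodule_coalgebra H A \<Delta> \<epsilon>" and f: "frobenius_algebra A mul u \<Delta> \<epsilon>"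
    using fr by (simp_all add: comodule_frobenius_def)
  have \<Delta>: "colinear H A (mtensor H A A) \<Delta>"
    using comult_homs[OF cc] by (simp add: comodule_homs_iff)
  have m: "mult_in_comod H A mul t = tensor_lift A A A mul t" if "t \<in> carrier (mtensor H A A)" for t
    using that by (simp add: mult_in_comod_def)
  show ?thesis
    unfolding frobenius_in_comod_def
  proof (intro conjI algebra_in_comod_if[OF ca] coalgebra_in_comod_if[OF cc],
      rule iffD2[OF mtensor_frobenius_iff[OF ca_comodule[OF ca] colinear_mul[OF ca] m \<Delta>]])
  qed (use f[unfolded frobenius_algebra_def Let_def, THEN conjunct2, THEN conjunct2] in blast)+
qed

text \<open>\<open>mtensor_frobenius_iff\<close> read in the other direction: \<mu> is now the lift
  of \<open>mult_of_comod H A m\<close>, which agrees with m on the product.\<close>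

lemma comodule_frobenius_if:
  assumes fr: "frobenius_in_comod H A m \<upsilon> \<Delta> \<epsilon>"
  shows "comodule_frobenius H A (mult_of_comod H A m) (\<upsilon> (one H)) \<Delta> (\<lambda>a\<in>carrier A. counit H (\<epsilon> a))"
proof -
  have al: "algebra_in_comod H A m \<upsilon>" and co: "coalgebra_in_comod H A \<Delta> \<epsilon>"
    using fr by (simp_all add: frobenius_in_comod_def)
  note ca = comodule_algebra_if[OF al] and cc = comodule_coalgebra_if[OF co]
  have m: "m t = tensor_lift A A A (mult_of_comod H A m) t" if "t \<in> carrier (mtensor H A A)" for t
    using that m_eq[OF al that] lift_mult_of_comod[OF al] mtensor_subset[OF al_pre[OF al] al_pre[OF al] that] by simp
  have "frobenius_algebra A (mult_of_comod H A m) (\<upsilon> (one H)) \<Delta> (\<lambda>a\<in>carrier A. counit H (\<epsilon> a))"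
    unfolding frobenius_algebra_def Let_def
  proof (intro conjI ca_algebra[OF ca] C_coalgebra[OF cc],
      rule iffD1[OF mtensor_frobenius_iff[OF al_comodule[OF al] colinear_mul[OF ca] m mcomult_colinear[OF co]]])
  qed (use fr[unfolded frobenius_in_comod_def, THEN conjunct2, THEN conjunct2] in blast)+
  then show ?thesis
    using ca cc by (simp add: comodule_frobenius_def)
qed

theorem ComodFrob_iso:
  "(ComodFrob H :: (('k, 'h, 'v) frob_obj, 'v \<Rightarrow> 'v) cat) \<cong> (FrobAlg H :: (('k, 'h, 'v) mfrob_obj, 'v \<Rightarrow> 'v) cat)"
proof (rule isomorphic_categoriesI[OF category_ComodFrob,
      where F = "\<lambda>(A, mul, u, \<Delta>, \<epsilon>). (A, mult_in_comod H A mul, unit_in_comod H A u, \<Delta>, counit_in_comod H A \<epsilon>)"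
      and G = "\<lambda>(A, m, \<upsilon>, \<Delta>, \<epsilon>). (A, mult_of_comod H A m, \<upsilon> (one H), \<Delta>, \<lambda>a\<in>carrier A. counit H (\<epsilon> a))"])
  have c: "comodule_algebra H A mul u" "comodule_coalgebra H A \<Delta> \<epsilon>"
    if "comodule_frobenius H A mul u \<Delta> \<epsilon>" for A :: "('k, 'h, 'v) comod" and mul u \<Delta> \<epsilon>
    using that by (simp_all add: comodule_frobenius_def)
  have d: "algebra_in_comod H A m \<upsilon>" "coalgebra_in_comod H A \<Delta> \<epsilon>"
    if "frobenius_in_comod H A m \<upsilon> \<Delta> \<epsilon>" for A :: "('k, 'h, 'v) comod" and m \<upsilon> \<Delta> \<epsilon>
    using that by (simp_all add: frobenius_in_comod_def)
  note simps = ComodFrob_def FrobAlg_def frobenius_in_comod_if comodule_frobenius_if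
    mult_of_mult_in_comod[OF c(1)] unit_of_unit_in_comod[OF c(1)] counit_counit_in_comod[OF c(2)]
    mult_in_mult_of_comod[OF d(1)] unit_in_comod_upsilon[OF d(1)] counit_in_comod_counit[OF d(2)]
    algebra_hom_iff[OF c(1) c(1)] coalgebra_hom_iff[OF c(2) c(2)]
  fix X Y Z :: "('k, 'h, 'v) frob_obj" and V :: "('k, 'h, 'v) mfrob_obj"
  let ?F = "\<lambda>(A, mul, u, \<Delta>, \<epsilon>). (A, mult_in_comod H A mul, unit_in_comod H A u, \<Delta>, counit_in_comod H A \<epsilon>) :: ('k, 'h, 'v) mfrob_obj"
  let ?G = "\<lambda>(A, m, \<upsilon>, \<Delta>, \<epsilon>). (A, mult_of_comod H A m, \<upsilon> (one H), \<Delta>, \<lambda>a\<in>carrier A. counit H (\<epsilon> a)) :: ('k, 'h, 'v) frob_obj"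
  show "?F X \<in> objs (FrobAlg H)" "?G (?F X) = X" if "X \<in> objs (ComodFrob H)"
    using that by (auto simp: simps)
  show "?G V \<in> objs (ComodFrob H)" "?F (?G V) = V" if "V \<in> objs (FrobAlg H)"
    using that by (auto simp: simps)
  show "homs (FrobAlg H) (?F X) (?F Y) = homs (ComodFrob H) X Y" if "X \<in> objs (ComodFrob H)" "Y \<in> objs (ComodFrob H)"
    using that by (auto simp: simps)
  show "ident (FrobAlg H) (?F X) = ident (ComodFrob H) X" 
    by (auto simp: simps split: prod.split)
  show "comp (FrobAlg H) (?F X) (?F Y) (?F Z) = comp (ComodFrob H) X Y Z"
    by (auto simp: simps split: prod.split)
qed

end

theorem theorem1p5:
  fixes H :: "('k::field, 'h) bialg"
  assumes "weak_bialgebra H"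
  shows "(ComodCoalg H :: (('k, 'h, 'v) coalg_obj, 'v \<Rightarrow> 'v) cat) \<cong>
           (Coalg H :: (('k, 'h, 'v) mcoalg_obj, 'v \<Rightarrow> 'v) cat) \<and>
         (ComodFrob H :: (('k, 'h, 'v) frob_obj, 'v \<Rightarrow> 'v) cat) \<cong>
           (FrobAlg H :: (('k, 'h, 'v) mfrob_obj, 'v \<Rightarrow> 'v) cat)"
proof -
  interpret weak_bialg H
    using assms by unfold_locales
  show ?thesis
    using ComodCoalg_iso ComodFrob_iso by blast
qed

end
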